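(* The Sobolev loop space $L\mathbb{P}^1=W^{1,2}(\mathbb{S}^1,\mathbb{P}^1)$ of the Riemann sphere, with its natural structure of a complex Hilbert manifold, is not biholomorphic to a closed complex submanifold of the projective Hilbert space $\mathbb{P}(l^2)$.
   Context: $l^2$ is the Hilbert space of square-summable complex sequences. A complex Hilbert manifold is a Hausdorff topological space locally homeomorphic to open subsets of a separable complex Hilbert space ($\mathbb{C}^n$ or $l^2$) with holomorphic transition maps. $\mathbb{P}(l^2)=(l^2\setminus\{0\})/(w\sim\lambda w,\ \lambda\in\mathbb{C}\setminus\{0\})$ is a complex Hilbert manifold with the affine charts $\{w_k\neq 0\}\to l^2$, $[w]\mapsto (w_j/w_k)_{j\ne k}$. A closed submanifold (projective Hilbert manifold) is a closed subset $\mathcal{M}\subset\mathbb{P}(l^2)$ such that every $m\in\mathcal{M}$ has a neighbourhood $\mathcal{U}$ and a holomorphic map $h:\mathcal{U}\to L$ to a Hilbert space, with surjective differential, such that $\mathcal{M}\cap\mathcal{U}=\{z\in\mathcal{U}:h(z)=0\}$. Loop space: $L\mathbb{P}^1=W^{1,2}(\mathbb{S}^1,\mathbb{P}^1)$ is the set of maps $\mathbb{S}^1\to\mathbb{P}^1$ of Sobolev class $W^{1,2}$ (these are continuous), with the Sobolev topology (a neighbourhood of $g$ is obtained by covering $\mathbb{S}^1$ by finitely many charts $S_j$ with $g(\bar S_j)$ contained in a coordinate chart $X_j$ of $\mathbb{P}^1$ and requiring that $h|_{S_j}$, read in these charts, be $W^{1,2}$-close to $g|_{S_j}$). Complex charts: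 for $g\in L\mathbb{P}^1$ there is a homeomorphism $G$ from a neighbourhood $U_g$ of the graph of $g$ in $\mathbb{S}^1\times\mathbb{P}^1$ onto a neighbourhood of the zero section of $g^*T\mathbb{P}^1$, sending the graph of $g$ to the zero section and, for every $s$, mapping $\{x:(s,x)\in U_g\}$ biholomorphically onto a neighbourhood of $0$ in $T_{g(s)}\mathbb{P}^1$; it is given by $G(s,x)=\sum_j\eta_j(s)\,(d\alpha_j^{-1})_{\alpha_j(g(s))}[\alpha_j(x)-\alpha_j(g(s))]$, where $(X_j,\alpha_j)$ are holomorphic charts of $\mathbb{P}^1$, $\{S_j\}$ is a finite open cover of $\mathbb{S}^1$ with $g(\bar S_j)\subset X_j$, and $\{\eta_j\}$ is a smooth partition of unity subordinate to $\{S_j\}$. The chart at $g$ is $h\mapsto G(\cdot,h(\cdot))\in W^{1,2}(\mathbb{S}^1,g^*T\mathbb{P}^1)$, defined for $h$ with graph in $U_g$. Equivalently, a map $F$ from a complex Hilbert manifold $\mathcal{X}$ to $L\mathbb{P}^1$ is holomorphic iff $z\mapsto F(z)(s)\in\mathbb{P}^1$ is holomorphic for each $s\in\mathbb{S}^1$ and $F$ is continuous for the Sobolev topology. *)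

theory Defs
  imports "HOL-Analysis.Analysis"
begin

section \<open>Complex Hilbert spaces of functions and holomorphic maps between them\<close>

text \<open>All model spaces below (\<open>\<complex>\<^sup>n\<close>, \<open>l\<^sup>2\<close> and spaces of \<open>W\<^sup>1\<^sup>,\<^sup>2\<close> sections) are complex
  vector spaces of functions \<open>'i \<Rightarrow> complex\<close> with pointwise operations, so only the
  underlying set and the norm are recorded. They vary with a base loop, hence they are
  sets and not types.\<close>

record 'i model_space =
  vecs :: "('i \<Rightarrow> complex) set"
  vnorm :: "('i \<Rightarrow> complex) \<Rightarrow> real"

definition norm_topology :: "'i model_space \<Rightarrow> ('i \<Rightarrow> complex) topology" where
  "norm_topology E = Metric_space.mtopology (vecs E) (\<lambda>x y. vnorm E (\<lambda>i. x i - y i))"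

definition bounded_clinear_on ::
    "'i model_space \<Rightarrow> 'j model_space \<Rightarrow> (('i \<Rightarrow> complex) \<Rightarrow> ('j \<Rightarrow> complex)) \<Rightarrow> bool" where
  "bounded_clinear_on E F A \<longleftrightarrow>
     A ` vecs E \<subseteq> vecs F \<and>
     (\<forall>x\<in>vecs E. \<forall>y\<in>vecs E. A (\<lambda>i. x i + y i) = (\<lambda>j. A x j + A y j)) \<and>
     (\<forall>x\<in>vecs E. \<forall>c. A (\<lambda>i. c * x i) = (\<lambda>j. c * A x j)) \<and>
     (\<exists>C. \<forall>x\<in>vecs E. vnorm F (A x) \<le> C * vnorm E x)"

definition has_cderiv ::
    "'i model_space \<Rightarrow> 'j model_space \<Rightarrow> (('i \<Rightarrow> complex) \<Rightarrow> ('j \<Rightarrow> complex)) \<Rightarrow>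
     (('i \<Rightarrow> complex) \<Rightarrow> ('j \<Rightarrow> complex)) \<Rightarrow> ('i \<Rightarrow> complex) \<Rightarrow> bool" where
  "has_cderiv E F f A x \<longleftrightarrow>
     bounded_clinear_on E F A \<and>
     (\<forall>e>0. \<exists>d>0. \<forall>y\<in>vecs E. vnorm E (\<lambda>i. y i - x i) < d \<longrightarrow>
        vnorm F (\<lambda>j. f y j - f x j - A (\<lambda>i. y i - x i) j) \<le> e * vnorm E (\<lambda>i. y i - x i))"

definition holomorphic_between ::
    "'i model_space \<Rightarrow> 'j model_space \<Rightarrow> ('i \<Rightarrow> complex) set \<Rightarrow>
     (('i \<Rightarrow> complex) \<Rightarrow> ('j \<Rightarrow> complex)) \<Rightarrow> bool" where
  "holomorphic_between E F U f \<longleftrightarrow>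
     openin (norm_topology E) U \<and> f ` U \<subseteq> vecs F \<and> (\<forall>x\<in>U. \<exists>A. has_cderiv E F f A x)"


section \<open>Complex Hilbert manifolds\<close>

record ('p, 'i) chart =
  cdom :: "'p set"
  cmap :: "'p \<Rightarrow> ('i \<Rightarrow> complex)"
  cspace :: "'i model_space"

record ('p, 'i) hilbert_manifold =
  mtop :: "'p topology"
  atlas :: "('p, 'i) chart set"

definition chart_inv :: "('p, 'i) chart \<Rightarrow> ('i \<Rightarrow> complex) \<Rightarrow> 'p" where
  "chart_inv c = inv_into (cdom c) (cmap c)"

text \<open>\<open>f\<close> is holomorphic on the open subset \<open>D\<close> of \<open>X\<close>, with values in \<open>Y\<close>.\<close>

definition holomorphic_map ::
    "('p, 'i) hilbert_manifold \<Rightarrow> ('q, 'j) hilbert_manifold \<Rightarrow> 'p set \<Rightarrow> ('p \<Rightarrow> 'q) \<Rightarrow> bool" where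
  "holomorphic_map X Y D f \<longleftrightarrow>
     openin (mtop X) D \<and>
     continuous_map (subtopology (mtop X) D) (mtop Y) f \<and>
     (\<forall>c\<in>atlas X. \<forall>c'\<in>atlas Y.
        holomorphic_between (cspace c) (cspace c')
          (cmap c ` {p \<in> D \<inter> cdom c. f p \<in> cdom c'})
          (cmap c' \<circ> f \<circ> chart_inv c))"

definition manifold_of_space :: "'i model_space \<Rightarrow> ('i \<Rightarrow> complex, 'i) hilbert_manifold" where
  "manifold_of_space E =
     \<lparr>mtop = norm_topology E, atlas = {\<lparr>cdom = vecs E, cmap = (\<lambda>x. x), cspace = E\<rparr>}\<rparr>"

definition surjective_differential ::
    "('p, 'i) hilbert_manifold \<Rightarrow> 'j model_space \<Rightarrow> ('p \<Rightarrow> ('j \<Rightarrow> complex)) \<Rightarrow> 'p \<Rightarrow> bool" where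
  "surjective_differential X L h z \<longleftrightarrow>
     (\<forall>c\<in>atlas X. z \<in> cdom c \<longrightarrow>
        (\<exists>A. has_cderiv (cspace c) L (h \<circ> chart_inv c) A (cmap c z) \<and>
             A ` vecs (cspace c) = vecs L))"


section \<open>Separable Hilbert spaces and projective Hilbert space\<close>

definition l2 :: "nat model_space" where
  "l2 = \<lparr>vecs = {x. summable (\<lambda>n. (cmod (x n))\<^sup>2)},
         vnorm = (\<lambda>x. sqrt (\<Sum>n. (cmod (x n))\<^sup>2))\<rparr>"

definition Cn :: "nat \<Rightarrow> nat model_space" where
  "Cn n = \<lparr>vecs = {x. \<forall>j\<ge>n. x j = 0}, vnorm = (\<lambda>x. sqrt (\<Sum>j<n. (cmod (x j))\<^sup>2))\<rparr>"

definition proj_rel :: "((nat \<Rightarrow> complex) \<times> (nat \<Rightarrow> complex)) set" where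
  "proj_rel = {(w, w'). w \<in> vecs l2 - {\<lambda>_. 0} \<and> w' \<in> vecs l2 - {\<lambda>_. 0} \<and>
                        (\<exists>c. c \<noteq> 0 \<and> w' = (\<lambda>j. c * w j))}"

definition proj_points :: "(nat \<Rightarrow> complex) set set" where
  "proj_points = (vecs l2 - {\<lambda>_. 0}) // proj_rel"

text \<open>Quotient topology; \<open>\<Union>U\<close> is the preimage of \<open>U\<close> in \<open>l\<^sup>2 - {0}\<close>.\<close>

definition proj_topology :: "(nat \<Rightarrow> complex) set topology" where
  "proj_topology = topology (\<lambda>U. U \<subseteq> proj_points \<and> openin (norm_topology l2) (\<Union>U))"

text \<open>The family \<open>(w\<^sub>j / w\<^sub>k)\<close>, \<open>j \<noteq> k\<close>, is renumbered by \<open>nat\<close> by skipping the index \<open>k\<close>.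
  The value does not depend on the representative \<open>w\<close>.\<close>

definition affine_chart :: "nat \<Rightarrow> ((nat \<Rightarrow> complex) set, nat) chart" where
  "affine_chart k =
     \<lparr>cdom = {p \<in> proj_points. \<forall>w\<in>p. w k \<noteq> 0},
      cmap = (\<lambda>p. let w = (SOME w. w \<in> p) in (\<lambda>j. w (if j < k then j else Suc j) / w k)),
      cspace = l2\<rparr>"

definition proj_l2 :: "((nat \<Rightarrow> complex) set, nat) hilbert_manifold" where
  "proj_l2 = \<lparr>mtop = proj_topology, atlas = range affine_chart\<rparr>"

definition closed_submanifold ::
    "('p, 'i) hilbert_manifold \<Rightarrow> 'p set \<Rightarrow> bool" where
  "closed_submanifold Y M \<longleftrightarrow>
     closedin (mtop Y) M \<and>
     (\<forall>m\<in>M. \<exists>U L h. m \<in> U \<and> L \<in> insert l2 (range Cn) \<and>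
        holomorphic_map Y (manifold_of_space L) U h \<and>
        (\<forall>z\<in>U. surjective_differential Y L h z) \<and>
        M \<inter> U = {z\<in>U. h z = (\<lambda>_. 0)})"

text \<open>A map out of a submanifold \<open>M\<close> of \<open>Y\<close> is holomorphic if it is locally the restriction of a
  holomorphic map on an open subset of \<open>Y\<close>; a map into \<open>M\<close> is holomorphic if it is holomorphic
  as a map into \<open>Y\<close>.\<close>

definition holomorphic_on_submanifold ::
    "('q, 'j) hilbert_manifold \<Rightarrow> 'q set \<Rightarrow> ('p, 'i) hilbert_manifold \<Rightarrow> ('q \<Rightarrow> 'p) \<Rightarrow> bool" where
  "holomorphic_on_submanifold Y M X k \<longleftrightarrow>
     (\<forall>m\<in>M. \<exists>U k'. m \<in> U \<and> holomorphic_map Y X U k' \<and> (\<forall>z\<in>M \<inter> U. k' z = k z))"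

definition biholomorphic_to_submanifold ::
    "('p, 'i) hilbert_manifold \<Rightarrow> ('q, 'j) hilbert_manifold \<Rightarrow> 'q set \<Rightarrow> bool" where
  "biholomorphic_to_submanifold X Y M \<longleftrightarrow>
     (\<exists>f. bij_betw f (topspace (mtop X)) M \<and>
          holomorphic_map X Y (topspace (mtop X)) f \<and>
          holomorphic_on_submanifold Y M X (inv_into (topspace (mtop X)) f))"


section \<open>The circle and Sobolev functions on its open subsets\<close>

typedef circle = "sphere (0 :: complex) 1"
  by (rule exI[of _ 1]) simp

definition circ :: "real \<Rightarrow> circle" where
  "circ t = Abs_circle (cis t)"

instantiation circle :: topological_space
begin

definition open_circle :: "circle set \<Rightarrow> bool" where
  "open_circle U \<longleftrightarrow> open (circ -` U)"

instance
  by standard (auto simp: open_circle_def vimage_Union intro: open_Int)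

end

definition smooth_circle :: "(circle \<Rightarrow> real) \<Rightarrow> bool" where
  "smooth_circle \<phi> \<longleftrightarrow> (\<forall>k t. (deriv ^^ k) (\<phi> \<circ> circ) field_differentiable (at t))"

definition angles :: "circle set \<Rightarrow> real set" where
  "angles S = {t \<in> {0..<2 * pi}. circ t \<in> S}"

definition square_integrable_on :: "circle set \<Rightarrow> (circle \<Rightarrow> complex) \<Rightarrow> bool" where
  "square_integrable_on S f \<longleftrightarrow>
     set_borel_measurable lborel (angles S) (f \<circ> circ) \<and>
     set_integrable lborel (angles S) (\<lambda>t. (cmod (f (circ t)))\<^sup>2)"

definition weak_derivative_on ::
    "circle set \<Rightarrow> (circle \<Rightarrow> complex) \<Rightarrow> (circle \<Rightarrow> complex) \<Rightarrow> bool" where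
  "weak_derivative_on S f u \<longleftrightarrow>
     (\<forall>\<phi>. smooth_circle \<phi> \<and> closure {s. \<phi> s \<noteq> 0} \<subseteq> S \<longrightarrow>
        (LINT t:{0..<2 * pi}|lborel. f (circ t) * of_real (deriv (\<phi> \<circ> circ) t)) =
        - (LINT t:{0..<2 * pi}|lborel. u (circ t) * of_real (\<phi> (circ t))))"

text \<open>\<open>W\<^sup>1\<^sup>,\<^sup>2(S)\<close> for an open subset \<open>S\<close> of the circle; elements are identified with their
  continuous representatives.\<close>

definition W12 :: "circle set \<Rightarrow> (circle \<Rightarrow> complex) \<Rightarrow> bool" where
  "W12 S f \<longleftrightarrow>
     continuous_on S f \<and> square_integrable_on S f \<and>
     (\<exists>u. square_integrable_on S u \<and> weak_derivative_on S f u)"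

definition some_weak_derivative :: "circle set \<Rightarrow> (circle \<Rightarrow> complex) \<Rightarrow> (circle \<Rightarrow> complex)" where
  "some_weak_derivative S f = (SOME u. square_integrable_on S u \<and> weak_derivative_on S f u)"

definition W12_norm :: "circle set \<Rightarrow> (circle \<Rightarrow> complex) \<Rightarrow> real" where
  "W12_norm S f =
     sqrt ((LINT t:angles S|lborel. (cmod (f (circ t)))\<^sup>2) +
           (LINT t:angles S|lborel. (cmod (some_weak_derivative S f (circ t)))\<^sup>2))"


section \<open>The Riemann sphere\<close>

datatype riemann_sphere = Aff complex | Infinity

definition at_infinity_param :: "complex \<Rightarrow> riemann_sphere" where
  "at_infinity_param w = (if w = 0 then Infinity else Aff (1 / w))"

instantiation riemann_sphere :: topological_space
begin

definition open_riemann_sphere :: "riemann_sphere set \<Rightarrow> bool" where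
  "open_riemann_sphere U \<longleftrightarrow> open (Aff -` U) \<and> open (at_infinity_param -` U)"

instance
  by standard (auto simp: open_riemann_sphere_def vimage_Union intro: open_Int)

end

text \<open>Holomorphic charts \<open>(X, \<alpha>)\<close>: an injective holomorphic function on an open set is
  biholomorphic onto its (open) image.\<close>

definition P1_chart :: "riemann_sphere set \<Rightarrow> (riemann_sphere \<Rightarrow> complex) \<Rightarrow> bool" where
  "P1_chart X \<alpha> \<longleftrightarrow>
     open X \<and> inj_on \<alpha> X \<and>
     (\<alpha> \<circ> Aff) holomorphic_on (Aff -` X) \<and>
     (\<alpha> \<circ> at_infinity_param) holomorphic_on (at_infinity_param -` X)"

text \<open>The tangent space at every point is identified with \<open>\<complex>\<close> by the coordinate \<open>z\<close> at the finite
  points and by the coordinate \<open>1 / z\<close> at infinity. With this convention the differential of \<open>\<alpha>\<close>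
  at \<open>p\<close> is multiplication by \<open>chart_diff \<alpha> p\<close>. (The bundle is not trivialized by this: its
  topology is given by \<open>pullback_bundle_topology\<close> below.)\<close>

definition chart_diff :: "(riemann_sphere \<Rightarrow> complex) \<Rightarrow> riemann_sphere \<Rightarrow> complex" where
  "chart_diff \<alpha> p =
     (case p of Aff z \<Rightarrow> deriv (\<alpha> \<circ> Aff) z | Infinity \<Rightarrow> deriv (\<alpha> \<circ> at_infinity_param) 0)"


section \<open>The loop space\<close>

definition W12_loops :: "(circle \<Rightarrow> riemann_sphere) set" where
  "W12_loops = {g. continuous_on UNIV g \<and>
     (\<forall>X \<alpha> S. P1_chart X \<alpha> \<and> open S \<and> g ` closure S \<subseteq> X \<longrightarrow> W12 S (\<alpha> \<circ> g))}"

definition adapted_cover ::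
    "(circle \<Rightarrow> riemann_sphere) \<Rightarrow> nat \<Rightarrow> (nat \<Rightarrow> circle set) \<Rightarrow> (nat \<Rightarrow> riemann_sphere set) \<Rightarrow>
     (nat \<Rightarrow> riemann_sphere \<Rightarrow> complex) \<Rightarrow> bool" where
  "adapted_cover g n S X \<alpha> \<longleftrightarrow>
     (\<forall>j<n. open (S j) \<and> P1_chart (X j) (\<alpha> j) \<and> g ` closure (S j) \<subseteq> X j) \<and>
     (\<Union>j<n. S j) = UNIV"

definition sobolev_nbhd ::
    "(circle \<Rightarrow> riemann_sphere) \<Rightarrow> nat \<Rightarrow> (nat \<Rightarrow> circle set) \<Rightarrow> (nat \<Rightarrow> riemann_sphere set) \<Rightarrow>
     (nat \<Rightarrow> riemann_sphere \<Rightarrow> complex) \<Rightarrow> real \<Rightarrow> (circle \<Rightarrow> riemann_sphere) set" where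
  "sobolev_nbhd g n S X \<alpha> e =
     {h \<in> W12_loops. \<forall>j<n. h ` closure (S j) \<subseteq> X j \<and>
        W12_norm (S j) (\<lambda>s. \<alpha> j (h s) - \<alpha> j (g s)) < e}"

definition sobolev_topology :: "(circle \<Rightarrow> riemann_sphere) topology" where
  "sobolev_topology = topology_generated_by
     {sobolev_nbhd g n S X \<alpha> e | g n S X \<alpha> e. g \<in> W12_loops \<and> adapted_cover g n S X \<alpha> \<and> 0 < e}"

text \<open>The total space of \<open>g\<^sup>*TP\<^sup>1\<close> is \<open>circle \<times> complex\<close> as a set. A chart \<open>(X, \<alpha>)\<close> trivializes it over
  \<open>g\<^sup>-\<^sup>1(X)\<close>, with inverse trivialization \<open>(s, w) \<mapsto> (s, w / chart_diff \<alpha> (g s))\<close>.\<close>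

definition pullback_bundle_topology ::
    "(circle \<Rightarrow> riemann_sphere) \<Rightarrow> (circle \<times> complex) topology" where
  "pullback_bundle_topology g = topology (\<lambda>W. \<forall>X \<alpha>. P1_chart X \<alpha> \<longrightarrow>
     open {(s, w). g s \<in> X \<and> (s, w / chart_diff \<alpha> (g s)) \<in> W})"

text \<open>\<open>W\<^sup>1\<^sup>,\<^sup>2\<close> sections of \<open>g\<^sup>*TP\<^sup>1\<close>. Up to equivalence, the norm does not depend on the cover.\<close>

definition W12_sections ::
    "(circle \<Rightarrow> riemann_sphere) \<Rightarrow> nat \<Rightarrow> (nat \<Rightarrow> circle set) \<Rightarrow>
     (nat \<Rightarrow> riemann_sphere \<Rightarrow> complex) \<Rightarrow> circle model_space" where
  "W12_sections g n S \<alpha> =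
     \<lparr>vecs = {\<xi>. \<forall>X \<beta> T. P1_chart X \<beta> \<and> open T \<and> g ` closure T \<subseteq> X \<longrightarrow>
                W12 T (\<lambda>s. chart_diff \<beta> (g s) * \<xi> s)},
      vnorm = (\<lambda>\<xi>. sqrt (\<Sum>j<n. (W12_norm (S j) (\<lambda>s. chart_diff (\<alpha> j) (g s) * \<xi> s))\<^sup>2))\<rparr>"

definition smooth_partition ::
    "nat \<Rightarrow> (nat \<Rightarrow> circle set) \<Rightarrow> (nat \<Rightarrow> circle \<Rightarrow> real) \<Rightarrow> bool" where
  "smooth_partition n S \<eta> \<longleftrightarrow>
     (\<forall>j<n. smooth_circle (\<eta> j) \<and> (\<forall>s. 0 \<le> \<eta> j s) \<and> closure {s. \<eta> j s \<noteq> 0} \<subseteq> S j) \<and>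
     (\<forall>s. (\<Sum>j<n. \<eta> j s) = 1)"

definition loop_G ::
    "(circle \<Rightarrow> riemann_sphere) \<Rightarrow> nat \<Rightarrow> (nat \<Rightarrow> riemann_sphere \<Rightarrow> complex) \<Rightarrow>
     (nat \<Rightarrow> circle \<Rightarrow> real) \<Rightarrow> circle \<Rightarrow> riemann_sphere \<Rightarrow> complex" where
  "loop_G g n \<alpha> \<eta> s x =
     (\<Sum>j<n. of_real (\<eta> j s) * ((\<alpha> j x - \<alpha> j (g s)) / chart_diff (\<alpha> j) (g s)))"

text \<open>The condition \<open>\<eta> j s \<noteq> 0 \<longrightarrow> x \<in> X j\<close> says that the formula for \<open>G\<close> makes sense on \<open>U\<close>.\<close>

definition admissible_nbhd ::
    "(circle \<Rightarrow> riemann_sphere) \<Rightarrow> nat \<Rightarrow> (nat \<Rightarrow> riemann_sphere set) \<Rightarrow>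
     (nat \<Rightarrow> riemann_sphere \<Rightarrow> complex) \<Rightarrow> (nat \<Rightarrow> circle \<Rightarrow> real) \<Rightarrow>
     (circle \<times> riemann_sphere) set \<Rightarrow> bool" where
  "admissible_nbhd g n X \<alpha> \<eta> U \<longleftrightarrow>
     open U \<and> (\<forall>s. (s, g s) \<in> U) \<and>
     (\<forall>(s, x)\<in>U. \<forall>j<n. \<eta> j s \<noteq> 0 \<longrightarrow> x \<in> X j) \<and>
     (let G = (\<lambda>(s, x). (s, loop_G g n \<alpha> \<eta> s x)) in
        openin (pullback_bundle_topology g) (G ` U) \<and>
        homeomorphic_map (top_of_set U) (subtopology (pullback_bundle_topology g) (G ` U)) G) \<and>
     (\<forall>s. P1_chart {x. (s, x) \<in> U} (loop_G g n \<alpha> \<eta> s))"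

definition loop_charts :: "(circle \<Rightarrow> riemann_sphere, circle) chart set" where
  "loop_charts =
     {\<lparr>cdom = {h \<in> W12_loops. \<forall>s. (s, h s) \<in> U},
       cmap = (\<lambda>h s. loop_G g n \<alpha> \<eta> s (h s)),
       cspace = W12_sections g n S \<alpha>\<rparr> | g n S X \<alpha> \<eta> U.
      g \<in> W12_loops \<and> adapted_cover g n S X \<alpha> \<and> smooth_partition n S \<eta> \<and>
      admissible_nbhd g n X \<alpha> \<eta> U}"

definition loop_space_P1 :: "(circle \<Rightarrow> riemann_sphere, circle) hilbert_manifold" where
  "loop_space_P1 = \<lparr>mtop = sobolev_topology, atlas = loop_charts\<rparr>"

end

theory Submission
  imports Defs "HOL-Complex_Analysis.Complex_Analysis" "HOL-Computational_Algebra.Computational_Algebra"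
begin

text \<open>No holomorphic map \<open>f\<close> from the loop space to \<open>P(l\<^sup>2)\<close> is injective. For an invertible loop
  \<open>a\<close> the curve \<open>x \<mapsto> f (x a)\<close> extends to \<open>P\<^sup>1\<close>, hence has a polynomial lift \<open>P\<close>, normalized by
  \<open>P\<^sub>d(0) = 1\<close> for one homogeneous coordinate \<open>d\<close>. Along a complex line \<open>a + t b\<close> its degree \<open>D\<close> is constant and
  its coefficients are polynomials in \<open>t\<close>: the Taylor coefficients of the affine coordinates at
  \<open>x = 0\<close> are, and the denominator spans the kernel of a linear system in them. Its leading coefficient
  \<open>U\<close> does not vanish at invertible loops. For nonnegative bumps with disjoint supports this makes
  \<open>t \<mapsto> U (1 + t b) / U (1)\<close> multiplicative in \<open>b\<close>, so among \<open>D + 1\<close> bumps one has constant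
  \<open>U (1 + t b)\<close>. If moreover \<open>b\<close> is an \<open>n\<close>-th power with \<open>n > D\<close>, then \<open>1 / (1 + t b)\<close> grows only like
  \<open>t\<^sup>1\<^sup>/\<^sup>n\<close>; estimates near \<open>x = \<infinity>\<close> show that all coefficients of \<open>P\<close> are constant in \<open>t\<close>, and
  \<open>f (1 + b) = f (1)\<close>.\<close>

section \<open>Complex polynomials\<close>

text \<open>The curve x |-> f (x a) closes up at x = infinity because x a, read in the chart around
  the constant loop infinity, is (1/x)(1/a), which tends to 0 in the C^1 norm. How large x has to be
  depends only on the C^1 norm of 1/a; this is why the growth of 1/(1 + t b) decides the last step.

  The obstacle is that a lift exists for each t separately, with no bound on the degrees. The link
  between different t is the linear system for the denominator: its entries are polynomials in t
  because the Taylor coefficients at x = 0 make sense for all t, even where a + t b has zeros. A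
  generic solution could still acquire a common factor or drop its degree at special t. Zero-free
  neighbourhoods that persist under small changes of t exclude both.

  For b = beta^n and y = t^(1/n) beta, the derivative of 1/(1 + t b) is, up to sign, t^(1/n) beta'
  times n y^(n-1) / (1 + y^n)^2, and the factor in y is bounded. The coefficient of index i in the
  lift is then O(t^((D-i)/n)). The exponent is below 1, so this polynomial in t is constant.\<close>

text \<open>Fraction-free Gaussian elimination by induction on the number of columns. The family of
  equations may be infinite: a single pivot in the last column suffices, and its finitely many roots
  are removed from \<open>S\<close>.\<close>

lemma generic_kernel_vector:
  fixes r :: "'r \<Rightarrow> nat \<Rightarrow> 'a::{idom,ring_char_0} poly"
  assumes "infinite S"
    and "\<And>t. t \<in> S \<Longrightarrow> \<exists>c. (\<exists>k<n. c k \<noteq> 0) \<and> (\<forall>i. (\<Sum>k<n. c k * poly (r i k) t) = 0)"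
  shows "\<exists>A. (\<exists>k<n. A k \<noteq> 0) \<and> (\<forall>i. (\<Sum>k<n. A k * r i k) = 0)"
  using assms
proof (induction n arbitrary: r S)
  case 0
  then obtain t where "t \<in> S" by (metis finite.emptyI all_not_in_conv)
  from 0(2)[OF this] show ?case by auto
next
  case (Suc n)
  show ?case
  proof (cases "\<forall>i. r i n = 0")
    case True
    then show ?thesis by (intro exI[of _ "\<lambda>k. if k = n then 1 else 0"]) auto
  next
    case False
    then obtain i0 where i0: "r i0 n \<noteq> 0" by auto
    define r' where "r' = (\<lambda>i k. r i0 n * r i k - r i n * r i0 k)"
    define S' where "S' = S - {t. poly (r i0 n) t = 0}"
    have "infinite S'"
      unfolding S'_def using Suc.prems(1) poly_roots_finite[OF i0] by (rule Diff_infinite_finite[rotated])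
    have ker: "\<exists>c. (\<exists>k<n. c k \<noteq> 0) \<and> (\<forall>i. (\<Sum>k<n. c k * poly (r' i k) t) = 0)" if t: "t \<in> S'" for t
    proof -
      from t have "t \<in> S" and piv: "poly (r i0 n) t \<noteq> 0" by (auto simp: S'_def)
      from Suc.prems(2)[OF \<open>t \<in> S\<close>] obtain c where
        c: "\<exists>k<Suc n. c k \<noteq> 0" and z: "\<And>i. (\<Sum>k<n. c k * poly (r i k) t) + c n * poly (r i n) t = 0" by auto
      have "\<exists>k<n. c k \<noteq> 0"
      proof (rule ccontr)
        assume "\<not> ?thesis"
        then have 0: "\<And>k. k < n \<Longrightarrow> c k = 0" by auto
        then have "(\<Sum>k<n. c k * poly (r i0 k) t) = 0" by simp
        with z[of i0] piv have "c n = 0" by simp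
        with 0 c show False by (metis less_Suc_eq)
      qed
      moreover have "(\<Sum>k<n. c k * poly (r' i k) t) = 0" for i
      proof -
        have "(\<Sum>k<n. c k * poly (r' i k) t) =
            poly (r i0 n) t * (\<Sum>k<n. c k * poly (r i k) t) - poly (r i n) t * (\<Sum>k<n. c k * poly (r i0 k) t)"
          by (simp add: r'_def sum_distrib_left sum_subtractf[symmetric] algebra_simps)
        also have "\<dots> = poly (r i0 n) t * (- c n * poly (r i n) t) - poly (r i n) t * (- c n * poly (r i0 n) t)"
          using z[of i] z[of i0] by (simp only: add_eq_0_iff2 mult_minus_left)
        also have "\<dots> = 0" by (simp add: algebra_simps)
        finally show ?thesis .
      qed
      ultimately show ?thesis by blast
    qed
    from Suc.IH[OF \<open>infinite S'\<close> ker] obtain A where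
      A: "\<exists>k<n. A k \<noteq> 0" "\<And>i. (\<Sum>k<n. A k * r' i k) = 0" by blast
    \<comment> \<open>Back substitution multiplied through by the pivot, so that no polynomial has
      to be divided.\<close>
    define B where "B = (\<lambda>k. if k < n then r i0 n * A k else - (\<Sum>k<n. A k * r i0 k))"
    have "(\<Sum>k<Suc n. B k * r i k) = 0" for i
    proof -
      have "(\<Sum>k<Suc n. B k * r i k) = (\<Sum>k<n. r i0 n * A k * r i k) - (\<Sum>k<n. A k * r i0 k) * r i n"
        by (simp add: B_def)
      also have "\<dots> = (\<Sum>k<n. A k * r' i k)"
        by (simp add: r'_def sum_distrib_left sum_distrib_right sum_subtractf[symmetric] algebra_simps)
      finally show ?thesis using A(2) by simp
    qed
    moreover have "\<exists>k<Suc n. B k \<noteq> 0"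
      using A(1) i0 by (auto simp: B_def intro: less_SucI)
    ultimately show ?thesis by blast
  qed
qed

section \<open>Roots, growth and divisibility\<close>

lemma poly_linear_factor:
  fixes q :: "'a::comm_ring_1 poly"
  shows "poly ([:-w, 1:] * q) x = (x - w) * poly q x"
  by (simp add: algebra_simps)

lemma complex_poly_root_factor:
  fixes p :: "complex poly"
  assumes "degree p = Suc n"
  obtains w q where "p = [:-w, 1:] * q" "poly p w = 0" "degree q = n"
proof -
  obtain w where w: "poly p w = 0" using alg_closed_imp_poly_has_root[of p] assms by auto
  then obtain q where q: "p = [:-w, 1:] * q" by (metis poly_eq_0_iff_dvd dvdE)
  have "q \<noteq> 0" using assms q by auto
  then have "degree p = Suc (degree q)" unfolding q by (subst degree_mult_eq) auto
  then show ?thesis using that w q assms by simp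
qed

text \<open>A root \<open>w\<close> has distance at least \<open>r\<close> from \<open>z\<close>,
  while \<open>x\<close> is closer than \<open>r\<close>, so each linear factor satisfies |x - w|
  \<le> 2 |z - w|. The product over all roots gives the power of 2.\<close>

lemma norm_poly_le_of_no_root_ball:
  fixes p :: "complex poly"
  assumes "\<And>x. dist z x < r \<Longrightarrow> poly p x \<noteq> 0" "dist z x < r"
  shows "cmod (poly p x) \<le> 2 ^ degree p * cmod (poly p z)"
  using assms(1)
proof (induction "degree p" arbitrary: p)
  case 0
  then obtain a where "p = [:a:]" by (metis degree_eq_zeroE)
  then show ?case by simp
next
  case (Suc n)
  from complex_poly_root_factor[OF Suc.hyps(2)[symmetric]]
  obtain w q where q: "p = [:-w, 1:] * q" and "poly p w = 0" and deg: "degree p = Suc (degree q)"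
    using Suc.hyps(2) by metis
  have w: "r \<le> dist z w" using Suc.prems[of w] \<open>poly p w = 0\<close> by force
  have IH: "cmod (poly q x) \<le> 2 ^ degree q * cmod (poly q z)"
    by (rule Suc.hyps(1)) (use Suc.prems Suc.hyps(2) deg q in auto)
  have "cmod (x - w) \<le> 2 * cmod (z - w)"
    using w assms(2) dist_triangle[of x w z] by (simp add: dist_norm norm_minus_commute)
  then have "cmod (x - w) * cmod (poly q x) \<le> (2 * cmod (z - w)) * (2 ^ degree q * cmod (poly q z))"
    using IH by (intro mult_mono) auto
  then show ?case unfolding deg by (simp only: q poly_linear_factor norm_mult) (simp add: mult_ac)
qed

lemma coeff_eq_higher_deriv:
  fixes p :: "complex poly"
  shows "coeff p n = (deriv ^^ n) (poly p) 0 / fact n"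
proof -
  have "(deriv ^^ n) (poly p) = poly ((pderiv ^^ n) p)"
    by (induction n) (auto intro: DERIV_imp_deriv poly_DERIV)
  moreover have "poly ((pderiv ^^ n) p) 0 = fact n * coeff p n"
    by (simp add: poly_0_coeff_0 coeff_higher_pderiv pochhammer_fact)
  ultimately show ?thesis by simp
qed

lemma poly_coeff_cauchy_bound:
  fixes p :: "complex poly"
  assumes "0 < r" "\<And>x. cmod x < r \<Longrightarrow> cmod (poly p x) \<le> K"
  shows "cmod (coeff p n) \<le> K / r ^ n"
proof -
  have *: "cmod (coeff p n) * s ^ n \<le> K" if "0 < s" "s < r" for s
  proof -
    have "norm ((deriv ^^ n) (poly p) 0) \<le> fact n * K / s ^ n"
      by (rule Cauchy_inequality) (use that assms in \<open>auto intro!: holomorphic_intros continuous_intros\<close>)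
    then show ?thesis using that
      by (simp add: coeff_eq_higher_deriv norm_divide field_simps)
  qed
  \<comment> \<open>The hypothesis concerns the open disc only, so the estimate at radius
    \<open>r\<close> is a limit of those at smaller radii.\<close>
  have "((\<lambda>s. cmod (coeff p n) * s ^ n) \<longlongrightarrow> cmod (coeff p n) * r ^ n) (at_left r)"
    by (intro tendsto_intros)
  moreover have "eventually (\<lambda>s. cmod (coeff p n) * s ^ n \<le> K) (at_left r)"
    using eventually_at_left_real[OF assms(1)] by eventually_elim (use * in auto)
  ultimately have "cmod (coeff p n) * r ^ n \<le> K"
    by (rule tendsto_upperbound) simp
  then show ?thesis using assms(1) by (simp add: field_simps)
qed

lemma degree_le_of_growth:
  fixes q :: "complex poly"
  assumes "\<And>t. cmod (poly q t) \<le> C * (1 + cmod t) ^ n"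
  shows "degree q \<le> n"
proof -
  have "0 \<le> C" using order.trans[OF norm_ge_zero assms[of 0]] by simp
  have "poly q t = (\<Sum>k\<le>n. (deriv^^k) (poly q) 0 / fact k * t ^ k)" for t
  proof (rule Liouville_polynomial)
    fix z :: complex assume "1 \<le> norm z"
    then have "(1 + cmod z) ^ n \<le> (2 * cmod z) ^ n" by (intro power_mono) auto
    then show "norm (poly q z) \<le> C * 2 ^ n * norm z ^ n"
      using assms[of z] mult_left_mono[OF _ \<open>0 \<le> C\<close>] by (fastforce simp: power_mult_distrib)
  qed (auto intro: holomorphic_intros)
  then have "poly q = poly (\<Sum>k\<le>n. monom (coeff q k) k)"
    by (simp add: fun_eq_iff poly_sum poly_monom flip: coeff_eq_higher_deriv)
  then have "q = (\<Sum>k\<le>n. monom (coeff q k) k)" by (simp add: poly_eq_poly_eq_iff)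
  moreover have "degree (\<Sum>k\<le>n. monom (coeff q k) k) \<le> n"
    by (intro degree_sum_le) (auto intro: order.trans[OF degree_monom_le])
  ultimately show ?thesis by simp
qed

text \<open>At a root of \<open>q\<close> the inequality forces \<open>p\<close> to vanish, so one
  linear factor is cancelled at a time and multiplicities take care of themselves. At the cancelled
  root the inequality is restored by continuity. Once \<open>q\<close> is constant, the growth
  bounds the degree.\<close>

lemma poly_divide_of_growth:
  fixes p q :: "complex poly"
  assumes "q \<noteq> 0" "\<And>t. cmod (poly p t) \<le> C * (1 + cmod t) ^ n * cmod (poly q t)"
  shows "\<exists>s. p = s * q \<and> degree s \<le> n"
  using assms
proof (induction "degree q" arbitrary: p q)
  case 0
  then obtain a where a: "q = [:a:]" by (metis degree_eq_zeroE)
  then have "a \<noteq> 0" using 0 by auto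
  have "degree (smult (1/a) p) \<le> n"
  proof (rule degree_le_of_growth)
    fix t show "cmod (poly (smult (1 / a) p) t) \<le> C * (1 + cmod t) ^ n"
      using 0(3)[of t] \<open>a \<noteq> 0\<close> a by (simp add: norm_mult norm_divide field_simps)
  qed
  then show ?case using a \<open>a \<noteq> 0\<close> by (intro exI[of _ "smult (1/a) p"]) simp
next
  case (Suc d)
  from complex_poly_root_factor[OF Suc.hyps(2)[symmetric]]
  obtain w q' where q': "q = [:-w, 1:] * q'" and w: "poly q w = 0" and deg: "degree q = Suc (degree q')"
    using Suc.hyps(2) by metis
  have "poly p w = 0" using Suc.prems(2)[of w] w by simp
  then obtain p' where p': "p = [:-w, 1:] * p'" by (metis poly_eq_0_iff_dvd dvdE)
  have "q' \<noteq> 0" using Suc.prems q' by auto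
  have off: "cmod (poly p' t) \<le> C * (1 + cmod t) ^ n * cmod (poly q' t)" if "t \<noteq> w" for t
    using Suc.prems(2)[of t] that by (simp only: p' q' poly_linear_factor norm_mult) (simp add: mult.left_commute)
  have "cmod (poly p' t) \<le> C * (1 + cmod t) ^ n * cmod (poly q' t)" for t
  proof (cases "t = w")
    case True
    have "((\<lambda>t. C * (1 + cmod t) ^ n * cmod (poly q' t) - cmod (poly p' t)) \<longlongrightarrow>
       C * (1 + cmod w) ^ n * cmod (poly q' w) - cmod (poly p' w)) (at w)"
      by (intro tendsto_intros poly_isCont[unfolded isCont_def])
    moreover have "eventually (\<lambda>t. 0 \<le> C * (1 + cmod t) ^ n * cmod (poly q' t) - cmod (poly p' t)) (at w)"
      using off by (auto simp: eventually_at intro: exI[of _ 1])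
    ultimately have "0 \<le> C * (1 + cmod w) ^ n * cmod (poly q' w) - cmod (poly p' w)"
      by (rule tendsto_lowerbound) simp
    then show ?thesis using True by simp
  qed (rule off)
  from Suc.hyps(1)[OF _ \<open>q' \<noteq> 0\<close> this] deg Suc.hyps(2) obtain s where "p' = s * q'" "degree s \<le> n" by auto
  then show ?case by (intro exI[of _ s]) (simp add: p' q' mult.left_commute)
qed

text \<open>At a root of \<open>N\<close> some \<open>P j\<close> is nonzero, so \<open>c\<close>
  vanishes there, and cancelling the factor preserves the hypotheses. In the application
  \<open>N\<close> is the denominator of a lift \<open>P\<close> and \<open>c\<close> any other
  polynomial that clears the denominators.\<close>

lemma common_denominator_dvd:
  fixes N c :: "complex poly" and P Q :: "'j \<Rightarrow> complex poly"
  assumes "N \<noteq> 0" "\<And>j. N * Q j = c * P j" "\<And>x. poly N x = 0 \<Longrightarrow> \<exists>j. poly (P j) x \<noteq> 0"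
  shows "N dvd c"
  using assms
proof (induction "degree N" arbitrary: N c)
  case 0
  then obtain a where a: "N = [:a:]" by (metis degree_eq_zeroE)
  with 0 have "a \<noteq> 0" by auto
  then show ?case by (simp add: a const_poly_dvd_iff dvd_field_iff)
next
  case (Suc d)
  from complex_poly_root_factor[OF Suc.hyps(2)[symmetric]]
  obtain w N' where N': "N = [:-w, 1:] * N'" and w: "poly N w = 0" and deg: "degree N = Suc (degree N')"
    using Suc.hyps(2) by metis
  then obtain j where "poly (P j) w \<noteq> 0" using Suc.prems(3) by blast
  moreover have "poly c w * poly (P j) w = 0"
    using arg_cong[OF Suc.prems(2)[of j], of "\<lambda>p. poly p w"] w by simp
  ultimately have "poly c w = 0" by simp
  then obtain c' where c': "c = [:-w, 1:] * c'" by (metis poly_eq_0_iff_dvd dvdE)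
  have "N' \<noteq> 0" using Suc.prems N' by auto
  have "N' * Q j = c' * P j" for j
  proof -
    have "[:-w, 1:] * (N' * Q j) = [:-w, 1:] * (c' * P j)"
      using Suc.prems(2)[of j] unfolding c' N' by (simp only: mult.assoc)
    then show ?thesis by (metis mult_left_cancel pCons_eq_0_iff zero_neq_one)
  qed
  then have "N' dvd c'"
    by (intro Suc.hyps(1)) (use Suc.hyps(2) deg Suc.prems(3) N' \<open>N' \<noteq> 0\<close> in auto)
  then show ?case unfolding c' N' by (rule mult_dvd_mono[OF dvd_refl])
qed

text \<open>A real-rooted polynomial is a constant times a real polynomial, and here the constant
  meets its own conjugate.\<close>

lemma real_rooted_poly_mult_cnj:
  fixes p :: "complex poly"
  assumes "\<And>z. poly p z = 0 \<Longrightarrow> z \<in> \<real>" "t \<in> \<real>" "u \<in> \<real>"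
  shows "poly p t * cnj (poly p u) \<in> \<real>"
  using assms(1)
proof (induction "degree p" arbitrary: p)
  case 0
  then obtain a where "p = [:a:]" by (metis degree_eq_zeroE)
  then show ?case by (simp flip: complex_norm_square)
next
  case (Suc d)
  from complex_poly_root_factor[OF Suc.hyps(2)[symmetric]]
  obtain w q where q: "p = [:-w, 1:] * q" and w: "poly p w = 0" and deg: "degree p = Suc (degree q)"
    using Suc.hyps(2) by metis
  have "w \<in> \<real>" using Suc.prems w by blast
  have "poly q t * cnj (poly q u) \<in> \<real>"
    by (rule Suc.hyps(1)) (use deg Suc.hyps(2) Suc.prems q in auto)
  moreover have "poly p t * cnj (poly p u) = (t - w) * (u - w) * (poly q t * cnj (poly q u))"
    using \<open>w \<in> \<real>\<close> assms(3) by (simp add: q Reals_cnj_iff algebra_simps)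
  ultimately show ?case using \<open>w \<in> \<real>\<close> assms(2,3) by simp
qed

text \<open>The quotient p / q is holomorphic and real-valued on a disc; were it nonconstant, its
  image would be open in the plane.\<close>

lemma proportional_of_real_ratio:
  fixes p q :: "complex poly"
  assumes "open \<Omega>" "\<Omega> \<noteq> {}" "\<And>s. s \<in> \<Omega> \<Longrightarrow> poly q s \<noteq> 0"
    and "\<And>s. s \<in> \<Omega> \<Longrightarrow> poly p s * cnj (poly q s) \<in> \<real>"
  shows "\<exists>c. p = smult c q"
proof -
  obtain z where "z \<in> \<Omega>" using assms(2) by blast
  then obtain e where e: "0 < e" "ball z e \<subseteq> \<Omega>" using assms(1) by (meson openE)
  define f where "f = (\<lambda>s. poly p s / poly q s)"
  have real: "f s \<in> \<real>" if "s \<in> ball z e" for s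
  proof -
    have s: "s \<in> \<Omega>" using that e by auto
    have "f s = (poly p s * cnj (poly q s)) / of_real ((cmod (poly q s))\<^sup>2)"
      unfolding f_def by (rule complex_div_cnj)
    then show ?thesis using assms(4)[OF s] by (metis Reals_divide Reals_of_real)
  qed
  have hol: "f holomorphic_on ball z e"
    unfolding f_def using e assms(3) by (intro holomorphic_intros) auto
  have "f constant_on ball z e"
  proof (rule ccontr)
    assume nc: "\<not> ?thesis"
    have "open (f ` ball z e)"
      by (rule open_mapping_thm[OF hol _ _ _ _ nc]) auto
    moreover have "f z \<in> f ` ball z e" using e by auto
    ultimately obtain d where d: "0 < d" "ball (f z) d \<subseteq> f ` ball z e" by (meson openE)
    have "f z + \<i> * of_real (d/2) \<in> ball (f z) d" using d by (simp add: dist_norm norm_mult)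
    then obtain s where "s \<in> ball z e" "f s = f z + \<i> * of_real (d/2)" using d(2) by auto
    then have "Im (f z + \<i> * of_real (d/2)) = 0" using real by (metis complex_is_Real_iff)
    moreover have "Im (f z) = 0" using real[of z] e by (simp add: complex_is_Real_iff)
    ultimately show False using d by simp
  qed
  then obtain c where c: "\<And>s. s \<in> ball z e \<Longrightarrow> f s = c" by (auto simp: constant_on_def)
  have "poly (p - smult c q) s = 0" if "s \<in> ball z e" for s
    using c[OF that] assms(3)[of s] e that by (auto simp: f_def field_simps)
  then have "ball z e \<subseteq> {s. poly (p - smult c q) s = 0}" by auto
  moreover have "infinite (ball z e)" using e countable_finite uncountable_ball by blast
  ultimately have "p - smult c q = 0" using poly_roots_finite finite_subset by metis
  then show ?thesis by auto
qed

text \<open>At the point \<tau>^n a polynomial of degree m > 0 grows like \<tau>^(n m), and n m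
  \<ge> n > d.\<close>

lemma poly_const_of_subpolynomial_growth:
  fixes p :: "complex poly"
  assumes "d < n" "\<And>\<tau>::real. 1 \<le> \<tau> \<Longrightarrow> cmod (poly p (of_real (\<tau> ^ n))) \<le> K * \<tau> ^ d"
  shows "degree p = 0"
proof (rule ccontr)
  assume "degree p \<noteq> 0"
  define l where "l = cmod (lead_coeff p)"
  have "filterlim (\<lambda>\<tau>::real. (of_real (\<tau> ^ n) :: complex)) at_infinity at_top"
    using assms(1) by (intro filterlim_compose[OF filterlim_of_real_at_infinity] filterlim_pow_at_top filterlim_ident) auto
  from filterlim_compose[OF poly_divide_tendsto_aux[of p] this]
  have lim: "((\<lambda>\<tau>::real. cmod (poly p (of_real (\<tau> ^ n)) / of_real (\<tau> ^ n) ^ degree p)) \<longlongrightarrow> l) at_top"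
    unfolding l_def by (rule tendsto_norm)
  have "((\<lambda>\<tau>::real. \<bar>K\<bar> / \<tau>) \<longlongrightarrow> 0) at_top"
    by (intro tendsto_divide_0[OF tendsto_const] filterlim_at_top_imp_at_infinity filterlim_ident)
  moreover have "\<forall>\<^sub>F \<tau> in at_top. cmod (poly p (of_real (\<tau> ^ n)) / of_real (\<tau> ^ n) ^ degree p) \<le> \<bar>K\<bar> / \<tau>"
    using eventually_ge_at_top[of 1]
  proof eventually_elim
    case (elim \<tau>)
    have "cmod (poly p (of_real (\<tau> ^ n))) * \<tau> \<le> \<bar>K\<bar> * \<tau> ^ d * \<tau>"
      using assms(2)[OF elim] elim
      by (intro mult_right_mono) (auto intro: order.trans mult_right_mono)
    also have "\<dots> = \<bar>K\<bar> * \<tau> ^ Suc d" by simp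
    also have "\<dots> \<le> \<bar>K\<bar> * \<tau> ^ (n * degree p)"
    proof (intro mult_left_mono power_increasing)
      have "n * 1 \<le> n * degree p" using \<open>degree p \<noteq> 0\<close> by (intro mult_le_mono2) simp
      with assms(1) show "Suc d \<le> n * degree p" by linarith
    qed (use elim in auto)
    finally have "cmod (poly p (of_real (\<tau> ^ n))) * \<tau> \<le> \<bar>K\<bar> * \<tau> ^ (n * degree p)" .
    then show ?case using elim by (simp add: norm_divide norm_power power_mult[symmetric] field_simps)
  qed
  ultimately have "l \<le> 0" using tendsto_le[OF trivial_limit_at_top_linorder _ lim] by blast
  then have "p = 0" by (simp add: l_def)
  then show False using \<open>degree p \<noteq> 0\<close> by simp
qed

section \<open>Rational curves in projective space\<close>

text \<open>A map into projective space is given by homogeneous coordinates \<open>V x j\<close>; the index \<open>d\<close>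
  singles out the coordinate used as denominator. \<open>P\<close> lifts \<open>V\<close> to polynomials without common
  zeros, normalized by \<open>P d\<close>.\<close>

definition rational_lift :: "'j \<Rightarrow> (complex \<Rightarrow> 'j \<Rightarrow> complex) \<Rightarrow> ('j \<Rightarrow> complex poly) \<Rightarrow> bool" where
  "rational_lift d V P \<longleftrightarrow>
     (\<forall>j. degree (P j) \<le> degree (P d)) \<and> poly (P d) 0 = 1 \<and>
     (\<forall>x. \<exists>c. c \<noteq> 0 \<and> (\<forall>j. poly (P j) x = c * V x j))"

text \<open>Only ratios with a locally nonvanishing denominator are required to be holomorphic; the
  homogeneous coordinates themselves need not even be continuous.\<close>

definition holomorphic_curve :: "(complex \<Rightarrow> 'j \<Rightarrow> complex) \<Rightarrow> bool" where
  "holomorphic_curve V \<longleftrightarrow>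
     (\<forall>z. \<exists>k e. 0 < e \<and> (\<forall>x\<in>ball z e. V x k \<noteq> 0) \<and>
        (\<forall>j. (\<lambda>x. V x j / V x k) holomorphic_on ball z e))"

lemma holomorphic_curveE:
  assumes "holomorphic_curve V"
  obtains k e where "0 < e" "\<And>x. x \<in> ball z e \<Longrightarrow> V x k \<noteq> 0"
    "\<And>j. (\<lambda>x. V x j / V x k) holomorphic_on ball z e"
proof -
  from assms have "\<exists>k e. 0 < e \<and> (\<forall>x\<in>ball z e. V x k \<noteq> 0) \<and>
        (\<forall>j. (\<lambda>x. V x j / V x k) holomorphic_on ball z e)"
    unfolding holomorphic_curve_def by (rule spec)
  then obtain k e where ke: "0 < e" "\<forall>x\<in>ball z e. V x k \<noteq> 0"
    "\<forall>j. (\<lambda>x. V x j / V x k) holomorphic_on ball z e" by (elim exE conjE)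
  show ?thesis by (rule that[OF ke(1) bspec[OF ke(2)] spec[OF ke(3)]])
qed

text \<open>The accumulation points of the zero set form an open set, by the identity theorem in a
  local affine chart, and a closed one. It misses 0, hence is empty; a bounded set without
  accumulation points is finite.\<close>

lemma holomorphic_curve_zeros_finite:
  assumes V: "holomorphic_curve V" and "V 0 d \<noteq> 0" and bd: "\<And>x. cmod x > R \<Longrightarrow> V x d \<noteq> 0"
  shows "finite {x. V x d = 0}"
proof -
  let ?Z = "{x. V x d = 0}"
  have ball: "\<exists>e>0. ball z e \<subseteq> ?Z" if "z islimpt ?Z" for z
  proof -
    obtain k e where e: "0 < e" "\<And>x. x \<in> ball z e \<Longrightarrow> V x k \<noteq> 0"
      and h: "\<And>j. (\<lambda>x. V x j / V x k) holomorphic_on ball z e"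
      by (rule holomorphic_curveE[OF V, where z = z]) (iprover intro: that)
    have lim: "z islimpt (?Z \<inter> ball z e)"
      using e by (intro islimpt_Int_eventually that eventually_at_in_open') auto
    have 0: "V x d / V x k = 0" if "x \<in> ball z e" for x
      by (rule analytic_continuation[OF h[of d] open_ball connected_ball _ _ lim _ that]) (use e(1) in auto)
    have "V x d = 0" if "x \<in> ball z e" for x
      using 0[OF that] e(2)[OF that] by simp
    then show ?thesis using e(1) by blast
  qed
  have "open {z. z islimpt ?Z}"
  proof (rule openI)
    fix z assume "z \<in> {z. z islimpt ?Z}"
    then obtain e where e: "e > 0" "ball z e \<subseteq> ?Z" using ball by auto
    have "y islimpt ?Z" if "y \<in> ball z e" for y
      using islimpt_subset[OF interior_limit_point e(2)] that by (metis interior_ball)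
    then show "\<exists>T>0. ball z T \<subseteq> {z. z islimpt ?Z}" using e by auto
  qed
  moreover have "closed {z. z islimpt ?Z}" by (rule closed_limpts)
  moreover have "\<not> 0 islimpt ?Z"
  proof
    assume "0 islimpt ?Z"
    then obtain e where "e > 0" "ball 0 e \<subseteq> ?Z" using ball by auto
    then have "0 \<in> ?Z" by (meson centre_in_ball subsetD)
    then show False using assms(2) by simp
  qed
  ultimately have no: "\<not> z islimpt ?Z" for z using clopen[of "{z. z islimpt ?Z}"] by blast
  have "?Z \<subseteq> cball 0 R" using bd by (auto simp: not_less[symmetric])
  then show ?thesis
    using no Heine_Borel_imp_Bolzano_Weierstrass[OF compact_cball, of ?Z 0 R] by auto
qed

lemma cmod_poly_le_leading:
  fixes p :: "complex poly"
  assumes "1 \<le> cmod z"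
  shows "cmod (poly p z) \<le> (\<Sum>i\<le>degree p. cmod (coeff p i)) * cmod z ^ degree p"
proof -
  have "cmod (poly p z) \<le> (\<Sum>i\<le>degree p. cmod (coeff p i * z ^ i))"
    unfolding poly_altdef by (rule norm_sum)
  also have "\<dots> \<le> (\<Sum>i\<le>degree p. cmod (coeff p i) * cmod z ^ degree p)"
    using assms by (intro sum_mono) (auto simp: norm_mult norm_power intro!: mult_left_mono power_increasing)
  finally show ?thesis by (simp add: sum_distrib_right)
qed

text \<open>The affine coordinates V j / V d are meromorphic. A polynomial \<open>N\<close> with the
  zeros of V d, counted with multiplicity in local charts, makes them entire and without common
  zeros. Boundedness near infinity and Liouville's theorem turn them into polynomials of degree at
  most that of \<open>N\<close>.\<close>

lemma rational_lift_exists: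
  assumes V: "holomorphic_curve V" and V0: "V 0 d \<noteq> 0"
    and inf: "\<And>x. cmod x > R \<Longrightarrow> V x d \<noteq> 0" "\<And>x j. cmod x > R \<Longrightarrow> cmod (V x j / V x d) \<le> C j"
  shows "\<exists>P. rational_lift d V P"
proof -
  define Z where "Z = {x. V x d = 0}"
  have finZ: "finite Z" unfolding Z_def by (rule holomorphic_curve_zeros_finite[OF V V0 inf(1)])
  have fac: "\<forall>z. \<exists>n k e \<phi>. 0 < e \<and> (\<forall>x\<in>ball z e. V x k \<noteq> 0 \<and> \<phi> x \<noteq> 0) \<and> \<phi> holomorphic_on ball z e \<and>
      (\<forall>j. (\<lambda>x. V x j / V x k) holomorphic_on ball z e) \<and>
      (\<forall>x\<in>ball z e. V x d / V x k = (x - z) ^ n * \<phi> x)"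
  proof (rule allI)
    fix z
    obtain k e where e: "0 < e" "\<And>x. x \<in> ball z e \<Longrightarrow> V x k \<noteq> 0"
      and h: "\<And>j. (\<lambda>x. V x j / V x k) holomorphic_on ball z e"
      by (rule holomorphic_curveE[OF V, where z = z]) (iprover intro: that)
    show "\<exists>n k e \<phi>. 0 < e \<and> (\<forall>x\<in>ball z e. V x k \<noteq> 0 \<and> \<phi> x \<noteq> 0) \<and> \<phi> holomorphic_on ball z e \<and>
      (\<forall>j. (\<lambda>x. V x j / V x k) holomorphic_on ball z e) \<and>
      (\<forall>x\<in>ball z e. V x d / V x k = (x - z) ^ n * \<phi> x)"
    proof (cases "z \<in> Z")
      case True
      have nc: "\<not> (\<lambda>x. V x d / V x k) constant_on ball z e"
      proof
        assume "(\<lambda>x. V x d / V x k) constant_on ball z e"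
        then have "V x d / V x k = V z d / V z k" if "x \<in> ball z e" for x
          using that e(1) by (auto simp: constant_on_def)
        then have "ball z e \<subseteq> Z" using True e(2) by (fastforce simp: Z_def)
        then show False using finZ e(1) finite_subset countable_finite uncountable_ball by blast
      qed
      have z0: "V z d / V z k = 0" using True by (simp add: Z_def)
      obtain \<phi> r n where "0 < n" "0 < r" "ball z r \<subseteq> ball z e" "\<phi> holomorphic_on ball z r"
        "\<And>w. w \<in> ball z r \<Longrightarrow> V w d / V w k = (w - z) ^ n * \<phi> w" "\<And>w. w \<in> ball z r \<Longrightarrow> \<phi> w \<noteq> 0"
        by (rule holomorphic_factor_zero_nonconstant[OF h[of d] open_ball connected_ball _ _ nc])
          (use e(1) z0 in auto)
      moreover have "(\<lambda>x. V x j / V x k) holomorphic_on ball z r" for j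
        using h[of j] \<open>ball z r \<subseteq> ball z e\<close> by (rule holomorphic_on_subset)
      moreover have "V x k \<noteq> 0" if "x \<in> ball z r" for x using \<open>ball z r \<subseteq> ball z e\<close> e(2) that by blast
      ultimately show ?thesis
        by (intro exI[of _ n] exI[of _ k] exI[of _ r] exI[of _ \<phi>] conjI ballI allI)
    next
      case False
      have "open (- Z)" using finZ by (simp add: finite_imp_closed open_Compl)
      then obtain r where r: "0 < r" "ball z r \<subseteq> - Z" using False by (meson ComplI openE)
      have sub: "ball z (min e r) \<subseteq> ball z e" "ball z (min e r) \<subseteq> - Z" using r by auto
      have "(\<lambda>x. V x j / V x k) holomorphic_on ball z (min e r)" for j
        using h[of j] sub(1) by (rule holomorphic_on_subset)
      moreover have "V x k \<noteq> 0" "V x d \<noteq> 0" if "x \<in> ball z (min e r)" for x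
        using sub e(2) that by (blast, auto simp: Z_def)
      ultimately show ?thesis
        using e(1) r(1) by (intro exI[of _ 0] exI[of _ k] exI[of _ "min e r"] exI[of _ "\<lambda>x. V x d / V x k"]) simp
    qed
  qed
  \<comment> \<open>Only the order of vanishing must be chosen for all points at once, since
    \<open>N\<close> is a global object; index, radius and cofactor stay local.\<close>
  obtain n where n: "\<forall>z. \<exists>k e \<phi>. 0 < e \<and> (\<forall>x\<in>ball z e. V x k \<noteq> 0 \<and> \<phi> x \<noteq> 0) \<and> \<phi> holomorphic_on ball z e \<and>
      (\<forall>j. (\<lambda>x. V x j / V x k) holomorphic_on ball z e) \<and>
      (\<forall>x\<in>ball z e. V x d / V x k = (x - z) ^ n z * \<phi> x)" using choice[OF fac] by (rule exE)
  define N where "N = (\<Prod>z\<in>Z. [:-z, 1:] ^ n z)"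
  have polyN: "poly N x = (\<Prod>z\<in>Z. (x - z) ^ n z)" for x by (simp add: N_def poly_prod)
  \<comment> \<open>At zeros of V d the quotient is 0 by convention, which is in general not the
    continuous extension; hence \<open>remove_sings\<close>.\<close>
  define L where "L = (\<lambda>j. remove_sings (\<lambda>x. poly N x * (V x j / V x d)))"
  have loc: "\<exists>e>0. \<exists>c. (\<forall>x\<in>ball z e. c x \<noteq> 0 \<and> (\<forall>j. L j x = c x * V x j)) \<and> (\<forall>j. L j holomorphic_on ball z e)" for z
  proof -
    obtain k e0 \<phi> where loc0: "0 < e0" "\<forall>x\<in>ball z e0. V x k \<noteq> 0 \<and> \<phi> x \<noteq> 0"
      "\<phi> holomorphic_on ball z e0" "\<forall>j. (\<lambda>x. V x j / V x k) holomorphic_on ball z e0"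
      "\<forall>x\<in>ball z e0. V x d / V x k = (x - z) ^ n z * \<phi> x"
      using spec[OF n, of z] by (elim exE conjE)
    have e0: "0 < e0" "\<And>x. x \<in> ball z e0 \<Longrightarrow> V x k \<noteq> 0"
      and phi: "\<And>x. x \<in> ball z e0 \<Longrightarrow> \<phi> x \<noteq> 0" "\<phi> holomorphic_on ball z e0"
      and h: "\<And>j. (\<lambda>x. V x j / V x k) holomorphic_on ball z e0"
      and f: "\<And>x. x \<in> ball z e0 \<Longrightarrow> V x d / V x k = (x - z) ^ n z * \<phi> x" using loc0 by simp_all
    have "open (- (Z - {z}))" by (intro open_Compl finite_imp_closed finite_Diff finZ)
    then obtain r where r: "0 < r" "ball z r \<subseteq> - (Z - {z})" by (meson ComplI DiffD2 openE singletonI)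
    define e where "e = min e0 r"
    have e: "0 < e" "ball z e \<subseteq> ball z e0" "ball z e \<inter> (Z - {z}) = {}" using e0 r by (auto simp: e_def)
    \<comment> \<open>This is \<open>N\<close> divided by V d / V k, after cancelling the power of x
      - z. It has no zero on the small ball, which is why the functions \<open>L j\<close> have no
      common zero.\<close>
    define \<psi> where "\<psi> = (\<lambda>x. (\<Prod>w\<in>Z-{z}. (x - w) ^ n w) / \<phi> x)"
    have psi: "\<psi> x \<noteq> 0" if "x \<in> ball z e" for x
      using that e phi(1)[of x] finZ by (auto simp: \<psi>_def)
    have hol: "(\<lambda>x. \<psi> x * (V x j / V x k)) holomorphic_on ball z e" for j
      unfolding \<psi>_def using phi(1) e(2)
      by (intro holomorphic_on_mult holomorphic_on_divide holomorphic_on_subset[OF phi(2) e(2)]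
          holomorphic_on_subset[OF h e(2)] holomorphic_intros) auto
    have n0: "n z = 0" if "z \<notin> Z"
      using f[of z] e0(1) e0(2)[of z] that by (auto simp: Z_def power_0_left split: if_splits)
    have N_eq: "poly N x = (x - z) ^ n z * (\<Prod>w\<in>Z-{z}. (x - w) ^ n w)" for x
    proof (cases "z \<in> Z")
      case True
      then show ?thesis unfolding polyN using finZ by (simp add: prod.remove)
    qed (simp add: polyN n0)
    have off: "poly N x * (V x j / V x d) = \<psi> x * (V x j / V x k)" if "x \<in> ball z e" "x \<noteq> z" for x j
    proof -
      have x: "x \<in> ball z e0" using that e by auto
      have "V x d = V x k * ((x - z) ^ n z * \<phi> x)" using f[OF x] e0(2)[OF x] by (simp add: field_simps)
      then show ?thesis using that phi(1)[OF x] e0(2)[OF x] by (simp add: N_eq \<psi>_def field_simps)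
    qed
    have Leq: "L j x = \<psi> x * (V x j / V x k)" if "x \<in> ball z e" for j x
      unfolding L_def
    proof (rule remove_sings_eqI)
      have "isCont (\<lambda>x. \<psi> x * (V x j / V x k)) x"
        using holomorphic_on_imp_continuous_on[OF hol[of j]] that
        by (metis continuous_on_eq_continuous_at open_ball)
      moreover have "\<forall>\<^sub>F y in at x. \<psi> y * (V y j / V y k) = poly N y * (V y j / V y d)"
      proof -
        have "\<forall>\<^sub>F y in at x. y \<in> ball z e" using that by (intro eventually_at_in_open') auto
        moreover have "\<forall>\<^sub>F y in at x. y \<noteq> z" by (rule eventually_neq_at_within)
        ultimately show ?thesis by eventually_elim (rule off[symmetric])
      qed
      ultimately show "(\<lambda>x. poly N x * (V x j / V x d)) \<midarrow>x\<rightarrow> \<psi> x * (V x j / V x k)"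
        unfolding isCont_def by (rule Lim_transform_eventually)
    qed
    have "L j holomorphic_on ball z e" for j
      using hol[of j] by (rule holomorphic_transform) (simp add: Leq)
    moreover have "\<psi> x / V x k \<noteq> 0 \<and> (\<forall>j. L j x = \<psi> x / V x k * V x j)" if "x \<in> ball z e" for x
      using psi[OF that] e0(2)[of x] e(2) that by (auto simp: Leq)
    ultimately show ?thesis using e(1) by (intro exI[of _ e] conjI exI[of _ "\<lambda>x. \<psi> x / V x k"]) auto
  qed
  have lift: "\<exists>c. c \<noteq> 0 \<and> (\<forall>j. L j x = c * V x j)" for x
    using loc[of x] by (metis centre_in_ball)
  have hol: "L j holomorphic_on UNIV" for j
  proof -
    have "L j field_differentiable at x" for x
      using loc[of x] by (metis holomorphic_on_imp_differentiable_at open_ball centre_in_ball)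
    then show ?thesis by (simp add: holomorphic_on_def)
  qed
  have LG: "L j x = poly N x * (V x j / V x d)" if "x \<notin> Z" for x j
  proof -
    obtain k e where e: "0 < e" "\<And>x'. x' \<in> ball x e \<Longrightarrow> V x' k \<noteq> 0"
      and h: "\<And>j. (\<lambda>x. V x j / V x k) holomorphic_on ball x e"
      by (rule holomorphic_curveE[OF V, where z = x]) (iprover intro: that)
    have cont: "isCont (\<lambda>x. V x j / V x k) x" for j
      using holomorphic_on_imp_continuous_on[OF h[of j]] e(1)
      by (metis centre_in_ball continuous_on_eq_continuous_at open_ball)
    have "isCont (\<lambda>x. poly N x * ((V x j / V x k) / (V x d / V x k))) x"
      using that e by (intro isCont_mult poly_isCont isCont_divide[OF cont cont]) (auto simp: Z_def)
    then have "(\<lambda>x. poly N x * ((V x j / V x k) / (V x d / V x k))) \<midarrow>x\<rightarrow> poly N x * (V x j / V x d)"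
      using e by (simp add: isCont_def)
    moreover have "\<forall>\<^sub>F y in at x. poly N y * ((V y j / V y k) / (V y d / V y k)) = poly N y * (V y j / V y d)"
    proof -
      have "\<forall>\<^sub>F y in at x. y \<in> ball x e" using e by (intro eventually_at_in_open') auto
      then show ?thesis by eventually_elim (use e in auto)
    qed
    ultimately show ?thesis unfolding L_def by (intro remove_sings_eqI) (rule Lim_transform_eventually)
  qed
  have N0: "N \<noteq> 0" using finZ by (auto simp: N_def)
  have Ld: "L d x = poly N x" for x
  proof (cases "x \<in> Z")
    case True
    obtain c where "c \<noteq> 0" "\<forall>j. L j x = c * V x j" using lift by metis
    then have "L d x = 0" using True by (simp add: Z_def)
    moreover have "n x \<noteq> 0"
    proof
      assume "n x = 0"
      moreover obtain k e \<phi> where "0 < e" "\<forall>y\<in>ball x e. V y k \<noteq> 0 \<and> \<phi> y \<noteq> 0"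
        "\<forall>y\<in>ball x e. V y d / V y k = (y - x) ^ n x * \<phi> y" using spec[OF n, of x] by (elim exE conjE)
      moreover have "x \<in> ball x e" using \<open>0 < e\<close> by simp
      ultimately have "V x d / V x k \<noteq> 0" by auto
      then have "V x d \<noteq> 0" by auto
      then show False using True by (simp add: Z_def)
    qed
    then have "poly N x = 0" unfolding polyN using finZ True by (auto intro: prod_zero)
    ultimately show ?thesis by simp
  next
    case False
    then show ?thesis by (simp add: LG Z_def)
  qed
  have "poly N 0 \<noteq> 0" using lift[of 0] V0 by (auto simp flip: Ld)
  have ex: "\<exists>p. degree p \<le> degree N \<and> (\<forall>x. poly p x = L j x)" for j
  proof -
    let ?B = "\<Sum>i\<le>degree N. cmod (coeff N i)"
    have "L j x = (\<Sum>k\<le>degree N. (deriv ^^ k) (L j) 0 / fact k * x ^ k)" for x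
    proof (rule Liouville_polynomial[OF hol])
      fix z assume z: "max 1 (\<bar>R\<bar> + 1) \<le> cmod z"
      then have R: "cmod z > R" by linarith
      then have "z \<notin> Z" using inf(1) by (auto simp: Z_def)
      then have "cmod (L j z) = cmod (V z j / V z d) * cmod (poly N z)" by (simp add: LG norm_mult norm_divide)
      also have "\<dots> \<le> C j * (?B * cmod z ^ degree N)"
      proof (rule mult_mono)
        show "cmod (poly N z) \<le> ?B * cmod z ^ degree N" using z by (intro cmod_poly_le_leading) simp
        show "0 \<le> C j" using order.trans[OF norm_ge_zero inf(2)[OF R]] .
      qed (use inf(2)[OF R] in auto)
      finally show "cmod (L j z) \<le> C j * ?B * cmod z ^ degree N" by (simp add: mult.assoc)
    qed
    then show ?thesis
      by (intro exI[of _ "\<Sum>k\<le>degree N. monom ((deriv ^^ k) (L j) 0 / fact k) k"])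
        (auto simp: poly_sum poly_monom intro!: degree_sum_le intro: order.trans[OF degree_monom_le])
  qed
  then obtain Q where Q: "\<And>j. degree (Q j) \<le> degree N" "\<And>j x. poly (Q j) x = L j x" by metis
  have "Q d = N" using Q(2) Ld by (metis poly_eq_poly_eq_iff ext)
  define P where "P = (\<lambda>j. smult (1 / poly N 0) (Q j))"
  have "\<exists>c. c \<noteq> 0 \<and> (\<forall>j. poly (P j) x = c * V x j)" for x
  proof -
    obtain c where "c \<noteq> 0" "\<forall>j. L j x = c * V x j" using lift by metis
    then show ?thesis using \<open>poly N 0 \<noteq> 0\<close>
      by (intro exI[of _ "c / poly N 0"]) (simp add: P_def Q)
  qed
  then have "rational_lift d V P"
    using \<open>poly N 0 \<noteq> 0\<close> Q \<open>Q d = N\<close> by (auto simp: rational_lift_def P_def)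
  then show ?thesis by blast
qed

section \<open>Limits and Taylor coefficients depending on a parameter\<close>

lemma dense_limit_le:
  fixes f g :: "complex \<Rightarrow> real"
  assumes "closure S = UNIV" "continuous_on UNIV f" "continuous_on UNIV g" "\<And>x. x \<in> S \<Longrightarrow> f x \<le> g x"
  shows "f x \<le> g x"
proof -
  have "f x - g x \<le> 0"
    by (rule continuous_le_on_closure[of S]) (use assms in \<open>auto intro!: continuous_intros\<close>)
  then show ?thesis by simp
qed

text \<open>In place of a contour integral, the coefficient of index \<open>m\<close> is the limit
  of (G t x - lower Taylor part) / x^m along a sequence x \<rightarrow> 0. These quotients are
  holomorphic in \<open>t\<close> by induction on \<open>m\<close>, and Cauchy's estimates make the
  convergence uniform in \<open>t\<close>.\<close>

lemma taylor_coeff_holomorphic_in_parameter: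
  fixes G :: "complex \<Rightarrow> complex \<Rightarrow> complex"
  assumes S: "open S" and r: "0 < r"
    and hol: "\<And>t. t \<in> S \<Longrightarrow> G t holomorphic_on ball 0 r"
    and bd: "\<And>t x. t \<in> S \<Longrightarrow> x \<in> ball 0 r \<Longrightarrow> cmod (G t x) \<le> K"
    and holt: "\<And>x. x \<in> ball 0 r \<Longrightarrow> (\<lambda>t. G t x) holomorphic_on S"
  shows "(\<lambda>t. (deriv ^^ m) (G t) 0 / fact m) holomorphic_on S"
proof (induction m rule: less_induct)
  case (less m)
  define s where "s = r / 2"
  have s: "0 < s" "s < r" using r by (auto simp: s_def)
  define g where "g = (\<lambda>i t. (deriv ^^ i) (G t) 0 / fact i)"
  have coeff: "cmod (g i t) \<le> K / s ^ i" if t: "t \<in> S" for i t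
  proof -
    have sub: "cball 0 s \<subseteq> ball (0::complex) r" using s by auto
    have "norm ((deriv ^^ i) (G t) 0) \<le> fact i * K / s ^ i"
    proof (rule Cauchy_inequality)
      show "continuous_on (cball 0 s) (G t)"
        using holomorphic_on_imp_continuous_on[OF hol[OF t]] sub by (rule continuous_on_subset)
      show "G t holomorphic_on ball 0 s" using hol[OF t] by (rule holomorphic_on_subset) (use s in auto)
    qed (use s bd[OF t] in auto)
    then show ?thesis using s(1) by (simp add: g_def norm_divide field_simps)
  qed
  \<comment> \<open>The bound |x n| \<le> s / 2 dominates the Taylor tail by a geometric series of
    ratio at most 1/2.\<close>
  define x where "x = (\<lambda>n. of_real (s / (2 * (real n + 1))) :: complex)"
  define R where "R = (\<lambda>n t. (G t (x n) - (\<Sum>i<m. g i t * x n ^ i)) / x n ^ m)"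
  have xn: "cmod (x n) = s / (2 * (real n + 1))" "x n \<noteq> 0" for n
    using s by (auto simp: x_def norm_divide norm_mult simp del: of_real_add of_real_mult of_real_divide)
  have xs: "cmod (x n) \<le> s / 2" for n unfolding xn using s by (intro frac_le) auto
  have x_ball: "x n \<in> ball 0 r" for n using s xs[of n] by simp
  have "(\<lambda>t. g m t) holomorphic_on S"
  proof (rule holomorphic_uniform_sequence[OF S])
    show "R n holomorphic_on S" for n
      unfolding R_def using xn(2) less.IH holt[OF x_ball]
      by (intro holomorphic_intros) (auto simp: g_def)
    fix t0 assume "t0 \<in> S"
    then obtain d where d: "0 < d" "cball t0 d \<subseteq> S" using S by (meson open_contains_cball)
    have est: "cmod (R n t - g m t) \<le> 2 * K / s ^ Suc m * cmod (x n)" if t: "t \<in> S" for n t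
    proof -
      define q where "q = cmod (x n) / s"
      have q: "0 \<le> q" "q \<le> 1 / 2" using xs[of n] s by (auto simp: q_def field_simps)
      have K: "0 \<le> K" using bd[OF t, of 0] r by (auto intro: order.trans[OF norm_ge_zero])
      have "(\<lambda>i. g i t * x n ^ i) sums G t (x n)"
        using holomorphic_power_series[OF hol[OF t] x_ball[of n]] by (simp add: g_def)
      then have 1: "(\<lambda>i. g (i + Suc m) t * x n ^ (i + Suc m)) sums (G t (x n) - (\<Sum>i<Suc m. g i t * x n ^ i))"
        by (rule sums_split_initial_segment)
      have 2: "(\<lambda>i. K * q ^ Suc m * q ^ i) sums (K * q ^ Suc m * (1 / (1 - q)))"
        using q by (intro sums_mult geometric_sums) auto
      have "cmod (G t (x n) - (\<Sum>i<Suc m. g i t * x n ^ i)) \<le> K * q ^ Suc m * (1 / (1 - q))"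
      proof (rule norm_sums_le[OF 1 2])
        fix i
        have "cmod (g (i + Suc m) t * x n ^ (i + Suc m)) \<le> K / s ^ (i + Suc m) * cmod (x n) ^ (i + Suc m)"
          unfolding norm_mult norm_power by (intro mult_right_mono coeff t) auto
        also have "\<dots> = K * q ^ Suc m * q ^ i" by (simp add: q_def power_divide power_add field_simps)
        finally show "cmod (g (i + Suc m) t * x n ^ (i + Suc m)) \<le> K * q ^ Suc m * q ^ i" .
      qed
      also have "\<dots> \<le> K * q ^ Suc m * 2"
        using q K by (intro mult_left_mono mult_nonneg_nonneg) (auto simp: field_simps)
      finally have "cmod (G t (x n) - (\<Sum>i<Suc m. g i t * x n ^ i)) / cmod (x n) ^ m
          \<le> K * q ^ Suc m * 2 / cmod (x n) ^ m"
        by (rule divide_right_mono) simp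
      also have "K * q ^ Suc m * 2 / cmod (x n) ^ m = 2 * K / s ^ Suc m * cmod (x n)"
        using xn(2)[of n] s by (simp add: q_def power_divide field_simps)
      also have "cmod (G t (x n) - (\<Sum>i<Suc m. g i t * x n ^ i)) / cmod (x n) ^ m = cmod (R n t - g m t)"
        using xn(2)[of n] unfolding R_def norm_power[symmetric] norm_divide[symmetric]
        by (simp add: diff_divide_distrib add_divide_distrib diff_diff_eq)
      finally show ?thesis .
    qed
    have x0: "(\<lambda>n. 2 * K / s ^ Suc m * cmod (x n)) \<longlonglongrightarrow> 0"
    proof -
      have "(\<lambda>n. 2 * K / s ^ Suc m * (s / 2 * inverse (real (Suc n)))) \<longlonglongrightarrow> 2 * K / s ^ Suc m * (s / 2 * 0)"
        by (intro tendsto_intros LIMSEQ_inverse_real_of_nat)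
      then show ?thesis by (simp add: xn field_simps)
    qed
    have "uniform_limit (cball t0 d) R (g m) sequentially"
    proof (rule uniform_limitI)
      fix e :: real assume "0 < e"
      then have "\<forall>\<^sub>F n in sequentially. 2 * K / s ^ Suc m * cmod (x n) < e"
        using x0 by (rule order_tendstoD(2)[rotated])
      then show "\<forall>\<^sub>F n in sequentially. \<forall>t\<in>cball t0 d. dist (R n t) (g m t) < e"
      proof eventually_elim
        case (elim n)
        show ?case
        proof
          fix t assume "t \<in> cball t0 d"
          then have "cmod (R n t - g m t) \<le> 2 * K / s ^ Suc m * cmod (x n)" by (intro est subsetD[OF d(2)])
          then show "dist (R n t) (g m t) < e" using elim by (simp only: dist_norm)
        qed
      qed
    qed
    then show "\<exists>d>0. cball t0 d \<subseteq> S \<and> uniform_limit (cball t0 d) R (g m) sequentially"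
      using d by blast
  qed
  then show ?case by (simp add: g_def)
qed

section \<open>Coefficient bounds from zero-free discs around 0 and infinity\<close>

definition reverse_coeffs :: "nat \<Rightarrow> complex poly \<Rightarrow> complex poly" where
  "reverse_coeffs D p = (\<Sum>i\<le>D. monom (coeff p (D - i)) i)"

lemma coeff_reverse_coeffs: "i \<le> D \<Longrightarrow> coeff (reverse_coeffs D p) i = coeff p (D - i)"
  by (simp add: reverse_coeffs_def coeff_sum coeff_monom)

lemma degree_reverse_coeffs: "degree (reverse_coeffs D p) \<le> D"
  unfolding reverse_coeffs_def by (intro degree_sum_le) (auto intro: order.trans[OF degree_monom_le])

text \<open>Reversal is the passage to the coordinate y = 1/x. A common bound \<open>D\<close>
  multiplies all homogeneous coordinates by the same y^D, whatever their own degrees are.\<close>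

lemma poly_reverse_coeffs:
  assumes "degree p \<le> D" "y \<noteq> 0"
  shows "poly (reverse_coeffs D p) y = y ^ D * poly p (1 / y)"
proof -
  have "poly p (1 / y) = (\<Sum>i\<le>D. coeff p i * (1 / y) ^ i)"
    unfolding poly_altdef using assms(1)
    by (intro sum.mono_neutral_left) (auto simp: coeff_eq_0)
  then have "y ^ D * poly p (1 / y) = (\<Sum>i\<le>D. coeff p i * y ^ (D - i))"
    using assms(2) by (auto simp: sum_distrib_left power_divide power_diff intro!: sum.cong)
  also have "\<dots> = (\<Sum>i\<le>D. coeff p (D - i) * y ^ i)"
    by (rule sum.reindex_bij_witness[of _ "\<lambda>i. D - i" "\<lambda>i. D - i"]) auto
  finally show ?thesis by (simp add: reverse_coeffs_def poly_sum poly_monom)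
qed

text \<open>The denominator is 1 at 0 and has no zero in the disc of radius \<open>r\<close>, so its
  modulus there is at most 2^degree; the rest is Cauchy's estimate.\<close>

lemma rational_lift_coeff_bound_zero:
  assumes P: "rational_lift d V P" and "0 < r" and nz: "\<And>x. cmod x < r \<Longrightarrow> V x d \<noteq> 0"
  shows "cmod (coeff (P d) i) \<le> 2 ^ degree (P d) / r ^ i"
proof (rule poly_coeff_cauchy_bound[OF assms(2)])
  fix x :: complex assume x: "cmod x < r"
  have "poly (P d) y \<noteq> 0" if "dist 0 y < r" for y
    using P nz[of y] that unfolding rational_lift_def by (metis dist_0_norm mult_eq_0_iff)
  then have "cmod (poly (P d) x) \<le> 2 ^ degree (P d) * cmod (poly (P d) 0)"
    by (rule norm_poly_le_of_no_root_ball) (use x in auto)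
  then show "cmod (poly (P d) x) \<le> 2 ^ degree (P d)" using P by (simp add: rational_lift_def)
qed

text \<open>The same argument at infinity: the reversed denominator has the leading coefficient as
  its value at 0 and no zero for |y| < e. The bound on the ratios carries the estimate over to
  \<open>P j\<close>. Reversal moves index \<open>i\<close> to D - i, whence the exponent of
  \<open>e\<close>.\<close>

lemma rational_lift_coeff_bound_infinity:
  assumes P: "rational_lift d V P" and "0 < e" and nz: "\<And>x. cmod x > 1 / e \<Longrightarrow> V x d \<noteq> 0"
    and bd: "\<And>x. cmod x > 1 / e \<Longrightarrow> cmod (V x j / V x d) \<le> C" and D: "D = degree (P d)" and i: "i \<le> D"
  shows "cmod (coeff (P j) i) \<le> C * 2 ^ D * cmod (coeff (P d) D) / e ^ (D - i)"
proof -
  have far: "cmod (1 / y) > 1 / e" if "y \<noteq> 0" "cmod y < e" for y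
    using that assms(2) by (simp add: norm_divide frac_less2)
  have degs: "degree (P d) \<le> D" "degree (P j) \<le> D" using P D by (auto simp: rational_lift_def)
  have lc: "coeff (P d) D \<noteq> 0"
    using P D unfolding rational_lift_def by (metis leading_coeff_0_iff poly_0 zero_neq_one)
  have rev0: "poly (reverse_coeffs D (P d)) 0 = coeff (P d) D"
    by (simp add: poly_0_coeff_0 coeff_reverse_coeffs)
  have nzd: "poly (reverse_coeffs D (P d)) y \<noteq> 0" if y: "dist 0 y < e" for y
  proof (cases "y = 0")
    case True
    then show ?thesis using rev0 lc by simp
  next
    case False
    obtain c where "c \<noteq> 0" "\<forall>j. poly (P j) (1 / y) = c * V (1 / y) j"
      using P unfolding rational_lift_def by blast
    then show ?thesis
      using False nz[OF far[OF False]] y by (simp add: poly_reverse_coeffs[OF degs(1)])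
  qed
  have off: "cmod (poly (reverse_coeffs D (P j)) y) \<le> C * (2 ^ D * cmod (coeff (P d) D))"
    if y: "y \<noteq> 0" "cmod y < e" for y
  proof -
    obtain c where c: "c \<noteq> 0" "\<forall>j. poly (P j) (1 / y) = c * V (1 / y) j"
      using P unfolding rational_lift_def by blast
    note f = far[OF y]
    have "poly (reverse_coeffs D (P j)) y = (V (1 / y) j / V (1 / y) d) * poly (reverse_coeffs D (P d)) y"
      using c y nz[OF f] by (simp add: poly_reverse_coeffs[OF degs(1)] poly_reverse_coeffs[OF degs(2)])
    moreover have "cmod (poly (reverse_coeffs D (P d)) y) \<le> 2 ^ D * cmod (coeff (P d) D)"
    proof -
      have "cmod (poly (reverse_coeffs D (P d)) y) \<le> 2 ^ degree (reverse_coeffs D (P d)) * cmod (coeff (P d) D)"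
        unfolding rev0[symmetric] by (rule norm_poly_le_of_no_root_ball[OF nzd]) (use y in auto)
      also have "\<dots> \<le> 2 ^ D * cmod (coeff (P d) D)"
        by (intro mult_right_mono power_increasing degree_reverse_coeffs) auto
      finally show ?thesis .
    qed
    moreover have "0 \<le> C" using order.trans[OF norm_ge_zero bd[OF f]] .
    ultimately show ?thesis using bd[OF f] by (simp only: norm_mult) (rule mult_mono, auto)
  qed
  have all: "cmod (poly (reverse_coeffs D (P j)) y) \<le> C * (2 ^ D * cmod (coeff (P d) D))" if "cmod y < e" for y
  proof (cases "y = 0")
    case True
    have "((\<lambda>y. cmod (poly (reverse_coeffs D (P j)) y)) \<longlongrightarrow> cmod (poly (reverse_coeffs D (P j)) 0)) (at 0)"
      by (intro tendsto_intros poly_isCont[unfolded isCont_def])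
    moreover have "\<forall>\<^sub>F y in at 0. cmod (poly (reverse_coeffs D (P j)) y) \<le> C * (2 ^ D * cmod (coeff (P d) D))"
      unfolding eventually_at using off assms(2) by (intro exI[of _ e]) auto
    ultimately show ?thesis unfolding True by (rule tendsto_upperbound) simp
  qed (use off that in auto)
  have "cmod (coeff (reverse_coeffs D (P j)) (D - i)) \<le> C * (2 ^ D * cmod (coeff (P d) D)) / e ^ (D - i)"
    by (rule poly_coeff_cauchy_bound[OF assms(2) all])
  then show ?thesis using i by (simp add: coeff_reverse_coeffs mult.assoc)
qed

section \<open>Polynomials whose coefficients depend on a parameter\<close>

definition eval_coeffs :: "nat \<Rightarrow> (nat \<Rightarrow> complex poly) \<Rightarrow> complex \<Rightarrow> complex poly" where
  "eval_coeffs D q t = (\<Sum>i\<le>D. monom (poly (q i) t) i)"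

lemma degree_eval_coeffs: "degree (eval_coeffs D q t) \<le> D"
  unfolding eval_coeffs_def by (intro degree_sum_le) (auto intro: order.trans[OF degree_monom_le])

lemma coeff_eval_coeffs: "coeff (eval_coeffs D q t) i = (if i \<le> D then poly (q i) t else 0)"
  by (simp add: eval_coeffs_def coeff_sum coeff_monom)

lemma poly_eval_coeffs: "poly (eval_coeffs D q t) x = (\<Sum>i\<le>D. poly (q i) t * x ^ i)"
  by (simp add: eval_coeffs_def poly_sum poly_monom)

text \<open>The polynomial case of Hurwitz' theorem.\<close>

lemma eval_coeffs_limit_root:
  assumes lim: "t0 islimpt S" and r: "0 < r"
    and nz: "\<And>t x. t \<in> S \<Longrightarrow> dist t0 t < e \<Longrightarrow> dist z x < r \<Longrightarrow> poly (eval_coeffs D q t) x \<noteq> 0" and e: "0 < e"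
    and root: "poly (eval_coeffs D q t0) z = 0"
  shows "eval_coeffs D q t0 = 0"
proof -
  have cont: "((\<lambda>t. poly (eval_coeffs D q t) x) \<longlongrightarrow> poly (eval_coeffs D q t0) x) (at t0 within S)" for x
    unfolding poly_eval_coeffs 
    by (intro tendsto_intros tendsto_within_subset[OF poly_isCont[unfolded isCont_def] subset_UNIV])
  \<comment> \<open>For \<open>t\<close> near \<open>t0\<close> the value at \<open>x\<close> is at
    most 2^D times the value at \<open>z\<close>, and the latter tends to 0.\<close>
  have "poly (eval_coeffs D q t0) x = 0" if x: "dist z x < r" for x
  proof -
    have "\<forall>\<^sub>F t in at t0 within S. cmod (poly (eval_coeffs D q t) x) \<le> 2 ^ D * cmod (poly (eval_coeffs D q t) z)"
      unfolding eventually_at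
    proof (intro exI[of _ e] conjI ballI impI e)
      fix t assume t: "t \<in> S" "t \<noteq> t0 \<and> dist t t0 < e"
      have "cmod (poly (eval_coeffs D q t) x) \<le> 2 ^ degree (eval_coeffs D q t) * cmod (poly (eval_coeffs D q t) z)"
        by (rule norm_poly_le_of_no_root_ball[OF _ x]) (use t nz in \<open>auto simp: dist_commute\<close>)
      also have "\<dots> \<le> 2 ^ D * cmod (poly (eval_coeffs D q t) z)"
        by (intro mult_right_mono power_increasing degree_eval_coeffs) auto
      finally show "cmod (poly (eval_coeffs D q t) x) \<le> 2 ^ D * cmod (poly (eval_coeffs D q t) z)" .
    qed
    moreover have "at t0 within S \<noteq> bot" using lim by (simp add: trivial_limit_within)
    ultimately have "cmod (poly (eval_coeffs D q t0) x) \<le> 2 ^ D * cmod (poly (eval_coeffs D q t0) z)"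
      by (intro tendsto_le[OF _ tendsto_mult[OF tendsto_const tendsto_norm[OF cont]] tendsto_norm[OF cont]])
    then show ?thesis using root by simp
  qed
  then have "ball z r \<subseteq> {x. poly (eval_coeffs D q t0) x = 0}" by auto
  moreover have "infinite (ball z r)" using r countable_finite uncountable_ball by blast
  ultimately show ?thesis using poly_roots_finite finite_subset by metis
qed

section \<open>Families of rational curves\<close>

lemma fps_of_poly_eqI:
  fixes F :: "'a::comm_ring_1 fps"
  assumes "\<And>m. m > D \<Longrightarrow> fps_nth F m = 0"
  obtains p where "F = fps_of_poly p" "degree p \<le> D"
proof
  let ?p = "\<Sum>i\<le>D. monom (fps_nth F i) i"
  show "F = fps_of_poly ?p"
    by (rule fps_ext) (auto simp: coeff_sum coeff_monom assms)
  show "degree ?p \<le> D" by (intro degree_sum_le) (auto intro: order.trans[OF degree_monom_le])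
qed

text \<open>Beyond index \<open>D\<close> the coefficients of the product have D + 1 terms and are
  linear in the coefficients of \<open>p\<close>. Their vanishing is the Pade system that
  characterizes denominators of \<open>F\<close>.\<close>

lemma fps_nth_fps_of_poly_mult:
  fixes p :: "'a::comm_ring_1 poly"
  assumes "degree p \<le> D" "D < m"
  shows "fps_nth (fps_of_poly p * F) m = (\<Sum>i<Suc D. coeff p i * fps_nth F (m - i))"
proof -
  have "fps_nth (fps_of_poly p * F) m = (\<Sum>i=0..m. coeff p i * fps_nth F (m - i))"
    by (simp add: fps_mult_nth)
  also have "\<dots> = (\<Sum>i<Suc D. coeff p i * fps_nth F (m - i))"
    using assms by (intro sum.mono_neutral_right) (auto, metis coeff_eq_0 less_Suc_eq_le mult_zero_left not_less order.strict_trans1)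
  finally show ?thesis .
qed

lemma rational_lift_taylor:
  assumes P: "rational_lift d V P" and r: "0 < r"
    and nz: "\<And>x. cmod x < r \<Longrightarrow> V x d \<noteq> 0" and hol: "(\<lambda>x. V x j / V x d) holomorphic_on ball 0 r"
  shows "fps_of_poly (P j) = fps_of_poly (P d) * fps_expansion (\<lambda>x. V x j / V x d) 0"
proof -
  let ?G = "\<lambda>x. V x j / V x d"
  have poly_exp: "poly p has_fps_expansion fps_of_poly p" for p :: "complex poly"
    by (simp add: has_fps_expansion_def)
  have G: "?G has_fps_expansion fps_expansion ?G 0"
    using hol r by (intro has_fps_expansion_fps_expansion[of "ball 0 r"]) auto
  have "(\<lambda>x. poly (P d) x * ?G x) has_fps_expansion fps_of_poly (P d) * fps_expansion ?G 0"
    by (intro has_fps_expansion_mult poly_exp G)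
  then have "poly (P j) has_fps_expansion fps_of_poly (P d) * fps_expansion ?G 0"
  proof (rule iffD1[OF has_fps_expansion_cong[OF _ refl], rotated])
    show "\<forall>\<^sub>F x in nhds 0. poly (P d) x * ?G x = poly (P j) x"
  proof -
    have "\<forall>\<^sub>F x in nhds 0. x \<in> ball 0 r" using r by (intro eventually_nhds_in_open) auto
    then show ?thesis
    proof eventually_elim
      case (elim x)
      obtain c where "\<forall>j. poly (P j) x = c * V x j" using P unfolding rational_lift_def by blast
      then show ?case using nz[of x] elim by simp
    qed
  qed
  qed
  then show ?thesis using poly_exp[of "P j"] by (rule fps_expansion_unique_complex[rotated])
qed

text \<open>\<open>t\<close> moves along a complex line of loops, \<open>x\<close> along the ray
  through the loop at \<open>t\<close>. The conditions near x = 0 hold for every \<open>t\<close>,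
  also outside \<open>T\<close>, which makes the Taylor coefficients at x = 0 entire in
  \<open>t\<close>; the region |x| (1 + |t|) < r reflects the size of x (a + t b). Lifts and control
  near x = infinity are available for \<open>t\<close> in \<open>T\<close> only.\<close>

locale rational_curve_family =
  fixes V :: "complex \<Rightarrow> complex \<Rightarrow> 'j \<Rightarrow> complex" and d :: 'j and T :: "complex set"
    and r :: real and C :: "'j \<Rightarrow> real"
  assumes T: "open T" "closure T = UNIV"
    and lift: "t \<in> T \<Longrightarrow> \<exists>P. rational_lift d (V t) P"
    and far: "t0 \<in> T \<Longrightarrow> \<exists>e>0. \<forall>t\<in>ball t0 e. t \<in> T \<and> (\<forall>x. 1 / e < cmod x \<longrightarrow> V t x d \<noteq> 0)"
    and r: "0 < r"
    and near: "cmod x * (1 + cmod t) < r \<Longrightarrow> V t x d \<noteq> 0"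
    and near_bound: "cmod x * (1 + cmod t) < r \<Longrightarrow> cmod (V t x j / V t x d) \<le> C j"
    and hol_x: "(\<lambda>x. V t x j / V t x d) holomorphic_on ball 0 (r / (1 + cmod t))"
    and hol_t: "(\<lambda>t. V t x j / V t x d) holomorphic_on {t. cmod x * (1 + cmod t) < r}"
    and nonzero: "\<exists>k. V t x k \<noteq> 0"
    and stable: "V t0 x0 k \<noteq> 0 \<Longrightarrow> \<exists>e>0. \<forall>t\<in>ball t0 e. \<forall>x\<in>ball x0 e. V t x k \<noteq> 0"
begin

definition G :: "'j \<Rightarrow> complex \<Rightarrow> complex \<Rightarrow> complex" where "G j t x = V t x j / V t x d"

lemma near_iff: "cmod x * (1 + cmod t) < r \<longleftrightarrow> x \<in> ball 0 (r / (1 + cmod t))"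
proof -
  have "0 < 1 + cmod t" using norm_ge_zero[of t] by linarith
  then show ?thesis by (simp add: pos_less_divide_eq)
qed

text \<open>The coefficient is entire in \<open>t\<close>, and Cauchy's estimate on a circle of
  radius proportional to 1 / (1 + |t|) bounds it by a multiple of (1 + |t|)^m. Liouville's theorem
  does the rest.\<close>

lemma taylor_coeff_poly:
  "\<exists>g. \<forall>t. poly g t = fps_nth (fps_expansion (G j t) 0) m"
proof -
  let ?g = "\<lambda>t. (deriv ^^ m) (G j t) 0 / fact m"
  have hol: "?g holomorphic_on UNIV"
  proof -
    \<comment> \<open>The radius of the disc in \<open>x\<close> shrinks as \<open>t\<close> grows;
      for |t| < R the radius r / (1 + R) serves all \<open>t\<close> at once.\<close>
    have "?g holomorphic_on ball 0 R" if "0 < R" for R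
    proof (rule taylor_coeff_holomorphic_in_parameter[where r = "r / (1 + R)" and K = "C j"])
      have sub: "cmod x * (1 + cmod t) < r" if "t \<in> ball 0 R" "x \<in> ball 0 (r / (1 + R))" for t x :: complex
      proof -
        have "cmod x * (1 + cmod t) \<le> cmod x * (1 + R)" using that by (intro mult_left_mono) auto
        also have "\<dots> < r" using that \<open>0 < R\<close> by (simp add: pos_less_divide_eq)
        finally show ?thesis .
      qed
      show "open (ball (0::complex) R)" by simp
      show "0 < r / (1 + R)" using r that by simp
      show "G j t holomorphic_on ball 0 (r / (1 + R))" if "t \<in> ball 0 R" for t
        unfolding G_def[abs_def] using hol_x
        by (rule holomorphic_on_subset) (use sub[OF that] near_iff in blast)
      show "cmod (G j t x) \<le> C j" if "t \<in> ball 0 R" "x \<in> ball 0 (r / (1 + R))" for t x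
        unfolding G_def by (rule near_bound[OF sub[OF that]])
      show "(\<lambda>t. G j t x) holomorphic_on ball 0 R" if "x \<in> ball 0 (r / (1 + R))" for x
        unfolding G_def using hol_t
        by (rule holomorphic_on_subset) (use sub[OF _ that] in blast)
    qed
    then have "?g field_differentiable at z" for z
      using holomorphic_on_imp_differentiable_at[of ?g "ball 0 (cmod z + 1)" z] by (simp add: add_nonneg_pos)
    then show ?thesis by (simp add: holomorphic_on_def)
  qed
  have bd: "cmod (?g t) \<le> C j * ((1 + cmod t) / (r / 2)) ^ m" for t
  proof -
    define s where "s = r / 2 / (1 + cmod t)"
    have pos: "0 < 1 + cmod t" using norm_ge_zero[of t] by linarith
    have s: "0 < s" "s < r / (1 + cmod t)" using r pos by (auto simp: s_def divide_simps)
    have sub: "cball 0 s \<subseteq> ball (0::complex) (r / (1 + cmod t))" using s by auto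
    have holG: "G j t holomorphic_on ball 0 (r / (1 + cmod t))" using hol_x unfolding G_def[abs_def] .
    have "norm ((deriv ^^ m) (G j t) 0) \<le> fact m * C j / s ^ m"
    proof (rule Cauchy_inequality)
      show "continuous_on (cball 0 s) (G j t)"
        using holomorphic_on_imp_continuous_on[OF holG] sub by (rule continuous_on_subset)
      show "G j t holomorphic_on ball 0 s" using holG by (rule holomorphic_on_subset) (use s in auto)
      show "norm (G j t x) \<le> C j" if "norm (0 - x) = s" for x
        unfolding G_def by (rule near_bound) (use that s near_iff[of x t] in auto)
    qed (use s in auto)
    then have "cmod (?g t) \<le> C j / s ^ m" using s by (simp add: norm_divide field_simps)
    also have "\<dots> = C j * ((1 + cmod t) / (r / 2)) ^ m" by (simp add: s_def power_divide field_simps)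
    finally show ?thesis .
  qed
  have liou: "?g t = (\<Sum>k\<le>m. (deriv^^k) ?g 0 / fact k * t ^ k)" for t
  proof (rule Liouville_polynomial[OF hol])
    fix t :: complex assume t: "1 \<le> cmod t"
    have C0: "0 \<le> C j" using order.trans[OF norm_ge_zero near_bound[of 0 0 j]] r by simp
    have "((1 + cmod t) / (r / 2)) ^ m \<le> (4 * cmod t / r) ^ m"
      using t r by (intro power_mono) (auto simp: field_simps)
    then have "C j * ((1 + cmod t) / (r / 2)) ^ m \<le> C j * (4 * cmod t / r) ^ m"
      using C0 by (rule mult_left_mono)
    with bd[of t] show "cmod (?g t) \<le> C j * (4 / r) ^ m * cmod t ^ m"
      by (simp add: power_mult_distrib power_divide mult.assoc)
  qed
  have "poly (\<Sum>k\<le>m. monom ((deriv^^k) ?g 0 / fact k) k) t = fps_nth (fps_expansion (G j t) 0) m" for t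
  proof -
    have "poly (\<Sum>k\<le>m. monom ((deriv^^k) ?g 0 / fact k) k) t = (\<Sum>k\<le>m. (deriv^^k) ?g 0 / fact k * t ^ k)"
      by (simp add: poly_sum poly_monom)
    also have "\<dots> = ?g t" by (rule liou[symmetric])
    also have "\<dots> = fps_nth (fps_expansion (G j t) 0) m" by (simp add: fps_expansion_def)
    finally show ?thesis .
  qed
  then show ?thesis by blast
qed

definition g :: "'j \<Rightarrow> nat \<Rightarrow> complex poly" where
  "g j m = (SOME p. \<forall>t. poly p t = fps_nth (fps_expansion (G j t) 0) m)"

lemma poly_g: "poly (g j m) t = fps_nth (fps_expansion (G j t) 0) m"
  using someI_ex[OF taylor_coeff_poly[of j m]] unfolding g_def[symmetric] by blast

definition lift_at :: "complex \<Rightarrow> 'j \<Rightarrow> complex poly" where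
  "lift_at t = (SOME P. rational_lift d (V t) P)"

lemma lift_at: "t \<in> T \<Longrightarrow> rational_lift d (V t) (lift_at t)"
  unfolding lift_at_def by (rule someI_ex[OF lift])

lemma lift_at_taylor:
  assumes "t \<in> T"
  shows "fps_of_poly (lift_at t j) = fps_of_poly (lift_at t d) * fps_expansion (G j t) 0"
proof -
  have pos: "0 < 1 + cmod t" using norm_ge_zero[of t] by linarith
  have "fps_of_poly (lift_at t j) = fps_of_poly (lift_at t d) * fps_expansion (\<lambda>x. V t x j / V t x d) 0"
    by (rule rational_lift_taylor[OF lift_at[OF assms] _ _ hol_x])
      (use r pos near near_iff in auto)
  then show ?thesis unfolding G_def[abs_def] .
qed

lemma lift_at_nonzero: "t \<in> T \<Longrightarrow> \<exists>j. poly (lift_at t j) x \<noteq> 0"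
  using lift_at[of t] nonzero[of t x] unfolding rational_lift_def by (metis mult_eq_0_iff)

lemma lift_at_d_nonzero: "t \<in> T \<Longrightarrow> lift_at t d \<noteq> 0"
  using lift_at[of t] by (auto simp: rational_lift_def)

text \<open>A solution \<open>c\<close> of the linear system clears the denominators of all
  coordinates. Since the lift has no common zeros, its denominator divides \<open>c\<close>, with a
  cofactor independent of \<open>j\<close>.\<close>

lemma denominator_dvd:
  assumes t: "t \<in> T" and deg: "degree c \<le> D"
    and ker: "\<And>j m. m > D \<Longrightarrow> (\<Sum>i<Suc D. coeff c i * poly (g j (m - i)) t) = 0"
  shows "\<exists>\<kappa>. c = lift_at t d * \<kappa> \<and> (\<forall>j. fps_of_poly c * fps_expansion (G j t) 0 = fps_of_poly (lift_at t j * \<kappa>))"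
proof -
  have "\<exists>q. fps_of_poly c * fps_expansion (G j t) 0 = fps_of_poly q" for j
  proof -
    have "fps_nth (fps_of_poly c * fps_expansion (G j t) 0) m = 0" if "m > D" for m
      using fps_nth_fps_of_poly_mult[OF deg that] ker[OF that, of j] by (simp add: poly_g)
    then show ?thesis by (metis fps_of_poly_eqI)
  qed
  then obtain Q where Q: "\<And>j. fps_of_poly c * fps_expansion (G j t) 0 = fps_of_poly (Q j)" by metis
  have rel: "lift_at t d * Q j = c * lift_at t j" for j
  proof -
    have "fps_of_poly (lift_at t d * Q j) = fps_of_poly (c * lift_at t j)"
      unfolding fps_of_poly_mult Q[symmetric] lift_at_taylor[OF t, of j] by (simp add: mult_ac)
    then show ?thesis by (simp add: fps_of_poly_eq_iff)
  qed
  have "lift_at t d dvd c"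
    by (rule common_denominator_dvd[OF lift_at_d_nonzero[OF t] rel lift_at_nonzero[OF t]])
  then obtain \<kappa> where k: "c = lift_at t d * \<kappa>" by (rule dvdE)
  have "Q j = lift_at t j * \<kappa>" for j
  proof -
    have "lift_at t d * Q j = lift_at t d * (lift_at t j * \<kappa>)" using rel[of j] by (simp add: k mult_ac)
    then show ?thesis using lift_at_d_nonzero[OF t] by simp
  qed
  then show ?thesis using k Q by auto
qed

text \<open>\<open>T\<close> is uncountable and a countable union of sets of bounded degree, so some
  bound holds for infinitely many \<open>t\<close>. Below the least such bound there are only
  finitely many.\<close>

lemma generic_degree:
  obtains D where "infinite {t \<in> T. degree (lift_at t d) \<le> D}" "finite {t \<in> T. degree (lift_at t d) < D}"
proof -
  have "\<exists>D. infinite {t \<in> T. degree (lift_at t d) \<le> D}"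
  proof (rule ccontr)
    assume "\<not> ?thesis"
    then have "countable (\<Union>D. {t \<in> T. degree (lift_at t d) \<le> D})" by (intro countable_UN) (auto intro: countable_finite)
    moreover have "T = (\<Union>D. {t \<in> T. degree (lift_at t d) \<le> D})" by auto
    moreover have "T \<noteq> {}" using T(2) by auto
    then have "uncountable T" using T(1) by (meson open_contains_ball all_not_in_conv countable_subset uncountable_ball)
    ultimately show False by simp
  qed
  define D where "D = (LEAST D. infinite {t \<in> T. degree (lift_at t d) \<le> D})"
  have "infinite {t \<in> T. degree (lift_at t d) \<le> D}"
    unfolding D_def by (rule LeastI_ex) fact
  moreover have "finite {t \<in> T. degree (lift_at t d) < D}"
  proof (cases D)
    case (Suc D')
    have "\<not> infinite {t \<in> T. degree (lift_at t d) \<le> D'}"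
      by (rule not_less_Least) (simp add: D_def[symmetric] Suc)
    then show ?thesis by (simp add: Suc less_Suc_eq_le)
  qed simp
  ultimately show ?thesis by (rule that)
qed

text \<open>For infinitely many \<open>t\<close> the coefficients of the actual denominator solve
  the system at \<open>t\<close>; \<open>generic_kernel_vector\<close> produces a solution over the
  polynomial ring.\<close>

lemma generic_denominator:
  assumes D: "infinite {t \<in> T. degree (lift_at t d) \<le> D}"
  obtains A where "\<exists>k<Suc D. A k \<noteq> 0" "\<And>j m. m > D \<Longrightarrow> (\<Sum>i<Suc D. A i * g j (m - i)) = 0"
proof -
  \<comment> \<open>A pair (j, l) indexes the equation of coordinate \<open>j\<close> at the power D
    + 1 + l.\<close>
  define R where "R = (\<lambda>p i. g (fst p) (Suc D + snd p - i) :: complex poly)"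
  have ker: "\<exists>c. (\<exists>k<Suc D. c k \<noteq> 0) \<and> (\<forall>p. (\<Sum>k<Suc D. c k * poly (R p k) t) = 0)"
    if "t \<in> {t \<in> T. degree (lift_at t d) \<le> D}" for t
  proof (intro exI[of _ "coeff (lift_at t d)"] conjI allI)
    from that have t: "t \<in> T" and deg: "degree (lift_at t d) \<le> D" by auto
    show "\<exists>k<Suc D. coeff (lift_at t d) k \<noteq> 0"
      using lift_at_d_nonzero[OF t] deg by (intro exI[of _ "degree (lift_at t d)"]) simp
    fix p :: "'j \<times> nat"
    have "(\<Sum>k<Suc D. coeff (lift_at t d) k * poly (R p k) t) =
        fps_nth (fps_of_poly (lift_at t d) * fps_expansion (G (fst p) t) 0) (Suc D + snd p)"
      using fps_nth_fps_of_poly_mult[OF deg, of "Suc D + snd p"] by (simp add: R_def poly_g del: sum.lessThan_Suc)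
    also have "\<dots> = coeff (lift_at t (fst p)) (Suc D + snd p)"
      by (simp flip: lift_at_taylor[OF t])
    also have "\<dots> = 0"
    proof (rule coeff_eq_0)
      have "degree (lift_at t (fst p)) \<le> degree (lift_at t d)"
        using lift_at[OF t] unfolding rational_lift_def by blast
      then show "degree (lift_at t (fst p)) < Suc D + snd p" using deg by linarith
    qed
    finally show "(\<Sum>k<Suc D. coeff (lift_at t d) k * poly (R p k) t) = 0" .
  qed
  have "\<exists>A. (\<exists>k<Suc D. A k \<noteq> 0) \<and> (\<forall>p. (\<Sum>k<Suc D. A k * R p k) = 0)"
    by (rule generic_kernel_vector[OF D], rule ker)
  then obtain A where "(\<exists>k<Suc D. A k \<noteq> 0) \<and> (\<forall>p. (\<Sum>k<Suc D. A k * R p k) = 0)" by (rule exE)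
  then have A: "\<exists>k<Suc D. A k \<noteq> 0" "\<forall>p. (\<Sum>k<Suc D. A k * R p k) = 0" by (rule conjunct1, rule conjunct2)
  have "(\<Sum>i<Suc D. A i * g j (m - i)) = 0" if "m > D" for j m
    using spec[OF A(2), of "(j, m - Suc D)"] that by (simp add: R_def del: sum.lessThan_Suc)
  with A(1) show ?thesis by (rule that)
qed

lemma T_minus_finite_dense: "closure (T - E) = UNIV" if "finite E"
proof -
  have "x \<in> closure (T - E)" for x
    unfolding closure_approachable
  proof (intro allI impI)
    fix e :: real assume e: "0 < e"
    have "x \<in> closure T" using T by simp
    then obtain y where y: "y \<in> T" "dist y x < e" using e unfolding closure_approachable by blast
    have "open (T \<inter> ball x e)" using T by auto
    moreover have "y \<in> T \<inter> ball x e" using y by (simp add: dist_commute)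
    ultimately obtain s where s: "0 < s" "ball y s \<subseteq> T \<inter> ball x e" by (meson openE)
    have "\<not> ball y s \<subseteq> E" using s(1) that finite_subset countable_finite uncountable_ball by blast
    then show "\<exists>y\<in>T - E. dist y x < e" using s by (force simp: dist_commute)
  qed
  then show ?thesis by auto
qed

lemma islimpt_T_minus_finite: "t0 islimpt T - E" if "finite E"
  using T_minus_finite_dense[of "insert t0 E"] that
  by (simp add: islimpt_in_closure flip: Diff_insert)

text \<open>Off a finite set the generic kernel vector is proportional to the denominator, whose
  constant coefficient is 1, so the coefficients are A i / A 0. Bounds on them show that
  \<open>A 0\<close> divides \<open>A i\<close>. At the remaining parameters a nonconstant cofactor
  or a drop of the degree would create a zero in a region that is zero-free for all nearby generic
  \<open>t\<close>.\<close>

theorem lift_coeffs_polynomial: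
  obtains D q where "\<And>t. t \<in> T \<Longrightarrow> degree (lift_at t d) = D"
    "\<And>t j. t \<in> T \<Longrightarrow> lift_at t j = eval_coeffs D (q j) t"
    "\<And>i. i \<le> D \<Longrightarrow> degree (q d i) \<le> i"
proof -
  obtain D where D: "infinite {t \<in> T. degree (lift_at t d) \<le> D}" "finite {t \<in> T. degree (lift_at t d) < D}"
    by (rule generic_degree)
  obtain A where A: "\<exists>k<Suc D. A k \<noteq> 0" and Aker: "\<And>j m. m > D \<Longrightarrow> (\<Sum>i<Suc D. A i * g j (m - i)) = 0"
    by (rule generic_denominator[OF D(1)]) (iprover intro: that)
  \<comment> \<open>The parameters with a degree below the generic one, and those at which the
    kernel vector specializes to 0.\<close>
  define E where "E = {t \<in> T. degree (lift_at t d) < D} \<union> {t. \<forall>k<Suc D. poly (A k) t = 0}"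
  have finE: "finite E"
  proof -
    obtain k where k: "k < Suc D" "A k \<noteq> 0" using A by blast
    have "{t. \<forall>k<Suc D. poly (A k) t = 0} \<subseteq> {t. poly (A k) t = 0}" using k by blast
    then have "finite {t. \<forall>k<Suc D. poly (A k) t = 0}" using poly_roots_finite[OF k(2)] by (rule finite_subset)
    then show ?thesis unfolding E_def using D(2) by simp
  qed
  have gen: "degree (lift_at t d) = D \<and> poly (A 0) t \<noteq> 0 \<and>
      (\<forall>i\<le>D. poly (A i) t = poly (A 0) t * coeff (lift_at t d) i)" if t: "t \<in> T - E" for t
  proof -
    let ?c = "eval_coeffs D A t"
    have tT: "t \<in> T" using t by simp
    have "(\<Sum>i<Suc D. coeff ?c i * poly (g j (m - i)) t) = 0" if "m > D" for j m
    proof -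
      have "(\<Sum>i<Suc D. coeff ?c i * poly (g j (m - i)) t) = poly (\<Sum>i<Suc D. A i * g j (m - i)) t"
        unfolding poly_sum by (intro sum.cong) (auto simp: coeff_eval_coeffs)
      then show ?thesis by (simp only: Aker[OF that] poly_0)
    qed
    from denominator_dvd[OF tT degree_eval_coeffs this] obtain \<kappa> where k: "?c = lift_at t d * \<kappa>" by blast
    have "?c \<noteq> 0"
    proof
      assume "?c = 0"
      then have "poly (A k) t = 0" if "k < Suc D" for k
        using coeff_eval_coeffs[of D A t k] that by simp
      then show False using t by (simp add: E_def)
    qed
    then have "\<kappa> \<noteq> 0" using k by auto
    \<comment> \<open>The product has degree at most \<open>D\<close> and the denominator at least
      \<open>D\<close>, so the cofactor is constant.\<close>
    have "degree (lift_at t d) + degree \<kappa> \<le> D"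
      using degree_eval_coeffs[of D A t] \<open>\<kappa> \<noteq> 0\<close> lift_at_d_nonzero[OF tT] by (simp add: k degree_mult_eq)
    moreover have "\<not> degree (lift_at t d) < D" using t by (simp add: E_def)
    ultimately have deg: "degree (lift_at t d) = D" "degree \<kappa> = 0" by auto
    then obtain a where "\<kappa> = [:a:]" by (metis degree_eq_zeroE)
    then have c: "coeff ?c i = a * coeff (lift_at t d) i" for i using k by simp
    have "coeff (lift_at t d) 0 = 1" using lift_at[OF tT] by (simp add: rational_lift_def poly_0_coeff_0)
    then have "a = poly (A 0) t" using c[of 0] by (simp add: coeff_eval_coeffs)
    moreover have "a \<noteq> 0" using \<open>\<kappa> \<noteq> 0\<close> \<open>\<kappa> = [:a:]\<close> by auto
    ultimately show ?thesis using deg c by (metis coeff_eval_coeffs)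
  qed
  have gen_deg: "degree (lift_at t d) = D" and gen_nz: "poly (A 0) t \<noteq> 0" if "t \<in> T - E" for t
    using gen[OF that] by blast+
  obtain t1 where t1: "t1 \<in> T - E" using T_minus_finite_dense[OF finE] by (metis closure_empty UNIV_not_empty ex_in_conv)
  have A0: "A 0 \<noteq> 0" using gen_nz[OF t1] by auto
  \<comment> \<open>The bound on A i / A 0, known off the finite set, is multiplied out and extended
    to the whole plane by density. It then covers the zeros of \<open>A 0\<close> too, which is what
    permits the division.\<close>
  have growth: "cmod (poly (A i) t) \<le> 2 ^ D / r ^ i * (1 + cmod t) ^ i * cmod (poly (A 0) t)" if i: "i \<le> D" for i t
  proof (rule dense_limit_le[OF T_minus_finite_dense[OF finE], where f = "\<lambda>t. cmod (poly (A i) t)"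
        and g = "\<lambda>t. 2 ^ D / r ^ i * (1 + cmod t) ^ i * cmod (poly (A 0) t)"])
    fix t assume t: "t \<in> T - E"
    have pos: "0 < 1 + cmod t" using norm_ge_zero[of t] by linarith
    have "cmod (coeff (lift_at t d) i) \<le> 2 ^ degree (lift_at t d) / (r / (1 + cmod t)) ^ i"
      by (rule rational_lift_coeff_bound_zero[OF lift_at]) (use t r pos near near_iff in auto)
    also have "\<dots> = 2 ^ D / r ^ i * (1 + cmod t) ^ i" by (simp add: power_divide gen_deg[OF t])
    finally have "cmod (poly (A 0) t) * cmod (coeff (lift_at t d) i) \<le>
        cmod (poly (A 0) t) * (2 ^ D / r ^ i * (1 + cmod t) ^ i)" by (rule mult_left_mono) simp
    moreover have "poly (A i) t = poly (A 0) t * coeff (lift_at t d) i" using gen[OF t] i by blast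
    ultimately show "cmod (poly (A i) t) \<le> 2 ^ D / r ^ i * (1 + cmod t) ^ i * cmod (poly (A 0) t)"
      by (simp only: norm_mult mult.commute)
  qed (intro continuous_intros)+
  have "\<exists>s. i \<le> D \<longrightarrow> A i = s * A 0 \<and> degree s \<le> i" for i
  proof (cases "i \<le> D")
    case True
    show ?thesis using poly_divide_of_growth[OF A0 growth[OF True]] by blast
  qed simp
  then obtain qd where qd: "\<And>i. i \<le> D \<Longrightarrow> A i = qd i * A 0" "\<And>i. i \<le> D \<Longrightarrow> degree (qd i) \<le> i" by metis
  have qd0: "qd 0 = 1" using qd(1)[of 0] A0 by simp
  have qker: "(\<Sum>i<Suc D. qd i * g j (m - i)) = 0" if "m > D" for j m
  proof -
    have "A 0 * (\<Sum>i<Suc D. qd i * g j (m - i)) = (\<Sum>i<Suc D. A i * g j (m - i))"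
      unfolding sum_distrib_left
    proof (rule sum.cong[OF refl])
      fix i assume "i \<in> {..<Suc D}"
      then have "A i = qd i * A 0" by (intro qd(1)) simp
      then show "A 0 * (qd i * g j (m - i)) = A i * g j (m - i)" by (simp only: mult_ac)
    qed
    then show ?thesis using Aker[OF that] A0 by simp
  qed
  \<comment> \<open>The numerators, as Cauchy products of the denominator with the Taylor
    series.\<close>
  define p where "p = (\<lambda>j i. \<Sum>l\<le>i. qd l * g j (i - l))"
  let ?\<nu> = "eval_coeffs D qd"
  have nu: "\<exists>\<kappa>. ?\<nu> t = lift_at t d * \<kappa> \<and> (\<forall>j. lift_at t j * \<kappa> = eval_coeffs D (p j) t)" if t: "t \<in> T" for t
  proof -
    have ker: "(\<Sum>i<Suc D. coeff (?\<nu> t) i * poly (g j (m - i)) t) = 0" if "m > D" for j m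
    proof -
      have "(\<Sum>i<Suc D. coeff (?\<nu> t) i * poly (g j (m - i)) t) = poly (\<Sum>i<Suc D. qd i * g j (m - i)) t"
        unfolding poly_sum by (intro sum.cong) (auto simp: coeff_eval_coeffs)
      then show ?thesis by (simp only: qker[OF that] poly_0)
    qed
    from denominator_dvd[OF t degree_eval_coeffs ker] obtain \<kappa> where k: "?\<nu> t = lift_at t d * \<kappa>"
      "\<And>j. fps_of_poly (?\<nu> t) * fps_expansion (G j t) 0 = fps_of_poly (lift_at t j * \<kappa>)" by blast
    have "coeff (lift_at t j * \<kappa>) m = coeff (eval_coeffs D (p j) t) m" for j m
    proof -
      have "coeff (lift_at t j * \<kappa>) m = fps_nth (fps_of_poly (?\<nu> t) * fps_expansion (G j t) 0) m"
        unfolding k(2) by simp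
      also have "\<dots> = coeff (eval_coeffs D (p j) t) m"
      proof (cases "m \<le> D")
        case True
        then show ?thesis
          by (auto simp: fps_mult_nth coeff_eval_coeffs p_def poly_sum poly_g atMost_atLeast0 intro!: sum.cong)
      next
        case False
        then show ?thesis
          using fps_nth_fps_of_poly_mult[OF degree_eval_coeffs, of D m qd t] ker[of m j]
          by (simp add: coeff_eval_coeffs poly_g)
      qed
      finally show ?thesis .
    qed
    then have "lift_at t j * \<kappa> = eval_coeffs D (p j) t" for j by (rule poly_eqI)
    then show ?thesis using k(1) by blast
  qed
  have nu_gen: "?\<nu> t = lift_at t d" if t: "t \<in> T - E" for t
  proof (rule poly_eqI)
    fix i
    show "coeff (?\<nu> t) i = coeff (lift_at t d) i"
    proof (cases "i \<le> D")
      case True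
      have "poly (A i) t = poly (qd i) t * poly (A 0) t" by (simp only: qd(1)[OF True] poly_mult)
      moreover have "poly (A i) t = poly (A 0) t * coeff (lift_at t d) i" using gen[OF t] True by blast
      ultimately show ?thesis using gen_nz[OF t] True by (simp add: coeff_eval_coeffs)
    next
      case False
      then show ?thesis using gen_deg[OF t] by (simp add: coeff_eval_coeffs coeff_eq_0)
    qed
  qed
  have p_gen: "eval_coeffs D (p j) t = lift_at t j" if t: "t \<in> T - E" for t j
  proof -
    have tT: "t \<in> T" using t by simp
    obtain \<kappa> where k: "?\<nu> t = lift_at t d * \<kappa>" "\<forall>j. lift_at t j * \<kappa> = eval_coeffs D (p j) t" using nu[OF tT] by blast
    have "lift_at t d * \<kappa> = lift_at t d * 1" using k(1) nu_gen[OF t] by simp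
    then have "\<kappa> = 1" using lift_at_d_nonzero[OF tT] by (metis mult_left_cancel)
    then show ?thesis using k(2) by simp
  qed
  have all: "degree (lift_at t0 d) = D \<and> ?\<nu> t0 = lift_at t0 d \<and> (\<forall>j. lift_at t0 j = eval_coeffs D (p j) t0)"
    if t0: "t0 \<in> T" for t0
  proof -
    obtain \<kappa> where k: "?\<nu> t0 = lift_at t0 d * \<kappa>" "\<forall>j. lift_at t0 j * \<kappa> = eval_coeffs D (p j) t0" using nu[OF t0] by blast
    have nu0: "coeff (?\<nu> t0) 0 = 1" by (simp add: coeff_eval_coeffs qd0)
    then have k0: "\<kappa> \<noteq> 0" using k(1) by auto
    \<comment> \<open>At a root \<open>y\<close> all polynomials
      \<open>eval_coeffs D (p j) t0\<close> would vanish. Some coordinate \<open>l\<close> of the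
      curve is nonzero near (t0, y), so for nearby generic \<open>t\<close> its polynomial has no
      root near \<open>y\<close>. In the limit it would vanish identically, although the lift at
      \<open>t0\<close> is nonzero at \<open>y\<close> in coordinate \<open>l\<close>.\<close>
    have "poly \<kappa> y \<noteq> 0" for y
    proof
      assume y: "poly \<kappa> y = 0"
      obtain l where l: "V t0 y l \<noteq> 0" using nonzero by blast
      then obtain e where e: "0 < e" "\<forall>t\<in>ball t0 e. \<forall>x\<in>ball y e. V t x l \<noteq> 0" using stable by blast
      have lift_l: "poly (lift_at t l) x \<noteq> 0" if "t \<in> T" "V t x l \<noteq> 0" for t x
        using lift_at[OF that(1)] that(2) unfolding rational_lift_def by (metis mult_eq_0_iff)
      have "eval_coeffs D (p l) t0 = 0"
      proof (rule eval_coeffs_limit_root[OF islimpt_T_minus_finite[OF finE] e(1) _ e(1)])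
        show "poly (eval_coeffs D (p l) t) x \<noteq> 0" if "t \<in> T - E" "dist t0 t < e" "dist y x < e" for t x
          unfolding p_gen[OF that(1)] using that e(2) by (intro lift_l) auto
        show "poly (eval_coeffs D (p l) t0) y = 0" using y by (simp flip: spec[OF k(2)])
      qed
      then have "lift_at t0 l = 0" using k(2) k0 by (metis mult_eq_0_iff)
      then show False using lift_l[OF t0 l] by simp
    qed
    then have "degree \<kappa> = 0" using alg_closed_imp_poly_has_root[of \<kappa>] by blast
    then obtain a where a: "\<kappa> = [:a:]" by (metis degree_eq_zeroE)
    have "coeff (lift_at t0 d) 0 = 1" using lift_at[OF t0] by (simp add: rational_lift_def poly_0_coeff_0)
    then have "a = 1" using nu0 k(1) a by simp
    then have eq: "?\<nu> t0 = lift_at t0 d" "\<forall>j. lift_at t0 j = eval_coeffs D (p j) t0" using k a by auto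
    \<comment> \<open>A vanishing top coefficient is a zero of the reversed denominator at 0. By
      \<open>far\<close> the nearby reversed denominators have no zero there, so this one would
      vanish identically, but its coefficient of index \<open>D\<close> is 1.\<close>
    have "coeff (lift_at t0 d) D \<noteq> 0"
    proof
      assume D0: "coeff (lift_at t0 d) D = 0"
      let ?rev = "eval_coeffs D (\<lambda>i. qd (D - i))"
      have rev: "?rev t = reverse_coeffs D (?\<nu> t)" for t
        unfolding eval_coeffs_def[of D "\<lambda>i. qd (D - i)"] reverse_coeffs_def by (simp add: coeff_eval_coeffs)
      obtain e where e: "0 < e" "\<forall>t\<in>ball t0 e. t \<in> T \<and> (\<forall>x. 1 / e < cmod x \<longrightarrow> V t x d \<noteq> 0)"
        using far[OF t0] by blast
      have "?rev t0 = 0"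
      proof (rule eval_coeffs_limit_root[OF islimpt_T_minus_finite[OF finE] e(1) _ e(1)])
        show "poly (?rev t0) 0 = 0"
          using D0 by (simp add: rev eq(1) poly_0_coeff_0 coeff_reverse_coeffs)
        fix t x :: complex assume t: "t \<in> T - E" "dist t0 t < e" and x: "dist 0 x < e"
        have tT: "t \<in> T" using t by simp
        have deg: "degree (lift_at t d) = D" by (rule gen_deg[OF t(1)])
        show "poly (?rev t) x \<noteq> 0"
        proof (cases "x = 0")
          case True
          have "poly (?rev t) 0 = coeff (lift_at t d) D"
            by (simp add: rev nu_gen[OF t(1)] poly_0_coeff_0 coeff_reverse_coeffs)
          moreover have "coeff (lift_at t d) D \<noteq> 0"
            using leading_coeff_0_iff[of "lift_at t d"] lift_at_d_nonzero[OF tT] by (simp add: deg)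
          ultimately show ?thesis using True by simp
        next
          case False
          have "1 / e < cmod (1 / x)" using False x e(1) by (simp add: norm_divide frac_less2)
          then have "V t (1 / x) d \<noteq> 0" using e(2) t(2) by auto
          then have "poly (lift_at t d) (1 / x) \<noteq> 0"
            using lift_at[OF tT] unfolding rational_lift_def by (metis mult_eq_0_iff)
          then show ?thesis using False by (simp add: rev nu_gen[OF t(1)] poly_reverse_coeffs deg)
        qed
      qed
      then have "coeff (reverse_coeffs D (?\<nu> t0)) D = 0" by (simp flip: rev)
      then show False using nu0 by (simp add: coeff_reverse_coeffs)
    qed
    then have "D \<le> degree (lift_at t0 d)" by (rule le_degree)
    moreover have "degree (lift_at t0 d) \<le> D" using degree_eval_coeffs[of D qd t0] by (simp add: eq(1))
    ultimately show ?thesis using eq by auto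
  qed
  show ?thesis
  \<comment> \<open>For the coordinate \<open>d\<close> the polynomials \<open>qd\<close> are taken,
    because they carry the degree bound.\<close>
  proof (rule that[of D "\<lambda>j. if j = d then qd else p j"])
    show "degree (lift_at t d) = D" if "t \<in> T" for t using all[OF that] by blast
    show "lift_at t j = eval_coeffs D (if j = d then qd else p j) t" if "t \<in> T" for t j
      using all[OF that] by auto
    show "degree ((if d = d then qd else p d) i) \<le> i" if "i \<le> D" for i using qd(2)[OF that] by simp
  qed
qed

end

section \<open>Continuously differentiable loops\<close>

text \<open>One constant bounds both the value and the angular derivative. Inverses are easy to
  estimate in this norm, and it controls the Sobolev norm by \<open>C1_bound_W12\<close>, so the
  whole argument can be run on continuously differentiable loops.\<close>

definition C1_bound :: "(circle \<Rightarrow> complex) \<Rightarrow> real \<Rightarrow> bool" where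
  "C1_bound a M \<longleftrightarrow> (\<exists>a'. continuous_on UNIV a' \<and>
     (\<forall>t. ((\<lambda>t. a (circ t)) has_vector_derivative a' t) (at t) \<and> cmod (a (circ t)) \<le> M \<and> cmod (a' t) \<le> M))"

definition C1_loop :: "(circle \<Rightarrow> complex) \<Rightarrow> bool" where
  "C1_loop a \<longleftrightarrow> (\<exists>M. C1_bound a M)"

lemma C1_loopI: "C1_bound a M \<Longrightarrow> C1_loop a"
  by (auto simp: C1_loop_def)

lemma Rep_circle_circ [simp]: "Rep_circle (circ t) = cis t"
  unfolding circ_def by (subst Abs_circle_inverse) auto

lemma circ_surj: "\<exists>t\<in>{0..2*pi}. circ t = s"
proof -
  have "cmod (Rep_circle s) = 1" using Rep_circle[of s] by simp
  then obtain t where "0 \<le> t" "t < 2 * pi" "Rep_circle s = cis t"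
    by (metis complex_norm_eq_1_exp complex_unimodular_polar cis_conv_exp Complex_eq cis.ctr)
  then show ?thesis by (intro bexI[of _ t]) (auto simp: Rep_circle_inject[symmetric])
qed

lemma C1_bound_cmod: "C1_bound a M \<Longrightarrow> cmod (a s) \<le> M"
  using circ_surj[of s] by (auto simp: C1_bound_def)

lemma C1_bound_nonneg: "C1_bound a M \<Longrightarrow> 0 \<le> M"
  using C1_bound_cmod[of a M undefined] norm_ge_zero order.trans by blast

lemma C1_bound_mono: "C1_bound a M \<Longrightarrow> M \<le> N \<Longrightarrow> C1_bound a N"
  unfolding C1_bound_def by (meson order.trans)

lemma C1_bound_const: "C1_bound (\<lambda>_. c) (cmod c)"
  unfolding C1_bound_def by (intro exI[of _ "\<lambda>_. 0"]) (auto intro!: derivative_eq_intros)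

lemma C1_bound_add:
  assumes "C1_bound a M" "C1_bound b N"
  shows "C1_bound (\<lambda>s. a s + b s) (M + N)"
proof -
  obtain a' where a: "continuous_on UNIV a'" "\<forall>t. ((\<lambda>t. a (circ t)) has_vector_derivative a' t) (at t) \<and> cmod (a (circ t)) \<le> M \<and> cmod (a' t) \<le> M"
    using assms(1) unfolding C1_bound_def by blast
  obtain b' where b: "continuous_on UNIV b'" "\<forall>t. ((\<lambda>t. b (circ t)) has_vector_derivative b' t) (at t) \<and> cmod (b (circ t)) \<le> N \<and> cmod (b' t) \<le> N"
    using assms(2) unfolding C1_bound_def by blast
  show ?thesis unfolding C1_bound_def
  proof (intro exI[of _ "\<lambda>t. a' t + b' t"] conjI allI)
    show "continuous_on UNIV (\<lambda>t. a' t + b' t)" using a(1) b(1) by (rule continuous_on_add)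
    fix t
    show "((\<lambda>t. a (circ t) + b (circ t)) has_vector_derivative a' t + b' t) (at t)"
      using a(2) b(2) by (intro has_vector_derivative_add) auto
    show "cmod (a (circ t) + b (circ t)) \<le> M + N" "cmod (a' t + b' t) \<le> M + N"
      using a(2) b(2) by (auto intro: norm_triangle_mono)
  qed
qed

lemma C1_bound_cmult:
  assumes "C1_bound a M"
  shows "C1_bound (\<lambda>s. c * a s) (cmod c * M)"
proof -
  obtain a' where a: "continuous_on UNIV a'" "\<forall>t. ((\<lambda>t. a (circ t)) has_vector_derivative a' t) (at t) \<and> cmod (a (circ t)) \<le> M \<and> cmod (a' t) \<le> M"
    using assms(1) unfolding C1_bound_def by blast
  show ?thesis unfolding C1_bound_def
  proof (intro exI[of _ "\<lambda>t. c * a' t"] conjI allI)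
    show "continuous_on UNIV (\<lambda>t. c * a' t)" using a(1) by (rule continuous_on_mult_left)
    fix t
    show "((\<lambda>t. c * a (circ t)) has_vector_derivative c * a' t) (at t)"
      using a(2) by (intro has_vector_derivative_mult_right) auto
    show "cmod (c * a (circ t)) \<le> cmod c * M" "cmod (c * a' t) \<le> cmod c * M"
      using a(2) by (auto simp: norm_mult intro: mult_left_mono)
  qed
qed

lemma C1_bound_inverse:
  assumes a: "continuous_on UNIV a'" "\<And>t. ((\<lambda>t. a (circ t)) has_vector_derivative a' t) (at t)"
    and nz: "\<And>s. a s \<noteq> 0" and K: "\<And>s. cmod (1 / a s) \<le> K" "\<And>t. cmod (a' t / (a (circ t))\<^sup>2) \<le> K"
  shows "C1_bound (\<lambda>s. 1 / a s) K"
  unfolding C1_bound_def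
proof (intro exI[of _ "\<lambda>t. - (a' t / (a (circ t))\<^sup>2)"] conjI allI)
  have "continuous_on UNIV (\<lambda>t. a (circ t))"
    using a(2) by (meson has_vector_derivative_continuous continuous_at_imp_continuous_on)
  then show "continuous_on UNIV (\<lambda>t. - (a' t / (a (circ t))\<^sup>2))"
    using a(1) nz by (intro continuous_intros) auto
  fix t
  have "(inverse has_field_derivative - (inverse (a (circ t)) ^ Suc (Suc 0))) (at (a (circ t)))"
    by (rule DERIV_inverse[OF nz])
  from field_vector_diff_chain_at[OF a(2) this]
  show "((\<lambda>t. 1 / a (circ t)) has_vector_derivative - (a' t / (a (circ t))\<^sup>2)) (at t)"
    by (simp add: o_def field_simps power2_eq_square)
  show "cmod (1 / a (circ t)) \<le> K" by (rule K)
  show "cmod (- (a' t / (a (circ t))\<^sup>2)) \<le> K" using K(2)[of t] by simp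
qed

lemma C1_bound_inverse_of_lower_bound:
  assumes "C1_bound a M" "0 < e" "\<And>s. e \<le> cmod (a s)"
  shows "C1_bound (\<lambda>s. 1 / a s) (1 / e + M / e\<^sup>2)"
proof -
  obtain a' where a: "continuous_on UNIV a'" "\<And>t. ((\<lambda>t. a (circ t)) has_vector_derivative a' t) (at t)" "\<And>t. cmod (a' t) \<le> M"
    using assms(1) unfolding C1_bound_def by blast
  have M: "0 \<le> M" using C1_bound_nonneg[OF assms(1)] .
  show ?thesis
  proof (rule C1_bound_inverse[OF a(1,2)])
    show "a s \<noteq> 0" for s using assms(2) assms(3)[of s] by auto
    show "cmod (1 / a s) \<le> 1 / e + M / e\<^sup>2" for s
    proof -
      have "cmod (1 / a s) \<le> 1 / e" using assms(2) assms(3)[of s] by (simp add: norm_divide frac_le)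
      then show ?thesis using M by (simp add: add_increasing2)
    qed
    show "cmod (a' t / (a (circ t))\<^sup>2) \<le> 1 / e + M / e\<^sup>2" for t
    proof -
      have "e\<^sup>2 \<le> (cmod (a (circ t)))\<^sup>2" using assms(2,3) by (intro power_mono) auto
      then have "cmod (a' t / (a (circ t))\<^sup>2) \<le> M / e\<^sup>2"
        unfolding norm_divide norm_power using assms(2) a(3)[of t] M by (intro frac_le) auto
      then show ?thesis using assms(2) by (simp add: add_increasing)
    qed
  qed
qed

lemma C1_loop_lower_bound:
  assumes "C1_loop a" "\<And>s. a s \<noteq> 0"
  shows "\<exists>e>0. \<forall>s. e \<le> cmod (a s)"
proof -
  have "continuous_on {0..2*pi} (\<lambda>t. cmod (a (circ t)))"
  proof (intro continuous_on_norm continuous_at_imp_continuous_on ballI)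
    fix t
    show "isCont (\<lambda>t. a (circ t)) t"
      using assms(1) unfolding C1_loop_def C1_bound_def by (blast intro: has_vector_derivative_continuous)
  qed
  then obtain t0 where "t0 \<in> {0..2*pi}" "\<And>t. t \<in> {0..2*pi} \<Longrightarrow> cmod (a (circ t0)) \<le> cmod (a (circ t))"
    using continuous_attains_inf[of "{0..2*pi}" "\<lambda>t. cmod (a (circ t))"] by (metis atLeastatMost_empty_iff compact_Icc mult_nonneg_nonneg pi_ge_zero zero_le_numeral)
  then show ?thesis using assms(2) circ_surj
    by (intro exI[of _ "cmod (a (circ t0))"]) (metis zero_less_norm_iff)
qed

lemma C1_loop_const: "C1_loop (\<lambda>_. c)" using C1_bound_const by (rule C1_loopI)
lemma C1_loop_add: "C1_loop a \<Longrightarrow> C1_loop b \<Longrightarrow> C1_loop (\<lambda>s. a s + b s)"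
  unfolding C1_loop_def using C1_bound_add by blast
lemma C1_loop_cmult: "C1_loop a \<Longrightarrow> C1_loop (\<lambda>s. c * a s)"
  unfolding C1_loop_def using C1_bound_cmult by blast

lemmas C1_loop_intros = C1_loop_const C1_loop_add C1_loop_cmult

lemma C1_inverse_locally_bounded:
  assumes a: "C1_loop a" and b: "C1_loop b" and nz: "\<And>s. a s + t0 * b s \<noteq> 0"
  shows "\<exists>e>0. \<exists>K>0. \<forall>t\<in>ball t0 e. (\<forall>s. a s + t * b s \<noteq> 0) \<and> C1_bound (\<lambda>s. 1 / (a s + t * b s)) K"
proof -
  obtain M where M: "C1_bound (\<lambda>s. a s + t0 * b s) M" using C1_loop_add[OF a C1_loop_cmult[OF b]] by (auto simp: C1_loop_def)
  obtain N where N: "C1_bound b N" using b by (auto simp: C1_loop_def)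
  obtain m where m: "0 < m" "\<And>s. m \<le> cmod (a s + t0 * b s)"
    using C1_loop_lower_bound[OF C1_loopI[OF M]] nz by blast
  have N0: "0 \<le> N" and M0: "0 \<le> M" using C1_bound_nonneg N M by auto
  \<comment> \<open>Chosen so that (t - t0) b has size at most m / 2, half of the lower bound at
    \<open>t0\<close>; N + 1 is positive even for b = 0.\<close>
  define e where "e = m / (2 * (N + 1))"
  have e: "0 < e" using m N0 by (simp add: e_def)
  have eN: "e * N \<le> m / 2" using m N0 by (simp add: e_def field_simps)
  define K where "K = 1 / (m / 2) + (M + e * N) / (m / 2)\<^sup>2"
  have "0 < K" unfolding K_def using m M0 N0 e by (intro add_pos_nonneg) auto
  moreover have "(\<forall>s. a s + t * b s \<noteq> 0) \<and> C1_bound (\<lambda>s. 1 / (a s + t * b s)) K" if t: "t \<in> ball t0 e" for t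
  proof -
    have te: "cmod (t - t0) \<le> e" using t by (simp add: dist_norm norm_minus_commute)
    have eq: "(\<lambda>s. a s + t * b s) = (\<lambda>s. (a s + t0 * b s) + (t - t0) * b s)" by (simp add: algebra_simps)
    have "C1_bound (\<lambda>s. a s + t * b s) (M + cmod (t - t0) * N)"
      unfolding eq by (intro C1_bound_add C1_bound_cmult M N)
    then have bd: "C1_bound (\<lambda>s. a s + t * b s) (M + e * N)"
      by (rule C1_bound_mono) (use te N0 in \<open>simp add: mult_right_mono\<close>)
    have lb: "m / 2 \<le> cmod (a s + t * b s)" for s
    proof -
      have "cmod ((t - t0) * b s) \<le> e * N"
        unfolding norm_mult using te C1_bound_cmod[OF N] e by (intro mult_mono) auto
      then have "cmod ((t - t0) * b s) \<le> m / 2" using eN by linarith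
      moreover have "cmod (a s + t0 * b s) - cmod ((t - t0) * b s) \<le> cmod (a s + t0 * b s + (t - t0) * b s)"
        by (rule norm_diff_ineq)
      ultimately have "m / 2 \<le> cmod (a s + t0 * b s + (t - t0) * b s)" using m(2)[of s] by linarith
      then show ?thesis by (simp only: fun_cong[OF eq, of s])
    qed
    have "C1_bound (\<lambda>s. 1 / (a s + t * b s)) K"
      unfolding K_def using m(1) lb by (intro C1_bound_inverse_of_lower_bound bd) auto
    moreover have "a s + t * b s \<noteq> 0" for s using lb[of s] m(1) by auto
    ultimately show ?thesis by blast
  qed
  ultimately show ?thesis using e by blast
qed

section \<open>Maps from loops to projective space\<close>

text \<open>Homogeneous coordinates \<open>v\<close> that become continuous, and differentiable along complex lines,
  at \<open>a\<close> after multiplication with a nowhere vanishing scalar function.\<close>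

definition projectively_regular :: "((circle \<Rightarrow> complex) \<Rightarrow> 'j \<Rightarrow> complex) \<Rightarrow> (circle \<Rightarrow> complex) \<Rightarrow> bool" where
  "projectively_regular v a \<longleftrightarrow> (\<exists>\<kappa>.
     (\<exists>e>0. \<forall>b. C1_bound (\<lambda>s. b s - a s) e \<longrightarrow> \<kappa> b \<noteq> 0) \<and>
     (\<forall>\<epsilon>>0. \<exists>e>0. \<forall>b. C1_bound (\<lambda>s. b s - a s) e \<longrightarrow> (\<forall>j. cmod (\<kappa> b * v b j - \<kappa> a * v a j) < \<epsilon>)) \<and>
     (\<forall>j b. C1_loop b \<longrightarrow>
        (\<lambda>t. \<kappa> (\<lambda>s. a s + t * b s) * v (\<lambda>s. a s + t * b s) j) field_differentiable at 0))"

lemma projectively_regularE: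
  assumes "projectively_regular v a"
  obtains \<kappa> where "\<exists>e>0. \<forall>b. C1_bound (\<lambda>s. b s - a s) e \<longrightarrow> \<kappa> b \<noteq> 0" "\<kappa> a \<noteq> 0"
    "\<forall>\<epsilon>>0. \<exists>e>0. \<forall>b. C1_bound (\<lambda>s. b s - a s) e \<longrightarrow> (\<forall>j. cmod (\<kappa> b * v b j - \<kappa> a * v a j) < \<epsilon>)"
    "\<forall>j b. C1_loop b \<longrightarrow>
        (\<lambda>t. \<kappa> (\<lambda>s. a s + t * b s) * v (\<lambda>s. a s + t * b s) j) field_differentiable at 0"
proof -
  from assms obtain \<kappa> where
    "(\<exists>e>0. \<forall>b. C1_bound (\<lambda>s. b s - a s) e \<longrightarrow> \<kappa> b \<noteq> 0) \<and>
     (\<forall>\<epsilon>>0. \<exists>e>0. \<forall>b. C1_bound (\<lambda>s. b s - a s) e \<longrightarrow> (\<forall>j. cmod (\<kappa> b * v b j - \<kappa> a * v a j) < \<epsilon>)) \<and>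
     (\<forall>j b. C1_loop b \<longrightarrow>
        (\<lambda>t. \<kappa> (\<lambda>s. a s + t * b s) * v (\<lambda>s. a s + t * b s) j) field_differentiable at 0)"
    unfolding projectively_regular_def by (rule exE)
  note k = this[THEN conjunct1] this[THEN conjunct2, THEN conjunct1] this[THEN conjunct2, THEN conjunct2]
  from k(1) obtain e where e: "0 < e" "\<forall>b. C1_bound (\<lambda>s. b s - a s) e \<longrightarrow> \<kappa> b \<noteq> 0" by blast
  have "C1_bound (\<lambda>s. a s - a s) e" using C1_bound_mono[OF C1_bound_const[of 0]] e(1) by simp
  then have "\<kappa> a \<noteq> 0" using e(2) by blast
  then show ?thesis using k(2,3) by (rule that[OF k(1)])
qed

text \<open>The scalar factor cancels in the ratio. Half of the nonzero value at \<open>a\<close> is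
  the tolerance that keeps the denominator away from 0, and one radius serves all
  \<open>j\<close>.\<close>

lemma projectively_regular_ratio_bounded:
  assumes reg: "projectively_regular v a" and k: "v a k \<noteq> 0"
  shows "\<exists>e>0. \<exists>C. \<forall>b. C1_bound (\<lambda>s. b s - a s) e \<longrightarrow> v b k \<noteq> 0 \<and> (\<forall>j. cmod (v b j / v b k) \<le> C j)"
proof -
  obtain \<kappa> where nz: "\<exists>e>0. \<forall>b. C1_bound (\<lambda>s. b s - a s) e \<longrightarrow> \<kappa> b \<noteq> 0" and ka: "\<kappa> a \<noteq> 0"
    and c: "\<forall>\<epsilon>>0. \<exists>e>0. \<forall>b. C1_bound (\<lambda>s. b s - a s) e \<longrightarrow> (\<forall>j. cmod (\<kappa> b * v b j - \<kappa> a * v a j) < \<epsilon>)"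
    by (rule projectively_regularE[OF reg])
  define m where "m = cmod (\<kappa> a * v a k) / 2"
  have m: "0 < m" using ka k by (simp add: m_def)
  obtain e1 where e1: "0 < e1" "\<forall>b. C1_bound (\<lambda>s. b s - a s) e1 \<longrightarrow> \<kappa> b \<noteq> 0" using nz by blast
  obtain e2 where e2: "0 < e2" "\<forall>b. C1_bound (\<lambda>s. b s - a s) e2 \<longrightarrow> (\<forall>j. cmod (\<kappa> b * v b j - \<kappa> a * v a j) < m)"
    using c m by blast
  define e where "e = min e1 e2"
  define C where "C = (\<lambda>j. (m + cmod (\<kappa> a * v a j)) / m)"
  have "v b k \<noteq> 0 \<and> (\<forall>j. cmod (v b j / v b k) \<le> C j)" if b: "C1_bound (\<lambda>s. b s - a s) e" for b
  proof -
    have kb: "\<kappa> b \<noteq> 0" using e1(2) C1_bound_mono[OF b, of e1] by (simp add: e_def)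
    have near: "cmod (\<kappa> b * v b j - \<kappa> a * v a j) < m" for j
      using e2(2) C1_bound_mono[OF b, of e2] by (simp add: e_def)
    have lower: "m \<le> cmod (\<kappa> b * v b k)"
      using near[of k] norm_triangle_ineq2[of "\<kappa> a * v a k" "\<kappa> b * v b k"]
      unfolding norm_minus_commute[of "\<kappa> a * v a k"] m_def by linarith
    moreover have "cmod (v b j / v b k) \<le> C j" for j
    proof -
      have "v b j / v b k = (\<kappa> b * v b j) / (\<kappa> b * v b k)" using kb by simp
      moreover have "cmod (\<kappa> b * v b j) \<le> m + cmod (\<kappa> a * v a j)"
        using near[of j] norm_triangle_ineq2[of "\<kappa> b * v b j" "\<kappa> a * v a j"] by linarith
      ultimately show ?thesis
        unfolding C_def using lower m by (simp only: norm_divide) (intro frac_le, auto)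
    qed
    ultimately show ?thesis using m by auto
  qed
  then show ?thesis using e1(1) e2(1) by (intro exI[of _ e] exI[of _ C]) (auto simp: e_def)
qed

text \<open>The scalar factor cancels only where it is nonzero, hence the passage to a small disc
  around 0.\<close>

lemma projectively_regular_ratio_differentiable:
  assumes reg: "projectively_regular v a" and k: "v a k \<noteq> 0" and b: "C1_loop b"
  shows "(\<lambda>t. v (\<lambda>s. a s + t * b s) j / v (\<lambda>s. a s + t * b s) k) field_differentiable at 0"
proof -
  obtain \<kappa> where nz: "\<exists>e>0. \<forall>b. C1_bound (\<lambda>s. b s - a s) e \<longrightarrow> \<kappa> b \<noteq> 0" and ka: "\<kappa> a \<noteq> 0"
    and dif: "\<forall>j b. C1_loop b \<longrightarrow>
        (\<lambda>t. \<kappa> (\<lambda>s. a s + t * b s) * v (\<lambda>s. a s + t * b s) j) field_differentiable at 0"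
    by (rule projectively_regularE[OF reg])
  let ?f = "\<lambda>j t. \<kappa> (\<lambda>s. a s + t * b s) * v (\<lambda>s. a s + t * b s) j"
  obtain e where e: "0 < e" "\<forall>b. C1_bound (\<lambda>s. b s - a s) e \<longrightarrow> \<kappa> b \<noteq> 0" using nz by blast
  obtain M where M: "C1_bound b M" using b by (auto simp: C1_loop_def)
  have M0: "0 \<le> M" using C1_bound_nonneg[OF M] .
  have "(\<lambda>t. ?f j t / ?f k t) field_differentiable at 0"
    using dif b ka k by (intro field_differentiable_divide) auto
  then obtain D where D: "((\<lambda>t. ?f j t / ?f k t) has_field_derivative D) (at 0)"
    by (auto simp: field_differentiable_def)
  have "((\<lambda>t. v (\<lambda>s. a s + t * b s) j / v (\<lambda>s. a s + t * b s) k) has_field_derivative D) (at 0)"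
  proof (rule has_field_derivative_transform_within[OF D])
    show "0 < e / (M + 1)" using e M0 by simp
    fix t :: complex assume "dist t 0 < e / (M + 1)"
    then have "cmod t * (M + 1) < e" using M0 by (simp add: pos_less_divide_eq)
    moreover have "cmod t * M \<le> cmod t * (M + 1)" by (intro mult_left_mono) auto
    ultimately have "C1_bound (\<lambda>s. t * b s) e" by (intro C1_bound_mono[OF C1_bound_cmult[OF M]]) linarith
    then have "\<kappa> (\<lambda>s. a s + t * b s) \<noteq> 0" using e(2) by (auto dest!: spec[of _ "\<lambda>s. a s + t * b s"])
    then show "?f j t / ?f k t = v (\<lambda>s. a s + t * b s) j / v (\<lambda>s. a s + t * b s) k" by simp
  qed simp
  then show ?thesis by (auto simp: field_differentiable_def)
qed

lemma projectively_regular_ratio_differentiable_at: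
  assumes reg: "projectively_regular v (\<lambda>s. a s + t0 * b s)" and k: "v (\<lambda>s. a s + t0 * b s) k \<noteq> 0" and b: "C1_loop b"
  shows "(\<lambda>t. v (\<lambda>s. a s + t * b s) j / v (\<lambda>s. a s + t * b s) k) field_differentiable at t0"
proof -
  have "(\<lambda>t. v (\<lambda>s. (a s + t0 * b s) + t * b s) j / v (\<lambda>s. (a s + t0 * b s) + t * b s) k) field_differentiable at 0"
    by (rule projectively_regular_ratio_differentiable[OF reg k b])
  then obtain D where "((\<lambda>t. v (\<lambda>s. (a s + t0 * b s) + t * b s) j / v (\<lambda>s. (a s + t0 * b s) + t * b s) k)
      has_field_derivative D) (at (t0 - t0))" by (auto simp: field_differentiable_def)
  moreover have "((\<lambda>t. t - t0) has_field_derivative 1) (at t0)" by (auto intro!: derivative_eq_intros)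
  ultimately have "((\<lambda>t. v (\<lambda>s. (a s + t0 * b s) + (t - t0) * b s) j / v (\<lambda>s. (a s + t0 * b s) + (t - t0) * b s) k)
      has_field_derivative D * 1) (at t0)" by (rule DERIV_chain2)
  then show ?thesis by (auto simp: field_differentiable_def algebra_simps)
qed

text \<open>Here \<open>v\<close> describes the map on the chart of finite loops and \<open>w\<close> the one on the chart of
  loops avoiding \<open>0\<close>, centred at the constant loop \<open>\<infinity>\<close>.\<close>

locale projective_loop_map =
  fixes v w :: "(circle \<Rightarrow> complex) \<Rightarrow> 'j \<Rightarrow> complex" and d :: 'j
  assumes v_regular: "C1_loop a \<Longrightarrow> projectively_regular v a"
    and w_regular: "projectively_regular w (\<lambda>_. 0)"
    and v_nonzero: "C1_loop a \<Longrightarrow> \<exists>k. v a k \<noteq> 0"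
    and change_chart: "C1_loop a \<Longrightarrow> (\<And>s. a s \<noteq> 0) \<Longrightarrow> \<exists>c. c \<noteq> 0 \<and> (\<forall>j. w (\<lambda>s. 1 / a s) j = c * v a j)"
    and v0: "v (\<lambda>_. 0) d \<noteq> 0" and w0: "w (\<lambda>_. 0) d \<noteq> 0"
begin

lemma v_near_zero: "\<exists>e>0. \<exists>C. \<forall>b. C1_bound b e \<longrightarrow> v b d \<noteq> 0 \<and> (\<forall>j. cmod (v b j / v b d) \<le> C j)"
  using projectively_regular_ratio_bounded[OF v_regular[OF C1_loop_const] v0] by simp

lemma w_near_zero: "\<exists>e>0. \<exists>C. \<forall>b. C1_bound b e \<longrightarrow> w b d \<noteq> 0 \<and> (\<forall>j. cmod (w b j / w b d) \<le> C j)"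
  using projectively_regular_ratio_bounded[OF w_regular w0] by simp

text \<open>In the chart at infinity the loop x a is (1/x)(1/a), of C^1 norm at most K / |x|. The
  threshold depends on \<open>a\<close> only through \<open>K\<close>, and the growth argument along
  bumps rests on this uniformity.\<close>

lemma v_near_infinity:
  "\<exists>e>0. \<exists>C. \<forall>a K x. C1_loop a \<longrightarrow> (\<forall>s. a s \<noteq> 0) \<longrightarrow> C1_bound (\<lambda>s. 1 / a s) K \<longrightarrow> 0 < K \<longrightarrow> K / e < cmod x \<longrightarrow>
     v (\<lambda>s. x * a s) d \<noteq> 0 \<and> (\<forall>j. cmod (v (\<lambda>s. x * a s) j / v (\<lambda>s. x * a s) d) \<le> C j)"
proof -
  obtain e C where e: "0 < e" and C: "\<forall>b. C1_bound b e \<longrightarrow> w b d \<noteq> 0 \<and> (\<forall>j. cmod (w b j / w b d) \<le> C j)"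
    using w_near_zero by blast
  have "v (\<lambda>s. x * a s) d \<noteq> 0 \<and> (\<forall>j. cmod (v (\<lambda>s. x * a s) j / v (\<lambda>s. x * a s) d) \<le> C j)"
    if a: "C1_loop a" "\<forall>s. a s \<noteq> 0" "C1_bound (\<lambda>s. 1 / a s) K" "0 < K" "K / e < cmod x" for a K and x :: complex
  proof -
    have "0 \<le> K / e" using a(4) e by simp
    then have x: "x \<noteq> 0" using a(5) by auto
    obtain c where c: "c \<noteq> 0" "\<forall>j. w (\<lambda>s. 1 / (x * a s)) j = c * v (\<lambda>s. x * a s) j"
      using change_chart[OF C1_loop_cmult[OF a(1), of x]] a(2) x by auto
    have eq: "(\<lambda>s. 1 / (x * a s)) = (\<lambda>s. (1 / x) * (1 / a s))" by simp
    have "C1_bound (\<lambda>s. 1 / (x * a s)) (cmod (1 / x) * K)" unfolding eq by (rule C1_bound_cmult[OF a(3)])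
    moreover have "cmod (1 / x) * K \<le> e" using a(5) x e by (simp add: norm_divide field_simps)
    ultimately have "C1_bound (\<lambda>s. 1 / (x * a s)) e" by (rule C1_bound_mono)
    then have "c * v (\<lambda>s. x * a s) d \<noteq> 0 \<and> (\<forall>j. cmod ((c * v (\<lambda>s. x * a s) j) / (c * v (\<lambda>s. x * a s) d)) \<le> C j)"
      unfolding c(2)[rule_format, symmetric] using C by blast
    then show ?thesis using c(1) by simp
  qed
  then show ?thesis using e by blast
qed

lemma stable_plane:
  assumes a: "C1_loop a" and b: "C1_loop b" and nz: "v (\<lambda>s. x0 * (a s + t0 * b s)) k \<noteq> 0"
  shows "\<exists>e>0. \<forall>t\<in>ball t0 e. \<forall>x\<in>ball x0 e. v (\<lambda>s. x * (a s + t * b s)) k \<noteq> 0"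
proof -
  obtain M N where M: "C1_bound a M" and N: "C1_bound b N" using a b by (auto simp: C1_loop_def)
  have M0: "0 \<le> M" "0 \<le> N" using C1_bound_nonneg M N by auto
  obtain r where r: "0 < r" "\<And>c. C1_bound (\<lambda>s. c s - x0 * (a s + t0 * b s)) r \<Longrightarrow> v c k \<noteq> 0"
    using projectively_regular_ratio_bounded[OF v_regular nz] C1_loop_cmult[OF C1_loop_add[OF a C1_loop_cmult[OF b]]] by blast
  define B where "B = M + (cmod t0 + 1) * N + cmod x0 * N + 1"
  have B: "0 < B" using M0 by (auto simp: B_def intro!: add_nonneg_pos add_nonneg_nonneg)
  define e where "e = min 1 (r / B)"
  have "v (\<lambda>s. x * (a s + t * b s)) k \<noteq> 0" if t: "t \<in> ball t0 e" and x: "x \<in> ball x0 e" for t x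
  proof (rule r(2))
    have te: "cmod (t - t0) \<le> e" and xe: "cmod (x - x0) \<le> e"
      using t x by (auto simp: dist_norm norm_minus_commute)
    have e1: "e \<le> 1" "0 \<le> e" "e * B \<le> r" using B r by (auto simp: e_def min_def field_simps)
    have t1: "cmod t \<le> cmod t0 + 1" using te e1 norm_triangle_ineq2[of t t0] by linarith
    \<comment> \<open>The displacement is split into the change of \<open>x\<close> and the change
      of \<open>t\<close>; \<open>B\<close> collects the bounds for both.\<close>
    have "C1_bound (\<lambda>s. (x - x0) * (a s + t * b s) + (x0 * (t - t0)) * b s)
        (cmod (x - x0) * (M + cmod t * N) + cmod (x0 * (t - t0)) * N)"
      by (intro C1_bound_add C1_bound_cmult M N)
    moreover have "(\<lambda>s. (x - x0) * (a s + t * b s) + (x0 * (t - t0)) * b s) =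
        (\<lambda>s. x * (a s + t * b s) - x0 * (a s + t0 * b s))" by (simp add: algebra_simps)
    moreover have "cmod (x - x0) * (M + cmod t * N) + cmod (x0 * (t - t0)) * N \<le> r"
    proof -
      have "cmod (x - x0) * (M + cmod t * N) \<le> e * (M + (cmod t0 + 1) * N)"
        using xe t1 M0 e1 by (intro mult_mono add_mono mult_right_mono) auto
      moreover have "cmod (x0 * (t - t0)) * N \<le> e * (cmod x0 * N)"
        using mult_right_mono[OF te, of "cmod x0 * N"] M0 by (simp add: norm_mult mult_ac)
      ultimately have "cmod (x - x0) * (M + cmod t * N) + cmod (x0 * (t - t0)) * N \<le> e * B"
        using e1 unfolding B_def by (simp only: distrib_left mult_1_right)
      then show ?thesis using e1 by linarith
    qed
    ultimately show "C1_bound (\<lambda>s. x * (a s + t * b s) - x0 * (a s + t0 * b s)) r"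
      using C1_bound_mono by (metis (no_types, lifting))
  qed
  then show ?thesis using B r by (intro exI[of _ e]) (auto simp: e_def)
qed

lemma holomorphic_line:
  assumes "C1_loop a" "C1_loop b" "open S" "\<And>t. t \<in> S \<Longrightarrow> v (\<lambda>s. a s + t * b s) k \<noteq> 0"
  shows "(\<lambda>t. v (\<lambda>s. a s + t * b s) j / v (\<lambda>s. a s + t * b s) k) holomorphic_on S"
  unfolding holomorphic_on_def
proof
  fix t assume "t \<in> S"
  then have "(\<lambda>t. v (\<lambda>s. a s + t * b s) j / v (\<lambda>s. a s + t * b s) k) field_differentiable at t"
    by (intro projectively_regular_ratio_differentiable_at v_regular C1_loop_intros assms)
  then show "(\<lambda>t. v (\<lambda>s. a s + t * b s) j / v (\<lambda>s. a s + t * b s) k) field_differentiable at t within S"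
    by (rule field_differentiable_at_within)
qed

lemma holomorphic_ray:
  assumes "C1_loop c" "open S" "\<And>x. x \<in> S \<Longrightarrow> v (\<lambda>s. x * c s) k \<noteq> 0"
  shows "(\<lambda>x. v (\<lambda>s. x * c s) j / v (\<lambda>s. x * c s) k) holomorphic_on S"
  using holomorphic_line[OF C1_loop_const[of 0] assms(1,2), of k j] assms(3) by simp

text \<open>Large multiples of \<open>c\<close> lie near the constant loop infinity, where the
  coordinate \<open>d\<close> does not vanish and the ratios are bounded. This is the input at
  infinity for \<open>rational_lift_exists\<close>.\<close>

lemma ray_lift_exists:
  assumes c: "C1_loop c" "\<And>s. c s \<noteq> 0"
  shows "\<exists>P. rational_lift d (\<lambda>x. v (\<lambda>s. x * c s)) P"
proof -
  \<comment> \<open>The estimate for families, used with direction 0, bounds the single loop 1 /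
    c.\<close>
  obtain e K where K: "0 < e" "0 < K"
    "\<forall>t\<in>ball 0 e. (\<forall>s. c s + t * 0 \<noteq> 0) \<and> C1_bound (\<lambda>s. 1 / (c s + t * 0)) K"
    using C1_inverse_locally_bounded[OF c(1) C1_loop_const[of 0], of 0] c(2) by auto
  then have K: "0 < K" "C1_bound (\<lambda>s. 1 / c s) K" using bspec[OF K(3), of 0] by simp_all
  obtain e' C where e': "0 < e'" and C: "\<forall>a K x. C1_loop a \<longrightarrow> (\<forall>s. a s \<noteq> 0) \<longrightarrow> C1_bound (\<lambda>s. 1 / a s) K \<longrightarrow> 0 < K \<longrightarrow> K / e' < cmod x \<longrightarrow>
     v (\<lambda>s. x * a s) d \<noteq> 0 \<and> (\<forall>j. cmod (v (\<lambda>s. x * a s) j / v (\<lambda>s. x * a s) d) \<le> C j)"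
    using v_near_infinity by blast
  show ?thesis
  proof (rule rational_lift_exists)
    show "v (\<lambda>s. 0 * c s) d \<noteq> 0" using v0 by simp
    show "v (\<lambda>s. x * c s) d \<noteq> 0" if "K / e' < cmod x" for x using C c K that by blast
    show "cmod (v (\<lambda>s. x * c s) j / v (\<lambda>s. x * c s) d) \<le> C j" if "K / e' < cmod x" for x j using C c K that by blast
    show "holomorphic_curve (\<lambda>x. v (\<lambda>s. x * c s))"
      unfolding holomorphic_curve_def
    proof
      fix z
      obtain k where k: "v (\<lambda>s. z * c s) k \<noteq> 0" using v_nonzero[OF C1_loop_cmult[OF c(1)]] by blast
      obtain e where e: "0 < e" "\<forall>t\<in>ball 0 e. \<forall>x\<in>ball z e. v (\<lambda>s. x * (c s + t * 0)) k \<noteq> 0"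
        using stable_plane[OF c(1) C1_loop_const[of 0], of z 0 k] k by auto
      then have "0 < e" "\<forall>x\<in>ball z e. v (\<lambda>s. x * c s) k \<noteq> 0" using bspec[OF e(2), of 0] by simp_all
      then show "\<exists>k e. 0 < e \<and> (\<forall>x\<in>ball z e. v (\<lambda>s. x * c s) k \<noteq> 0) \<and>
          (\<forall>j. (\<lambda>x. v (\<lambda>s. x * c s) j / v (\<lambda>s. x * c s) k) holomorphic_on ball z e)"
        using holomorphic_ray[OF c(1) open_ball, of z e k] by (intro exI[of _ k] exI[of _ e]) blast
    qed
  qed
qed

definition ray_lift :: "(circle \<Rightarrow> complex) \<Rightarrow> 'j \<Rightarrow> complex poly" where
  "ray_lift c = (SOME P. rational_lift d (\<lambda>x. v (\<lambda>s. x * c s)) P)"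

lemma ray_lift: "C1_loop c \<Longrightarrow> (\<And>s. c s \<noteq> 0) \<Longrightarrow> rational_lift d (\<lambda>x. v (\<lambda>s. x * c s)) (ray_lift c)"
  unfolding ray_lift_def by (rule someI_ex[OF ray_lift_exists])

theorem ray_lift_polynomial_on_line:
  assumes a: "C1_loop a" and b: "C1_loop b" and dense: "closure {t. \<forall>s. a s + t * b s \<noteq> 0} = UNIV"
  obtains D q where
    "\<And>t. (\<forall>s. a s + t * b s \<noteq> 0) \<Longrightarrow> degree (ray_lift (\<lambda>s. a s + t * b s) d) = D"
    "\<And>t j. (\<forall>s. a s + t * b s \<noteq> 0) \<Longrightarrow> ray_lift (\<lambda>s. a s + t * b s) j = eval_coeffs D (q j) t"
    "\<And>i. i \<le> D \<Longrightarrow> degree (q d i) \<le> i"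
proof -
  obtain M N where M: "C1_bound a M" and N: "C1_bound b N" using a b by (auto simp: C1_loop_def)
  obtain e0 C where e0: "0 < e0" and C: "\<forall>b. C1_bound b e0 \<longrightarrow> v b d \<noteq> 0 \<and> (\<forall>j. cmod (v b j / v b d) \<le> C j)"
    using v_near_zero by blast
  \<comment> \<open>With this \<open>B\<close> the loop x (a + t b) has C^1 norm at most
    \<open>e0\<close> whenever |x| (1 + |t|) < e0 / B, for every \<open>t\<close>.\<close>
  define B where "B = max M N + 1"
  have B: "0 < B" "M \<le> B" "N \<le> B" using C1_bound_nonneg[OF M] by (auto simp: B_def)
  have near: "C1_bound (\<lambda>s. x * (a s + t * b s)) e0" if "cmod x * (1 + cmod t) < e0 / B" for x t :: complex
  proof -
    have "cmod x * (M + cmod t * N) \<le> cmod x * (B + cmod t * B)"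
      using B by (intro mult_left_mono add_mono) auto
    also have "\<dots> = cmod x * (1 + cmod t) * B" by (simp add: algebra_simps)
    also have "\<dots> \<le> e0" using that B by (simp add: pos_less_divide_eq)
    finally show ?thesis by (rule C1_bound_mono[OF C1_bound_cmult[OF C1_bound_add[OF M C1_bound_cmult[OF N]]]])
  qed
  let ?T = "{t. \<forall>s. a s + t * b s \<noteq> 0}"
  have ab: "C1_loop (\<lambda>s. a s + t * b s)" for t by (intro C1_loop_intros a b)
  interpret rational_curve_family "\<lambda>t x. v (\<lambda>s. x * (a s + t * b s))" d ?T "e0 / B" C
  proof
    show "open ?T"
    proof (rule openI)
      fix t assume "t \<in> ?T"
      then show "\<exists>e>0. ball t e \<subseteq> ?T" using C1_inverse_locally_bounded[OF a b, of t] by blast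
    qed
    show "closure ?T = UNIV" by fact
    show "\<exists>P. rational_lift d (\<lambda>x. v (\<lambda>s. x * (a s + t * b s))) P" if "t \<in> ?T" for t
      using that by (intro ray_lift_exists ab) auto
    show "0 < e0 / B" using e0 B by simp
    show "v (\<lambda>s. x * (a s + t * b s)) d \<noteq> 0" if "cmod x * (1 + cmod t) < e0 / B" for x t :: complex
      using C near[OF that] by blast
    show "cmod (v (\<lambda>s. x * (a s + t * b s)) j / v (\<lambda>s. x * (a s + t * b s)) d) \<le> C j"
      if "cmod x * (1 + cmod t) < e0 / B" for x t :: complex and j using C near[OF that] by blast
    show "(\<lambda>x. v (\<lambda>s. x * (a s + t * b s)) j / v (\<lambda>s. x * (a s + t * b s)) d) holomorphic_on ball 0 (e0 / B / (1 + cmod t))" for t j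
    proof (rule holomorphic_ray[OF ab open_ball])
      fix x :: complex assume x: "x \<in> ball 0 (e0 / B / (1 + cmod t))"
      have "0 < 1 + cmod t" using norm_ge_zero[of t] by linarith
      moreover have "cmod x < (e0 / B) / (1 + cmod t)" using x by (simp only: mem_ball dist_0_norm)
      ultimately have "cmod x * (1 + cmod t) < e0 / B" by (simp only: pos_less_divide_eq)
      then show "v (\<lambda>s. x * (a s + t * b s)) d \<noteq> 0" using C near by blast
    qed
    show "(\<lambda>t. v (\<lambda>s. x * (a s + t * b s)) j / v (\<lambda>s. x * (a s + t * b s)) d) holomorphic_on {t. cmod x * (1 + cmod t) < e0 / B}" for x j
    proof -
      have op: "open {t. cmod x * (1 + cmod t) < e0 / B}" by (intro open_Collect_less continuous_intros)
      have eq: "(\<lambda>s. x * (a s + t * b s)) = (\<lambda>s. x * a s + t * (x * b s))" for t by (simp add: algebra_simps)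
      show ?thesis unfolding eq
        by (rule holomorphic_line[OF _ _ op]) (use C near in \<open>auto simp flip: eq intro: C1_loop_intros a b\<close>)
    qed
    show "\<exists>k. v (\<lambda>s. x * (a s + t * b s)) k \<noteq> 0" for t x by (intro v_nonzero C1_loop_intros a b)
    show "\<exists>e>0. \<forall>t\<in>ball t0 e. \<forall>x\<in>ball x0 e. v (\<lambda>s. x * (a s + t * b s)) k \<noteq> 0"
      if "v (\<lambda>s. x0 * (a s + t0 * b s)) k \<noteq> 0" for t0 x0 k by (rule stable_plane[OF a b that])
    show "\<exists>e>0. \<forall>t\<in>ball t0 e. t \<in> ?T \<and> (\<forall>x. 1 / e < cmod x \<longrightarrow> v (\<lambda>s. x * (a s + t * b s)) d \<noteq> 0)"
      if t0: "t0 \<in> ?T" for t0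
    proof -
      obtain e K where e: "0 < e" "0 < K" and K: "\<forall>t\<in>ball t0 e. (\<forall>s. a s + t * b s \<noteq> 0) \<and> C1_bound (\<lambda>s. 1 / (a s + t * b s)) K"
        using C1_inverse_locally_bounded[OF a b, of t0] t0 by blast
      obtain e' C' where e': "0 < e'" and C': "\<forall>a K x. C1_loop a \<longrightarrow> (\<forall>s. a s \<noteq> 0) \<longrightarrow> C1_bound (\<lambda>s. 1 / a s) K \<longrightarrow> 0 < K \<longrightarrow> K / e' < cmod x \<longrightarrow>
         v (\<lambda>s. x * a s) d \<noteq> 0 \<and> (\<forall>j. cmod (v (\<lambda>s. x * a s) j / v (\<lambda>s. x * a s) d) \<le> C' j)"
        using v_near_infinity by blast
      have "t \<in> ?T \<and> (\<forall>x. 1 / min e (e' / K) < cmod x \<longrightarrow> v (\<lambda>s. x * (a s + t * b s)) d \<noteq> 0)"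
        if t: "t \<in> ball t0 (min e (e' / K))" for t
      proof (intro conjI allI impI)
        have te: "t \<in> ball t0 e" using t by simp
        show "t \<in> ?T" using K te by blast
        fix x :: complex assume x: "1 / min e (e' / K) < cmod x"
        have "K / e' \<le> 1 / min e (e' / K)" using e e' by (auto simp: min_def field_simps)
        then have "K / e' < cmod x" using x by linarith
        moreover have "\<forall>s. a s + t * b s \<noteq> 0" "C1_bound (\<lambda>s. 1 / (a s + t * b s)) K" using K te by blast+
        ultimately show "v (\<lambda>s. x * (a s + t * b s)) d \<noteq> 0" using C' ab e(2) by blast
      qed
      then show ?thesis using e e' by (intro exI[of _ "min e (e' / K)"]) auto
    qed
  qed
  \<comment> \<open>Both sides choose from the same predicate, so the chosen lifts coincide.\<close>
  have eq: "lift_at t = ray_lift (\<lambda>s. a s + t * b s)" for t by (simp add: lift_at_def ray_lift_def)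
  show ?thesis
  proof (rule lift_coeffs_polynomial)
    fix D q
    assume 1: "\<And>t. t \<in> ?T \<Longrightarrow> degree (lift_at t d) = D"
      and 2: "\<And>t j. t \<in> ?T \<Longrightarrow> lift_at t j = eval_coeffs D (q j) t"
      and 3: "\<And>i. i \<le> D \<Longrightarrow> degree (q d i) \<le> i"
    show ?thesis
    proof (rule that[of D q])
      show "degree (ray_lift (\<lambda>s. a s + t * b s) d) = D" if "\<forall>s. a s + t * b s \<noteq> 0" for t
        unfolding eq[symmetric] by (rule 1) (use that in simp)
      show "ray_lift (\<lambda>s. a s + t * b s) j = eval_coeffs D (q j) t" if "\<forall>s. a s + t * b s \<noteq> 0" for t j
        unfolding eq[symmetric] by (rule 2) (use that in simp)
    qed (rule 3)
  qed
qed

end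

section \<open>Leading coefficients along bump functions\<close>

text \<open>The complement of the open negative real axis: exactly the s for which 1 + s z is
  nonzero for every real z \<ge> 0.\<close>

definition slit_plane :: "complex set" where
  "slit_plane = {s. Im s \<noteq> 0 \<or> 0 \<le> Re s}"

definition nonneg_loop :: "(circle \<Rightarrow> complex) \<Rightarrow> bool" where
  "nonneg_loop b \<longleftrightarrow> C1_loop b \<and> (\<forall>s. Im (b s) = 0 \<and> 0 \<le> Re (b s))"

lemma slit_plane_of_real: "0 \<le> x \<Longrightarrow> complex_of_real x \<in> slit_plane"
  and slit_plane_0: "0 \<in> slit_plane" and slit_plane_1: "1 \<in> slit_plane"
  by (auto simp: slit_plane_def)

lemma closure_slit_plane: "slit_plane \<subseteq> T \<Longrightarrow> closure T = UNIV"
proof -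
  assume sub: "slit_plane \<subseteq> T"
  have "z \<in> closure T" for z
    unfolding closure_approachable
  proof (intro allI impI)
    fix e :: real assume e: "0 < e"
    show "\<exists>y\<in>T. dist y z < e"
    proof (cases "Im z = 0")
      case True
      have "z + \<i> * of_real (e / 2) \<in> slit_plane" using True e by (simp add: slit_plane_def)
      then show ?thesis using sub e by (intro bexI[of _ "z + \<i> * of_real (e / 2)"]) (auto simp: dist_norm norm_mult)
    next
      case False
      then show ?thesis using sub e by (intro bexI[of _ z]) (auto simp: slit_plane_def)
    qed
  qed
  then show ?thesis by auto
qed

lemma slit_plane_mult_nonneg_nonzero:
  assumes "s \<in> slit_plane" "Im z = 0" "0 \<le> Re z"
  shows "1 + s * z \<noteq> 0"
proof
  assume "1 + s * z = 0"
  then have "1 + Re s * Re z = 0" "Im s * Re z = 0"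
    using assms(2) by (auto simp: complex_eq_iff)
  then have "Im s = 0" "Re s * Re z = -1" by auto
  then have "0 \<le> Re s" using assms(1) by (simp add: slit_plane_def)
  then have "0 \<le> Re s * Re z" using assms(3) by simp
  then show False using \<open>Re s * Re z = -1\<close> by simp
qed

lemma nonneg_loop_add: "nonneg_loop a \<Longrightarrow> nonneg_loop b \<Longrightarrow> nonneg_loop (\<lambda>s. a s + b s)"
  by (auto simp: nonneg_loop_def intro: C1_loop_add)

lemma nonneg_loop_sum:
  "finite I \<Longrightarrow> (\<And>i. i \<in> I \<Longrightarrow> nonneg_loop (b i)) \<Longrightarrow> nonneg_loop (\<lambda>s. \<Sum>i\<in>I. b i s)"
proof (induction I rule: finite_induct)
  case empty
  then show ?case by (simp add: nonneg_loop_def C1_loop_const)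
next
  case (insert i I)
  then show ?case by (auto intro!: nonneg_loop_add)
qed

context projective_loop_map
begin

definition leading :: "(circle \<Rightarrow> complex) \<Rightarrow> complex" where
  "leading c = coeff (ray_lift c d) (degree (ray_lift c d))"

lemma leading_nonzero: "C1_loop c \<Longrightarrow> (\<And>s. c s \<noteq> 0) \<Longrightarrow> leading c \<noteq> 0"
  using ray_lift[of c] unfolding leading_def rational_lift_def by (metis leading_coeff_0_iff poly_0 zero_neq_one)

text \<open>By \<open>leading_polynomial\<close> this is also the degree at every 1 + t b with
  nonnegative \<open>b\<close> and \<open>t\<close> in the slit plane.\<close>

definition lift_degree :: nat where
  "lift_degree = degree (ray_lift (\<lambda>_. 1) d)"

lemma leading_polynomial:
  assumes a: "C1_loop a" and b: "C1_loop b" and nz: "\<And>t s. t \<in> slit_plane \<Longrightarrow> a s + t * b s \<noteq> 0"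
  obtains u q where "degree u \<le> degree (ray_lift a d)"
    "\<And>t. t \<in> slit_plane \<Longrightarrow> poly u t = leading (\<lambda>s. a s + t * b s)"
    "\<And>t. t \<in> slit_plane \<Longrightarrow> degree (ray_lift (\<lambda>s. a s + t * b s) d) = degree (ray_lift a d)"
    "\<And>t j. t \<in> slit_plane \<Longrightarrow> ray_lift (\<lambda>s. a s + t * b s) j = eval_coeffs (degree (ray_lift a d)) (q j) t"
proof -
  have dense: "closure {t. \<forall>s. a s + t * b s \<noteq> 0} = UNIV" by (rule closure_slit_plane) (use nz in blast)
  show ?thesis
  proof (rule ray_lift_polynomial_on_line[OF a b dense])
    fix D q
    assume 1: "\<And>t. (\<forall>s. a s + t * b s \<noteq> 0) \<Longrightarrow> degree (ray_lift (\<lambda>s. a s + t * b s) d) = D"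
      and 2: "\<And>t j. (\<forall>s. a s + t * b s \<noteq> 0) \<Longrightarrow> ray_lift (\<lambda>s. a s + t * b s) j = eval_coeffs D (q j) t"
      and 3: "\<And>i. i \<le> D \<Longrightarrow> degree (q d i) \<le> i"
    have D: "D = degree (ray_lift a d)" using 1[of 0] nz[OF slit_plane_0] by simp
    show ?thesis
    proof (rule that[of "q d D" q])
      show "degree (q d D) \<le> degree (ray_lift a d)" using 3[of D] D by simp
      fix t assume t: "t \<in> slit_plane"
      have t': "\<forall>s. a s + t * b s \<noteq> 0" using nz[OF t] by blast
      show "degree (ray_lift (\<lambda>s. a s + t * b s) d) = degree (ray_lift a d)" using 1[OF t'] D by simp
      show "poly (q d D) t = leading (\<lambda>s. a s + t * b s)"
      proof -
        have "leading (\<lambda>s. a s + t * b s) = coeff (ray_lift (\<lambda>s. a s + t * b s) d) D"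
          unfolding leading_def by (simp only: 1[OF t'])
        then show ?thesis by (simp only: 2[OF t']) (simp add: coeff_eval_coeffs)
      qed
      show "ray_lift (\<lambda>s. a s + t * b s) j = eval_coeffs (degree (ray_lift a d)) (q j) t" for j
        using 2[OF t'] D by simp
    qed
  qed
qed

lemma one_plus_nonzero: "nonneg_loop b \<Longrightarrow> t \<in> slit_plane \<Longrightarrow> 1 + t * b s \<noteq> 0"
  by (rule slit_plane_mult_nonneg_nonzero) (auto simp: nonneg_loop_def)

lemma nonneg_loop_C1: "nonneg_loop b \<Longrightarrow> C1_loop b" by (simp add: nonneg_loop_def)

lemma leading_poly_exists:
  assumes "nonneg_loop b"
  shows "\<exists>u. degree u \<le> lift_degree \<and> (\<forall>t\<in>slit_plane. poly u t = leading (\<lambda>s. 1 + t * b s))"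
proof (rule leading_polynomial[OF C1_loop_const[of 1] nonneg_loop_C1[OF assms] one_plus_nonzero[OF assms]])
  fix u q
  assume "degree u \<le> degree (ray_lift (\<lambda>_. 1) d)"
    "\<And>t. t \<in> slit_plane \<Longrightarrow> poly u t = leading (\<lambda>s. 1 + t * b s)"
  then show ?thesis unfolding lift_degree_def by blast
qed

definition leading_poly :: "(circle \<Rightarrow> complex) \<Rightarrow> complex poly" where
  "leading_poly b = (SOME u. degree u \<le> lift_degree \<and> (\<forall>t\<in>slit_plane. poly u t = leading (\<lambda>s. 1 + t * b s)))"

lemma leading_poly:
  assumes "nonneg_loop b"
  shows "degree (leading_poly b) \<le> lift_degree"
    and "t \<in> slit_plane \<Longrightarrow> poly (leading_poly b) t = leading (\<lambda>s. 1 + t * b s)"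
  using someI_ex[OF leading_poly_exists[OF assms]] unfolding leading_poly_def[symmetric] by blast+

text \<open>For disjoint supports \<open>1 + s B + t b\<close> is invertible unless \<open>s\<close> or \<open>t\<close> lies on the negative real
  axis. So for fixed \<open>s\<close> the leading coefficient is a real-rooted polynomial in \<open>t\<close>, and its ratio
  to the value at \<open>t = 0\<close> is a real-valued holomorphic function of \<open>s\<close>, hence constant.\<close>

lemma leading_separates:
  assumes B: "nonneg_loop B" and b: "nonneg_loop b" and disj: "\<And>x. B x = 0 \<or> b x = 0" and t: "0 \<le> t"
  shows "leading (\<lambda>x. 1 + of_real t * (B x + b x)) * leading (\<lambda>x. 1) =
    leading (\<lambda>x. 1 + of_real t * B x) * leading (\<lambda>x. 1 + of_real t * b x)"
proof -
  let ?t = "complex_of_real t"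
  have ts: "?t \<in> slit_plane" by (rule slit_plane_of_real[OF t])
  have nz: "(1 + s * B x) + u * b x \<noteq> 0" if "s \<in> slit_plane" "u \<in> slit_plane" for s u x
    using disj[of x] one_plus_nonzero[OF B that(1), of x] one_plus_nonzero[OF b that(2), of x] by auto
  have c1: "C1_loop (\<lambda>x. 1 + s * B x)" "C1_loop (\<lambda>x. 1 + s * b x)" for s
    using nonneg_loop_C1[OF B] nonneg_loop_C1[OF b] by (auto intro!: C1_loop_intros)
  have swap: "(\<lambda>x. (1 + u * b x) + s * B x) = (\<lambda>x. (1 + s * B x) + u * b x)" for s u
    by (simp add: algebra_simps)
  have nz': "(1 + u * b x) + s * B x \<noteq> 0" if "s \<in> slit_plane" "u \<in> slit_plane" for s u x
    using nz[OF that, of x] by (simp only: add_ac not_False_eq_True)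
  obtain p where p: "\<forall>s\<in>slit_plane. poly p s = leading (\<lambda>x. (1 + s * B x) + ?t * b x)"
  proof (rule leading_polynomial[OF c1(2)[of ?t] nonneg_loop_C1[OF B] nz'[OF _ ts]])
    fix u q assume "\<And>s. s \<in> slit_plane \<Longrightarrow> poly u s = leading (\<lambda>x. (1 + ?t * b x) + s * B x)"
    then show thesis by (intro that[of u]) (simp only: swap ball_simps, blast)
  qed
  let ?q = "leading_poly B"
  \<comment> \<open>For fixed \<open>s\<close> the polynomial \<open>z\<close> in the other
    parameter has the value of \<open>p\<close> at \<open>?t\<close> and that of \<open>?q\<close>
    at 0. Nonreal points lie in the slit plane, so its roots are real.\<close>
  have real: "poly p s * cnj (poly ?q s) \<in> \<real>" if s: "s \<in> {s. 0 < Im s}" for s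
  proof -
    have ss: "s \<in> slit_plane" using s by (auto simp: slit_plane_def)
    obtain z where z: "\<forall>u\<in>slit_plane. poly z u = leading (\<lambda>x. (1 + s * B x) + u * b x)"
    proof (rule leading_polynomial[OF c1(1)[of s] nonneg_loop_C1[OF b] nz[OF ss]])
      fix u q assume "\<And>t. t \<in> slit_plane \<Longrightarrow> poly u t = leading (\<lambda>x. (1 + s * B x) + t * b x)"
      then show thesis by (intro that[of u]) blast
    qed
    have "y \<in> \<real>" if "poly z y = 0" for y
    proof (rule ccontr)
      assume "y \<notin> \<real>"
      then have y: "y \<in> slit_plane" by (auto simp: slit_plane_def complex_is_Real_iff)
      have "leading (\<lambda>x. (1 + s * B x) + y * b x) \<noteq> 0"
        by (intro leading_nonzero C1_loop_add c1 C1_loop_cmult nonneg_loop_C1 b nz ss y)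
      then show False using z y that by simp
    qed
    then have "poly z ?t * cnj (poly z 0) \<in> \<real>" by (rule real_rooted_poly_mult_cnj) auto
    moreover have "poly z ?t = poly p s" using z p ts ss by simp
    moreover have "poly z 0 = poly ?q s" using z slit_plane_0 leading_poly(2)[OF B ss] by simp
    ultimately show ?thesis by simp
  qed
  have "\<exists>c. p = smult c ?q"
  proof (rule proportional_of_real_ratio)
    show "open {s. 0 < Im s}" by (rule open_halfspace_Im_gt)
    have "\<i> \<in> {s. 0 < Im s}" by simp
    then show "{s. 0 < Im s} \<noteq> {}" by blast
    show "poly ?q s \<noteq> 0" if "s \<in> {s. 0 < Im s}" for s
    proof -
      have ss: "s \<in> slit_plane" using that by (auto simp: slit_plane_def)
      have "leading (\<lambda>x. 1 + s * B x) \<noteq> 0" by (intro leading_nonzero c1 one_plus_nonzero B ss)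
      then show ?thesis using leading_poly(2)[OF B ss] by simp
    qed
  qed (rule real)
  then obtain c where c: "p = smult c ?q" by blast
  \<comment> \<open>Comparing the proportional polynomials at \<open>?t\<close> and 0 eliminates the
    factor \<open>c\<close>.\<close>
  have "poly p ?t * poly ?q 0 = poly ?q ?t * poly p 0" unfolding c by simp
  moreover have "poly p 0 = leading (\<lambda>x. 1 + ?t * b x)" using p slit_plane_0 by simp
  moreover have "poly ?q 0 = leading (\<lambda>x. 1)" using leading_poly(2)[OF B slit_plane_0] by simp
  moreover have "poly p ?t = leading (\<lambda>x. 1 + ?t * (B x + b x))" using p ts by (simp add: algebra_simps)
  moreover have "poly ?q ?t = leading (\<lambda>x. 1 + ?t * B x)" using leading_poly(2)[OF B ts] .
  ultimately show ?thesis by simp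
qed

lemma leading_one_nonzero: "leading (\<lambda>_. 1) \<noteq> 0"
  by (rule leading_nonzero[OF C1_loop_const]) simp

lemma leading_poly_nonzero: "nonneg_loop b \<Longrightarrow> leading_poly b \<noteq> 0"
  using leading_poly(2)[of b 0] leading_one_nonzero by (auto simp: slit_plane_0)

text \<open>\<open>leading_separates\<close> holds at all real t \<ge> 0, which are infinitely many
  points, so it is an identity of polynomials and degrees add.\<close>

lemma degree_leading_poly_add:
  assumes B: "nonneg_loop B" and b: "nonneg_loop b" and disj: "\<And>x. B x = 0 \<or> b x = 0"
  shows "degree (leading_poly (\<lambda>x. B x + b x)) = degree (leading_poly B) + degree (leading_poly b)"
proof -
  let ?l = "smult (leading (\<lambda>_. 1)) (leading_poly (\<lambda>x. B x + b x))"
  have "poly (?l - leading_poly B * leading_poly b) (of_real t) = 0" if t: "0 \<le> t" for t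
    using leading_separates[OF B b disj t] slit_plane_of_real[OF t]
    by (simp add: leading_poly(2)[OF nonneg_loop_add[OF B b]] leading_poly(2)[OF B] leading_poly(2)[OF b] mult.commute)
  then have "of_real ` {0::real..} \<subseteq> {z. poly (?l - leading_poly B * leading_poly b) z = 0}" by auto
  moreover have "infinite (complex_of_real ` {0..})"
    by (subst finite_image_iff) (auto simp: inj_on_def infinite_Ici)
  ultimately have "?l - leading_poly B * leading_poly b = 0"
    using poly_roots_finite finite_subset by blast
  then have "?l = leading_poly B * leading_poly b" by simp
  then have "degree ?l = degree (leading_poly B) + degree (leading_poly b)"
    using leading_poly_nonzero[OF B] leading_poly_nonzero[OF b] by (simp add: degree_mult_eq)
  then show ?thesis using leading_one_nonzero by simp
qed

text \<open>Additivity for 0 = 0 + 0, a decomposition with trivially disjoint supports.\<close>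

lemma degree_leading_poly_zero_loop: "degree (leading_poly (\<lambda>_. 0)) = 0"
proof -
  have 0: "nonneg_loop (\<lambda>_. 0)" by (simp add: nonneg_loop_def C1_loop_const)
  have "degree (leading_poly (\<lambda>x. 0 + 0)) = degree (leading_poly (\<lambda>_. 0)) + degree (leading_poly (\<lambda>_. 0))"
    by (rule degree_leading_poly_add[OF 0 0]) simp
  then show ?thesis by simp
qed

lemma degree_leading_poly_sum:
  fixes n :: nat
  assumes "\<And>i. i < n \<Longrightarrow> nonneg_loop (b i)" "\<And>i j x. i < n \<Longrightarrow> j < n \<Longrightarrow> i \<noteq> j \<Longrightarrow> b i x = 0 \<or> b j x = 0"
  shows "degree (leading_poly (\<lambda>x. \<Sum>i<n. b i x)) = (\<Sum>i<n. degree (leading_poly (b i)))"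
  using assms
proof (induction n)
  case 0
  then show ?case by (simp add: degree_leading_poly_zero_loop)
next
  case (Suc n)
  have "degree (leading_poly (\<lambda>x. (\<Sum>i<n. b i x) + b n x)) =
      degree (leading_poly (\<lambda>x. \<Sum>i<n. b i x)) + degree (leading_poly (b n))"
  proof (rule degree_leading_poly_add)
    show "nonneg_loop (\<lambda>x. \<Sum>i<n. b i x)" by (rule nonneg_loop_sum) (auto intro: Suc.prems(1))
    show "nonneg_loop (b n)" by (rule Suc.prems(1)) simp
    show "(\<Sum>i<n. b i x) = 0 \<or> b n x = 0" for x
    proof (cases "b n x = 0")
      case False
      have "b i x = 0" if "i < n" for i using Suc.prems(2)[of i n x] that False by auto
      then show ?thesis by simp
    qed simp
  qed
  moreover have "degree (leading_poly (\<lambda>x. \<Sum>i<n. b i x)) = (\<Sum>i<n. degree (leading_poly (b i)))"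
  proof (rule Suc.IH)
    show "nonneg_loop (b i)" if "i < n" for i using that by (intro Suc.prems(1)) simp
    show "b i x = 0 \<or> b j x = 0" if "i < n" "j < n" "i \<noteq> j" for i j x using that by (intro Suc.prems(2)) simp_all
  qed
  ultimately show ?case by simp
qed

text \<open>Pigeonhole: the degrees of the bumps add up to that of their sum, which is at most
  \<open>lift_degree\<close> and so less than the number of bumps.\<close>

lemma constant_leading_bump_exists:
  assumes "\<And>i. i < n \<Longrightarrow> nonneg_loop (b i)" "\<And>i j x. i < n \<Longrightarrow> j < n \<Longrightarrow> i \<noteq> j \<Longrightarrow> b i x = 0 \<or> b j x = 0"
    and "lift_degree < n"
  shows "\<exists>i<n. degree (leading_poly (b i)) = 0"
proof (rule ccontr)
  assume "\<not> ?thesis"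
  then have "(\<Sum>i<n. 1) \<le> (\<Sum>i<n. degree (leading_poly (b i)))" by (intro sum_mono) (auto simp: Suc_le_eq)
  also have "\<dots> = degree (leading_poly (\<lambda>x. \<Sum>i<n. b i x))"
    by (rule degree_leading_poly_sum[symmetric]) (use assms in auto)
  also have "\<dots> \<le> lift_degree"
    by (rule leading_poly(1)[OF nonneg_loop_sum]) (use assms in auto)
  finally show False using assms(3) by simp
qed

text \<open>The inverse of \<open>1 + \<tau>\<^sup>n b\<close> grows only linearly in \<open>\<tau>\<close>. Since the degree is less than \<open>n\<close>, this
  bounds the polynomial coefficients of the lift so well that they are constant.\<close>

lemma constant_leading_imp_equal_points:
  assumes b: "nonneg_loop b" and deg: "degree (leading_poly b) = 0" and n: "lift_degree < n"
    and K: "0 < K" "\<And>\<tau>. 1 \<le> \<tau> \<Longrightarrow> C1_bound (\<lambda>s. 1 / (1 + of_real (\<tau> ^ n) * b s)) (K * \<tau>)"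
  shows "\<exists>c. c \<noteq> 0 \<and> (\<forall>j. v (\<lambda>s. 1 + b s) j = c * v (\<lambda>_. 1) j)"
proof -
  let ?D = "lift_degree"
  obtain e C where e: "0 < e" and C: "\<forall>a K x. C1_loop a \<longrightarrow> (\<forall>s. a s \<noteq> 0) \<longrightarrow> C1_bound (\<lambda>s. 1 / a s) K \<longrightarrow> 0 < K \<longrightarrow> K / e < cmod x \<longrightarrow>
     v (\<lambda>s. x * a s) d \<noteq> 0 \<and> (\<forall>j. cmod (v (\<lambda>s. x * a s) j / v (\<lambda>s. x * a s) d) \<le> C j)"
    using v_near_infinity by blast
  obtain q where
    qdeg: "\<forall>t\<in>slit_plane. degree (ray_lift (\<lambda>s. 1 + t * b s) d) = ?D" and
    q: "\<forall>t\<in>slit_plane. \<forall>j. ray_lift (\<lambda>s. 1 + t * b s) j = eval_coeffs ?D (q j) t"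
  proof (rule leading_polynomial[OF C1_loop_const[of 1] nonneg_loop_C1[OF b] one_plus_nonzero[OF b]])
    fix u q
    assume "\<And>t. t \<in> slit_plane \<Longrightarrow> degree (ray_lift (\<lambda>s. 1 + t * b s) d) = degree (ray_lift (\<lambda>_. 1) d)"
      "\<And>t j. t \<in> slit_plane \<Longrightarrow> ray_lift (\<lambda>s. 1 + t * b s) j = eval_coeffs (degree (ray_lift (\<lambda>_. 1) d)) (q j) t"
    then show thesis by (intro that[of q]) (auto simp: lift_degree_def)
  qed
  have C1: "C1_loop (\<lambda>s. 1 + t * b s)" for t by (intro C1_loop_intros nonneg_loop_C1 b)
  have lead: "leading (\<lambda>s. 1 + t * b s) = leading (\<lambda>_. 1)" if t: "t \<in> slit_plane" for t
  proof -
    obtain l where "leading_poly b = [:l:]" using deg by (metis degree_eq_zeroE)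
    then show ?thesis using leading_poly(2)[OF b t] leading_poly(2)[OF b slit_plane_0] by simp
  qed
  have const: "degree (q j i) = 0" if i: "i \<le> ?D" for i j
  proof (rule poly_const_of_subpolynomial_growth)
    show "?D - i < n" using n by simp
    fix \<tau> :: real assume tau: "1 \<le> \<tau>"
    let ?t = "complex_of_real (\<tau> ^ n)"
    have t: "?t \<in> slit_plane" using tau by (intro slit_plane_of_real) simp
    have inv: "\<forall>s. 1 + ?t * b s \<noteq> 0" using one_plus_nonzero[OF b t] by blast
    \<comment> \<open>The inverse bound K \<tau> leaves a zero-free disc of radius e / (K \<tau>)
      around infinity.\<close>
    have far: "v (\<lambda>s. x * (1 + ?t * b s)) d \<noteq> 0 \<and> (\<forall>j. cmod (v (\<lambda>s. x * (1 + ?t * b s)) j / v (\<lambda>s. x * (1 + ?t * b s)) d) \<le> C j)"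
      if "1 / (e / (K * \<tau>)) < cmod x" for x
    proof -
      have "K * \<tau> / e < cmod x" using that by simp
      moreover have "0 < K * \<tau>" using K(1) tau by simp
      ultimately show ?thesis using C C1 inv K(2)[OF tau] by blast
    qed
    have "cmod (coeff (ray_lift (\<lambda>s. 1 + ?t * b s) j) i) \<le>
        C j * 2 ^ ?D * cmod (coeff (ray_lift (\<lambda>s. 1 + ?t * b s) d) ?D) / (e / (K * \<tau>)) ^ (?D - i)"
    proof (rule rational_lift_coeff_bound_infinity[OF ray_lift[OF C1]])
      show "1 + ?t * b s \<noteq> 0" for s using inv by blast
      show "0 < e / (K * \<tau>)" using e K(1) tau by simp
      show "?D = degree (ray_lift (\<lambda>s. 1 + ?t * b s) d)" using qdeg t by simp
    qed (use far i in auto)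
    \<comment> \<open>The leading coefficient is constant in \<tau>, so the only growth left in the
      bound is \<tau>^(D - i), with D - i < n.\<close>
    also have "coeff (ray_lift (\<lambda>s. 1 + ?t * b s) d) ?D = leading (\<lambda>_. 1)"
      using lead[OF t] qdeg t by (simp add: leading_def)
    also have "coeff (ray_lift (\<lambda>s. 1 + ?t * b s) j) i = poly (q j i) ?t"
      using q t i by (simp add: coeff_eval_coeffs)
    also have "C j * 2 ^ ?D * cmod (leading (\<lambda>_. 1)) / (e / (K * \<tau>)) ^ (?D - i) =
        C j * 2 ^ ?D * cmod (leading (\<lambda>_. 1)) / (e / K) ^ (?D - i) * \<tau> ^ (?D - i)"
      using tau by (simp add: power_divide power_mult_distrib)
    finally show "cmod (poly (q j i) ?t) \<le> C j * 2 ^ ?D * cmod (leading (\<lambda>_. 1)) / (e / K) ^ (?D - i) * \<tau> ^ (?D - i)" .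
  qed
  \<comment> \<open>Constant coefficients make the lifts at t = 1 and t = 0 equal.\<close>
  have same: "ray_lift (\<lambda>s. 1 + 1 * b s) j = ray_lift (\<lambda>s. 1 + 0 * b s) j" for j
  proof -
    have "poly (q j i) 1 = poly (q j i) 0" if i: "i \<le> ?D" for i
    proof -
      obtain l where "q j i = [:l:]" using const[OF i, of j] by (metis degree_eq_zeroE)
      then show ?thesis by simp
    qed
    then have "eval_coeffs ?D (q j) 1 = eval_coeffs ?D (q j) 0"
      by (intro poly_eqI) (simp add: coeff_eval_coeffs)
    then show ?thesis
      by (simp only: q[rule_format, OF slit_plane_0] q[rule_format, OF slit_plane_1])
  qed
  have "\<exists>c. c \<noteq> 0 \<and> (\<forall>j. poly (ray_lift (\<lambda>s. 1 + t * b s) j) 1 = c * v (\<lambda>s. 1 + t * b s) j)" if "t \<in> slit_plane" for t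
    using ray_lift[OF C1 one_plus_nonzero[OF b that]] unfolding rational_lift_def by (auto dest!: spec[of _ 1])
  from this[OF slit_plane_1] this[OF slit_plane_0] obtain c c' where
    c: "c \<noteq> 0" "\<forall>j. poly (ray_lift (\<lambda>s. 1 + 1 * b s) j) 1 = c * v (\<lambda>s. 1 + 1 * b s) j" and
    c': "c' \<noteq> 0" "\<forall>j. poly (ray_lift (\<lambda>s. 1 + 0 * b s) j) 1 = c' * v (\<lambda>s. 1 + 0 * b s) j"
    by (elim exE conjE) (rule that)
  have "c * v (\<lambda>s. 1 + 1 * b s) j = c' * v (\<lambda>s. 1 + 0 * b s) j" for j
    by (simp only: c(2)[rule_format, symmetric] c'(2)[rule_format, symmetric] same)
  then have "c * v (\<lambda>s. 1 + b s) j = c' * v (\<lambda>_. 1) j" for j by simp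
  then show ?thesis using c(1) c'(1) by (intro exI[of _ "c' / c"]) (simp add: field_simps)
qed

end

subsection \<open>Bump functions\<close>

text \<open>An exponent of at least 2 smooths the kink at 0: the difference quotient there is at
  most |h|^(n - 1).\<close>

lemma max_0_power_has_derivative:
  assumes "2 \<le> n"
  shows "((\<lambda>x::real. max 0 x ^ n) has_real_derivative real n * max 0 x ^ (n - 1)) (at x)"
proof (cases x "0::real" rule: linorder_cases)
  case less
  have 0: "real n * max 0 x ^ (n - 1) = 0" using less assms by (simp add: power_0_left)
  have "((\<lambda>x. 0) has_real_derivative real n * max 0 x ^ (n - 1)) (at x)"
    unfolding 0 by (rule DERIV_const)
  then show ?thesis
    by (rule DERIV_cong_ev[OF refl _ refl, THEN iffD1, rotated])
      (use eventually_nhds_in_open[of "{..<0}" x] less assms in \<open>auto elim!: eventually_mono\<close>)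
next
  case greater
  have "((\<lambda>x. x ^ n) has_real_derivative real n * max 0 x ^ (n - 1)) (at x)"
    using greater by (auto intro!: derivative_eq_intros)
  then show ?thesis
    by (rule DERIV_cong_ev[OF refl _ refl, THEN iffD1, rotated])
      (use eventually_nhds_in_open[of "{0<..}" x] greater in \<open>auto elim!: eventually_mono\<close>)
next
  case equal
  obtain m where m: "n = Suc m" "0 < m" using assms by (cases n) auto
  have "((\<lambda>h::real. max 0 h ^ n / h) \<longlongrightarrow> 0) (at 0)"
  proof (rule Lim_null_comparison)
    show "\<forall>\<^sub>F h in at 0. norm (max 0 h ^ n / h) \<le> \<bar>h::real\<bar> ^ m"
      by (rule always_eventually) (auto simp: m max_def power_abs)
    have "((\<lambda>h::real. \<bar>h\<bar> ^ m) \<longlongrightarrow> \<bar>0\<bar> ^ m) (at 0)" by (intro tendsto_intros)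
    then show "((\<lambda>h::real. \<bar>h\<bar> ^ m) \<longlongrightarrow> 0) (at 0)" using m by (simp add: power_0_left)
  qed
  then show ?thesis using m by (simp add: equal DERIV_def power_0_left)
qed

text \<open>A parabola cut off outside the interval from k / N to (k + 1) / N. For k < N the
  interval lies in the range of the real part on the circle, and functions of the real part are
  automatically periodic in the angle.\<close>

definition bump_base :: "nat \<Rightarrow> nat \<Rightarrow> real \<Rightarrow> real" where
  "bump_base N k u = max 0 ((u - real k / real N) * (real (Suc k) / real N - u))"

text \<open>For N > 0 the power N + 1 makes the bump continuously differentiable, with a derivative
  that keeps the factor \<open>bump_base\<close> to the power N. The exponent is also the order of
  the root that governs the growth of 1 / (1 + t b).\<close>

definition bump :: "nat \<Rightarrow> nat \<Rightarrow> circle \<Rightarrow> complex" where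
  "bump N k s = of_real (bump_base N k (Re (Rep_circle s)) ^ Suc N)"

lemma bump_base_nonneg: "0 \<le> bump_base N k u"
  by (simp add: bump_base_def)

lemma bump_base_pos_iff:
  assumes "0 < N"
  shows "0 < bump_base N k u \<longleftrightarrow> real k < real N * u \<and> real N * u < real (Suc k)"
proof -
  have lt: "real k / real N < real (Suc k) / real N" using assms by (intro divide_strict_right_mono) auto
  have "0 < bump_base N k u \<longleftrightarrow> 0 < (u - real k / real N) * (real (Suc k) / real N - u)"
    by (auto simp: bump_base_def)
  also have "\<dots> \<longleftrightarrow> real k / real N < u \<and> u < real (Suc k) / real N"
    using lt by (auto simp: zero_less_mult_iff)
  also have "\<dots> \<longleftrightarrow> real k < real N * u \<and> real N * u < real (Suc k)"
    using assms by (simp add: field_simps)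
  finally show ?thesis .
qed

lemma bump_disjoint:
  assumes "0 < N" "k \<noteq> l"
  shows "bump N k s = 0 \<or> bump N l s = 0"
proof (rule ccontr)
  assume "\<not> ?thesis"
  then have "bump_base N k (Re (Rep_circle s)) \<noteq> 0" "bump_base N l (Re (Rep_circle s)) \<noteq> 0"
    by (auto simp: bump_def)
  then have "0 < bump_base N k (Re (Rep_circle s))" "0 < bump_base N l (Re (Rep_circle s))"
    using bump_base_nonneg[of N k "Re (Rep_circle s)"] bump_base_nonneg[of N l "Re (Rep_circle s)"] by linarith+
  then have "k < Suc l" "l < Suc k"
    unfolding bump_base_pos_iff[OF assms(1)] of_nat_less_iff[symmetric, where 'a = real] by linarith+
  then show False using assms(2) by simp
qed

lemma bump_not_zero:
  assumes "k < N"
  shows "\<exists>s. bump N k s \<noteq> 0"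
proof -
  \<comment> \<open>The midpoint of the supporting interval, attained by the cosine at the angle
    arccos u.\<close>
  define u where "u = (real k + 1 / 2) / real N"
  have N: "0 < N" using assms by simp
  have "real k + 1 / 2 \<le> real N" using assms by linarith
  then have u: "-1 \<le> u" "u \<le> 1" using N by (auto simp: u_def divide_le_eq intro: order.trans[of _ 0])
  have "0 < bump_base N k u" unfolding bump_base_pos_iff[OF N] using N by (simp add: u_def)
  then have "bump N k (circ (arccos u)) \<noteq> 0" using u by (simp add: bump_def)
  then show ?thesis by blast
qed

definition bump_deriv :: "nat \<Rightarrow> nat \<Rightarrow> real \<Rightarrow> real" where
  "bump_deriv N k t = real (Suc N) * bump_base N k (cos t) ^ N * ((real (2 * k + 1) / real N - 2 * cos t) * (- sin t))"

lemma bump_has_derivative: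
  assumes "0 < N"
  shows "((\<lambda>t. bump N k (circ t)) has_vector_derivative of_real (bump_deriv N k t)) (at t)"
proof -
  have inner: "((\<lambda>t. (cos t - real k / real N) * (real (Suc k) / real N - cos t)) has_real_derivative
      (real (2 * k + 1) / real N - 2 * cos t) * (- sin t)) (at t)"
    using assms by (auto intro!: derivative_eq_intros simp: algebra_simps add_divide_distrib)
  have "2 \<le> Suc N" using assms by simp
  from DERIV_chain2[OF max_0_power_has_derivative[OF this] inner]
  have "((\<lambda>t. bump_base N k (cos t) ^ Suc N) has_real_derivative bump_deriv N k t) (at t)"
    by (simp add: bump_base_def bump_deriv_def)
  then show ?thesis unfolding bump_def
    by (simp add: has_vector_derivative_of_real has_real_derivative_iff_has_vector_derivative
        del: of_real_power power_Suc)
qed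

lemma bump_deriv_bound:
  assumes "k < N"
  shows "\<bar>bump_deriv N k t\<bar> \<le> 4 * real (Suc N) * bump_base N k (cos t) ^ N"
proof -
  have "real (2 * k + 1) / real N \<le> 2" using assms by (simp add: divide_le_eq)
  moreover have "0 \<le> real (2 * k + 1) / real N" by simp
  ultimately have "\<bar>real (2 * k + 1) / real N - 2 * cos t\<bar> \<le> 4"
    using cos_le_one[of t] cos_ge_minus_one[of t] by linarith
  then have "\<bar>(real (2 * k + 1) / real N - 2 * cos t) * (- sin t)\<bar> \<le> 4 * 1"
    unfolding abs_mult by (intro mult_mono) auto
  then have "(real (Suc N) * bump_base N k (cos t) ^ N) * \<bar>(real (2 * k + 1) / real N - 2 * cos t) * (- sin t)\<bar>
      \<le> (real (Suc N) * bump_base N k (cos t) ^ N) * (4 * 1)"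
    using bump_base_nonneg by (intro mult_left_mono) auto
  moreover have "\<bar>bump_deriv N k t\<bar> =
      (real (Suc N) * bump_base N k (cos t) ^ N) * \<bar>(real (2 * k + 1) / real N - 2 * cos t) * (- sin t)\<bar>"
    unfolding bump_deriv_def abs_mult[of "real (Suc N) * bump_base N k (cos t) ^ N"]
    using bump_base_nonneg by (simp only: abs_of_nonneg mult_nonneg_nonneg of_nat_0_le_iff zero_le_power)
  ultimately show ?thesis by (simp only: mult_1_right mult.commute mult.left_commute)
qed

lemma bump_deriv_continuous: "continuous_on UNIV (bump_deriv N k)"
  unfolding bump_deriv_def[abs_def] bump_base_def by (intro continuous_intros)

lemma bump_base_le: "\<lbrakk>k < N; \<bar>u\<bar> \<le> 1\<rbrakk> \<Longrightarrow> bump_base N k u \<le> 4"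
proof -
  assume k: "k < N" and u: "\<bar>u\<bar> \<le> 1"
  have "real k / real N \<le> 1" "real (Suc k) / real N \<le> 1" "0 \<le> real k / real N" "0 \<le> real (Suc k) / real N"
    using k by (auto simp: divide_le_eq)
  then have "\<bar>u - real k / real N\<bar> \<le> 2" "\<bar>real (Suc k) / real N - u\<bar> \<le> 2" using u by linarith+
  then have "\<bar>(u - real k / real N) * (real (Suc k) / real N - u)\<bar> \<le> 2 * 2"
    unfolding abs_mult by (intro mult_mono) auto
  then show "bump_base N k u \<le> 4" by (simp add: bump_base_def)
qed

lemma nonneg_loop_bump:
  assumes "k < N"
  shows "nonneg_loop (bump N k)"
proof -
  have N: "0 < N" using assms by simp
  have "C1_bound (bump N k) (4 * real (Suc N) * 4 ^ Suc N)"
    unfolding C1_bound_def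
  proof (intro exI[of _ "\<lambda>t. of_real (bump_deriv N k t)"] conjI allI)
    show "continuous_on UNIV (\<lambda>t. complex_of_real (bump_deriv N k t))"
      by (intro continuous_on_of_real bump_deriv_continuous)
    fix t
    show "((\<lambda>t. bump N k (circ t)) has_vector_derivative of_real (bump_deriv N k t)) (at t)"
      by (rule bump_has_derivative[OF N])
    have b: "0 \<le> bump_base N k (cos t)" "bump_base N k (cos t) \<le> 4"
      using bump_base_nonneg bump_base_le[OF assms, of "cos t"] by auto
    have "cmod (bump N k (circ t)) \<le> 4 ^ Suc N"
      unfolding bump_def using b by (simp add: norm_power power_mono del: power_Suc)
    also have "\<dots> \<le> 4 * real (Suc N) * 4 ^ Suc N" by simp
    finally show "cmod (bump N k (circ t)) \<le> 4 * real (Suc N) * 4 ^ Suc N" .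
    have "\<bar>bump_deriv N k t\<bar> \<le> 4 * real (Suc N) * bump_base N k (cos t) ^ N" by (rule bump_deriv_bound[OF assms])
    also have "\<dots> \<le> 4 * real (Suc N) * 4 ^ N" using b by (intro mult_left_mono power_mono) auto
    also have "\<dots> \<le> 4 * real (Suc N) * 4 ^ Suc N" by simp
    finally show "cmod (complex_of_real (bump_deriv N k t)) \<le> 4 * real (Suc N) * 4 ^ Suc N" by simp
  qed
  then show ?thesis using bump_base_nonneg by (auto simp: nonneg_loop_def bump_def intro: C1_loopI)
qed

text \<open>With y = \<tau> times the base, the derivative of the inverse is at most 4 (N + 1)
  \<tau> y^N / (1 + y^(N+1))^2, and the fraction in y is at most 1. So of the power \<tau>^(N+1)
  only one factor \<tau> survives.\<close>

lemma bump_inverse_bound: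
  assumes k: "k < N" and tau: "1 \<le> \<tau>"
  shows "C1_bound (\<lambda>s. 1 / (1 + of_real (\<tau> ^ Suc N) * bump N k s)) (4 * real (Suc N) * \<tau>)"
proof (rule C1_bound_inverse)
  have N: "0 < N" using k by simp
  show "continuous_on UNIV (\<lambda>t. of_real (\<tau> ^ Suc N) * complex_of_real (bump_deriv N k t))"
    by (intro continuous_intros continuous_on_of_real bump_deriv_continuous)
  show "((\<lambda>t. 1 + of_real (\<tau> ^ Suc N) * bump N k (circ t)) has_vector_derivative
      of_real (\<tau> ^ Suc N) * complex_of_real (bump_deriv N k t)) (at t)" for t
    using has_vector_derivative_add[OF has_vector_derivative_const
        has_vector_derivative_mult_right[OF bump_has_derivative[OF N]]] by simp
  have re: "1 + of_real (\<tau> ^ Suc N) * bump N k s = of_real (1 + (\<tau> * bump_base N k (Re (Rep_circle s))) ^ Suc N)" for s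
    by (simp only: bump_def of_real_add of_real_mult of_real_power of_real_1 power_mult_distrib)
  have ge: "1 \<le> 1 + (\<tau> * bump_base N k u) ^ Suc N" for u
    using tau bump_base_nonneg[of N k u] by simp
  show "1 + of_real (\<tau> ^ Suc N) * bump N k s \<noteq> 0" for s
    unfolding re of_real_eq_0_iff using ge[of "Re (Rep_circle s)"] by linarith
  have one: "1 \<le> 4 * real (Suc N) * \<tau>" using tau mult_mono[of 1 "4 * real (Suc N)" 1 \<tau>] by simp
  show "cmod (1 / (1 + of_real (\<tau> ^ Suc N) * bump N k s)) \<le> 4 * real (Suc N) * \<tau>" for s
  proof -
    have "cmod (1 / (1 + of_real (\<tau> ^ Suc N) * bump N k s)) \<le> 1"
      unfolding re norm_divide norm_of_real using ge[of "Re (Rep_circle s)"] by (simp add: divide_le_eq del: power_Suc)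
    then show ?thesis using one by linarith
  qed
  show "cmod (of_real (\<tau> ^ Suc N) * complex_of_real (bump_deriv N k t) / (1 + of_real (\<tau> ^ Suc N) * bump N k (circ t))\<^sup>2)
      \<le> 4 * real (Suc N) * \<tau>" for t
  proof -
    define y where "y = \<tau> * bump_base N k (cos t)"
    have y: "0 \<le> y" using tau bump_base_nonneg by (simp add: y_def)
    have "y ^ N \<le> 1 + y ^ Suc N"
    proof (cases "y \<le> 1")
      case True
      then have "y ^ N \<le> 1" using y by (simp add: power_le_one)
      then show ?thesis using y by (simp add: add_increasing2)
    next
      case False
      then have "y ^ N \<le> y ^ Suc N" by (intro power_increasing) auto
      then show ?thesis by simp
    qed
    moreover have ge1: "1 \<le> 1 + y ^ Suc N" using y by simp
    then have "1 + y ^ Suc N \<le> (1 + y ^ Suc N)\<^sup>2" by (simp add: power2_eq_square del: power_Suc)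
    ultimately have yb: "y ^ N \<le> (1 + y ^ Suc N)\<^sup>2" by linarith
    have "\<tau> ^ Suc N * \<bar>bump_deriv N k t\<bar> \<le> \<tau> ^ Suc N * (4 * real (Suc N) * bump_base N k (cos t) ^ N)"
      using tau by (intro mult_left_mono bump_deriv_bound k) auto
    also have "\<dots> = 4 * real (Suc N) * \<tau> * y ^ N" by (simp add: y_def power_mult_distrib)
    also have "\<dots> \<le> 4 * real (Suc N) * \<tau> * (1 + y ^ Suc N)\<^sup>2" using tau yb by (intro mult_left_mono) auto
    finally have "\<tau> ^ Suc N * \<bar>bump_deriv N k t\<bar> / (1 + y ^ Suc N)\<^sup>2 \<le> 4 * real (Suc N) * \<tau>"
      using ge1 by (subst pos_divide_le_eq) (auto intro!: zero_less_power simp del: power_Suc)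
    moreover have "1 + of_real (\<tau> ^ Suc N) * bump N k (circ t) = of_real (1 + y ^ Suc N)"
      unfolding re y_def by simp
    moreover have "cmod (of_real (\<tau> ^ Suc N) * complex_of_real (bump_deriv N k t) / (of_real (1 + y ^ Suc N))\<^sup>2)
        = \<tau> ^ Suc N * \<bar>bump_deriv N k t\<bar> / (1 + y ^ Suc N)\<^sup>2"
      unfolding norm_divide norm_mult norm_power norm_of_real using tau by (simp del: power_Suc)
    ultimately show ?thesis by simp
  qed
qed

theorem (in projective_loop_map) not_injective:
  "\<exists>a b. C1_loop a \<and> C1_loop b \<and> a \<noteq> b \<and> (\<exists>c. c \<noteq> 0 \<and> (\<forall>j. v a j = c * v b j))"
proof -
  \<comment> \<open>The number of bumps is the degree plus 1 and their exponent the degree plus 2,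
    so both exceed the degree.\<close>
  define N where "N = Suc lift_degree"
  have N: "0 < N" by (simp add: N_def)
  have "\<exists>k<N. degree (leading_poly (bump N k)) = 0"
    by (rule constant_leading_bump_exists) (use nonneg_loop_bump bump_disjoint[OF N] in \<open>auto simp: N_def\<close>)
  then obtain k where k: "k < N" "degree (leading_poly (bump N k)) = 0" by blast
  have "\<exists>c. c \<noteq> 0 \<and> (\<forall>j. v (\<lambda>s. 1 + bump N k s) j = c * v (\<lambda>_. 1) j)"
  proof (rule constant_leading_imp_equal_points[OF nonneg_loop_bump[OF k(1)] k(2)])
    show "lift_degree < Suc N" by (simp add: N_def)
    show "0 < 4 * real (Suc N)" by simp
  qed (rule bump_inverse_bound[OF k(1)])
  moreover obtain s where "bump N k s \<noteq> 0" using bump_not_zero[OF k(1)] by blast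
  then have "(\<lambda>s. 1 + bump N k s) \<noteq> (\<lambda>_. 1)" by (auto simp: fun_eq_iff)
  moreover have "C1_loop (\<lambda>s. 1 + bump N k s)"
    using nonneg_loop_bump[OF k(1)] by (intro C1_loop_intros nonneg_loop_C1)
  ultimately show ?thesis using C1_loop_const[of 1] by blast
qed

section \<open>Weak derivatives on the circle\<close>

text \<open>Real polynomials restricted to the circle are closed under the angular derivative, so
  iteration shows them smooth. By Stone-Weierstrass they are a uniformly dense supply of test
  functions.\<close>

lemma real_polynomial_function_cis_deriv:
  fixes p :: "complex \<Rightarrow> real"
  assumes "real_polynomial_function p"
  shows "\<exists>q. real_polynomial_function q \<and> (\<forall>t. ((\<lambda>t. p (cis t)) has_real_derivative q (cis t)) (at t))"
  using assms
proof (induction rule: real_polynomial_function.induct)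
  case (linear f)
  have "((\<lambda>t. f (cis t)) has_real_derivative f (\<i> * cis t)) (at t)" for t
  proof -
    have "(cis has_vector_derivative \<i> * cis t) (at t)"
      unfolding cis_conv_exp by (auto intro!: derivative_eq_intros has_vector_derivative_real_field)
    from bounded_linear.has_vector_derivative[OF linear this] show ?thesis
      by (simp add: has_real_derivative_iff_has_vector_derivative)
  qed
  moreover have "bounded_linear (\<lambda>z. f (\<i> * z))"
    using linear bounded_linear_mult_right by (rule bounded_linear_compose)
  ultimately show ?case using real_polynomial_function.intros(1) by blast
next
  case (const c)
  show ?case by (intro exI[of _ "\<lambda>_. 0"]) (auto intro: real_polynomial_function.intros(2))
next
  case (add f g)
  then obtain f' g' where "real_polynomial_function f'" "\<forall>t. ((\<lambda>t. f (cis t)) has_real_derivative f' (cis t)) (at t)"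
    "real_polynomial_function g'" "\<forall>t. ((\<lambda>t. g (cis t)) has_real_derivative g' (cis t)) (at t)" by blast
  then show ?case
    by (intro exI[of _ "\<lambda>z. f' z + g' z"]) (auto intro: real_polynomial_function.intros(3) DERIV_add)
next
  case (mult f g)
  then obtain f' g' where fg: "real_polynomial_function f'" "\<forall>t. ((\<lambda>t. f (cis t)) has_real_derivative f' (cis t)) (at t)"
    "real_polynomial_function g'" "\<forall>t. ((\<lambda>t. g (cis t)) has_real_derivative g' (cis t)) (at t)" by blast
  have "((\<lambda>t. f (cis t) * g (cis t)) has_real_derivative f' (cis t) * g (cis t) + g' (cis t) * f (cis t)) (at t)" for t
    using fg by (intro DERIV_mult) auto
  moreover have "real_polynomial_function (\<lambda>z. f' z * g z + g' z * f z)"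
    using fg mult by (intro real_polynomial_function.intros(3) real_polynomial_function.intros(4))
  ultimately show ?case by (intro exI[of _ "\<lambda>z. f' z * g z + g' z * f z"]) auto
qed

lemma smooth_circle_real_polynomial:
  assumes "real_polynomial_function p"
  shows "smooth_circle (\<lambda>s. p (Rep_circle s))"
proof -
  have "\<exists>q. real_polynomial_function q \<and> (deriv ^^ k) (\<lambda>t. p (cis t)) = (\<lambda>t. q (cis t))" for k
  proof (induction k)
    case 0
    then show ?case using assms by auto
  next
    case (Suc k)
    then obtain q where q: "real_polynomial_function q" "(deriv ^^ k) (\<lambda>t. p (cis t)) = (\<lambda>t. q (cis t))" by blast
    obtain q' where "real_polynomial_function q'" "\<forall>t. ((\<lambda>t. q (cis t)) has_real_derivative q' (cis t)) (at t)"
      using real_polynomial_function_cis_deriv[OF q(1)] by blast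
    then show ?case by (intro exI[of _ q']) (auto simp: q(2) fun_eq_iff intro: DERIV_imp_deriv)
  qed
  then have "(deriv ^^ k) (\<lambda>t. p (cis t)) field_differentiable at t" for k t
    using real_polynomial_function_cis_deriv by (metis field_differentiable_def)
  then show ?thesis by (simp add: smooth_circle_def o_def)
qed

lemma borel_measurable_cis [measurable]: "cis \<in> borel_measurable borel"
  by (intro borel_measurable_continuous_onI continuous_intros)

text \<open>Polynomials are smooth test functions and approximate \<open>h\<close> uniformly on the
  circle; the error is at most e times the integral of |g|.\<close>

lemma integral_zero_of_smooth_zero:
  fixes g :: "real \<Rightarrow> complex"
  assumes g: "integrable lborel g"
    and zero: "\<And>\<phi>. smooth_circle \<phi> \<Longrightarrow> (LINT t|lborel. g t * of_real (\<phi> (circ t))) = 0"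
    and h: "continuous_on (sphere 0 1) h" "\<And>t. \<bar>h (cis t)\<bar> \<le> (1::real)"
  shows "(LINT t|lborel. g t * of_real (h (cis t))) = 0"
proof -
  have gm [measurable]: "g \<in> borel_measurable lborel" using g by (rule borel_measurable_integrable)
  have hm [measurable]: "(\<lambda>t. h (cis t)) \<in> borel_measurable lborel"
    using continuous_on_compose2[OF h(1), of UNIV cis]
    by (simp add: borel_measurable_continuous_onI continuous_on_cis continuous_on_id image_subset_iff)
  have ghi: "integrable lborel (\<lambda>t. g t * of_real (h (cis t)))"
    by (rule Bochner_Integration.integrable_bound[OF g])
      (measurable, use h(2) in \<open>auto simp: norm_mult intro!: mult_left_le\<close>)
  define I where "I = (LINT t|lborel. cmod (g t))"
  have I0: "0 \<le> I" unfolding I_def by simp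
  have le: "cmod (LINT t|lborel. g t * of_real (h (cis t))) \<le> e * I" if e: "0 < e" for e
  proof -
    obtain p where p: "real_polynomial_function p" "\<And>z. z \<in> sphere 0 1 \<Longrightarrow> \<bar>h z - p z\<bar> < e"
      using Stone_Weierstrass_real_polynomial_function[OF compact_sphere h(1) e] by blast
    have pe: "\<bar>h (cis t) - p (cis t)\<bar> \<le> e" for t using p(2)[of "cis t"] by simp
    obtain q where q: "\<forall>t. ((\<lambda>t. p (cis t)) has_real_derivative q (cis t)) (at t)"
      using real_polynomial_function_cis_deriv[OF p(1)] by blast
    then have "continuous_on UNIV (\<lambda>t. p (cis t))"
      by (meson DERIV_isCont continuous_at_imp_continuous_on)
    then have pm [measurable]: "(\<lambda>t. p (cis t)) \<in> borel_measurable lborel"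
      by (simp add: borel_measurable_continuous_onI)
    have eg: "integrable lborel (\<lambda>t. of_real e * g t)" using g by simp
    have gp: "integrable lborel (\<lambda>t. g t * of_real (h (cis t) - p (cis t)))"
    proof (rule Bochner_Integration.integrable_bound[OF eg])
      show "(\<lambda>t. g t * of_real (h (cis t) - p (cis t))) \<in> borel_measurable lborel" by measurable
      show "AE t in lborel. cmod (g t * of_real (h (cis t) - p (cis t))) \<le> cmod (of_real e * g t)"
        using pe e by (intro AE_I2) (simp add: norm_mult mult.commute[of e] mult_left_mono del: of_real_diff)
    qed
    have "(LINT t|lborel. g t * of_real (h (cis t))) - (LINT t|lborel. g t * of_real (h (cis t) - p (cis t)))
        = (LINT t|lborel. g t * of_real (p (cis t)))"
      by (subst Bochner_Integration.integral_diff[symmetric, OF ghi gp]) (simp add: algebra_simps)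
    also have "\<dots> = 0" using zero[OF smooth_circle_real_polynomial[OF p(1)]] by simp
    finally have "cmod (LINT t|lborel. g t * of_real (h (cis t))) = cmod (LINT t|lborel. g t * of_real (h (cis t) - p (cis t)))"
      by simp
    also have "\<dots> \<le> (LINT t|lborel. cmod (g t * of_real (h (cis t) - p (cis t))))" by (rule integral_norm_bound)
    also have "\<dots> \<le> (LINT t|lborel. e * cmod (g t))"
    proof (rule integral_mono)
      show "integrable lborel (\<lambda>t. cmod (g t * of_real (h (cis t) - p (cis t))))" using gp by (rule integrable_norm)
      show "integrable lborel (\<lambda>t. e * cmod (g t))" using g by simp
      show "cmod (g t * of_real (h (cis t) - p (cis t))) \<le> e * cmod (g t)" for t
        using pe[of t] by (simp add: norm_mult mult.commute[of e] mult_left_mono del: of_real_diff)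
    qed
    finally show ?thesis by (simp add: I_def)
  qed
  have "cmod (LINT t|lborel. g t * of_real (h (cis t))) \<le> 0 + e" if "0 < e" for e
  proof -
    have "e / (I + 1) * I \<le> e" using that I0 by (simp add: field_simps)
    then show ?thesis using le[of "e / (I + 1)"] that I0 by simp
  qed
  then have "cmod (LINT t|lborel. g t * of_real (h (cis t))) \<le> 0" by (rule field_le_epsilon)
  then show ?thesis by simp
qed

text \<open>The indicator of \<open>K\<close> is the pointwise limit of continuous functions of the
  distance to \<open>K\<close>, all bounded by 1, so dominated convergence applies. For an empty set
  \<open>infdist\<close> would be 0 everywhere.\<close>

lemma integral_zero_on_arc:
  fixes g :: "real \<Rightarrow> complex"
  assumes g: "integrable lborel g"
    and zero: "\<And>\<phi>. smooth_circle \<phi> \<Longrightarrow> (LINT t|lborel. g t * of_real (\<phi> (circ t))) = 0"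
    and K: "closed K" "K \<noteq> {}"
  shows "(LINT t|lborel. g t * of_real (indicator K (cis t))) = 0"
proof -
  define h where "h = (\<lambda>n z. max 0 (1 - real n * infdist z K))"
  have gm [measurable]: "g \<in> borel_measurable lborel" using g by (rule borel_measurable_integrable)
  have hc: "continuous_on UNIV (h n)" for n
    unfolding h_def by (intro continuous_intros)
  have hm [measurable]: "(\<lambda>t. h n (cis t)) \<in> borel_measurable lborel" for n
    using continuous_on_compose2[OF hc[of n], of UNIV cis]
    by (simp add: borel_measurable_continuous_onI continuous_on_cis continuous_on_id)
  have Km [measurable]: "(\<lambda>t. indicator K (cis t) :: real) \<in> borel_measurable lborel"
  proof -
    have "indicator K \<in> borel_measurable (borel :: complex measure)" using K(1) by (intro borel_measurable_indicator) auto
    from measurable_compose[OF borel_measurable_cis this] show ?thesis by simp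
  qed
  have h1: "\<bar>h n z\<bar> \<le> 1" for n z by (auto simp: h_def infdist_nonneg)
  have "(\<lambda>n. LINT t|lborel. g t * of_real (h n (cis t))) \<longlonglongrightarrow> (LINT t|lborel. g t * of_real (indicator K (cis t)))"
  proof (rule integral_dominated_convergence[where w = "\<lambda>t. cmod (g t)"])
    show "(\<lambda>t. g t * of_real (indicator K (cis t))) \<in> borel_measurable lborel" by measurable
    show "(\<lambda>t. g t * of_real (h n (cis t))) \<in> borel_measurable lborel" for n by measurable
    show "integrable lborel (\<lambda>t. cmod (g t))" using g by (rule integrable_norm)
    have "(\<lambda>n. h n z) \<longlonglongrightarrow> indicator K z" for z
    proof (cases "z \<in> K")
      case True
      then show ?thesis by (simp add: h_def)
    next
      case False
      then have pos: "0 < infdist z K" using K infdist_pos_not_in_closed by blast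
      obtain N :: nat where N: "1 / infdist z K < real N" using reals_Archimedean2 by blast
      have "h n z = 0" if "N \<le> n" for n
      proof -
        have "1 < real N * infdist z K" using N pos by (simp add: pos_divide_less_eq)
        also have "\<dots> \<le> real n * infdist z K" using that pos by (intro mult_right_mono) auto
        finally show ?thesis by (simp add: h_def)
      qed
      then have "\<forall>\<^sub>F n in sequentially. h n z = 0" unfolding eventually_sequentially by blast
      then show ?thesis using False by (simp add: tendsto_eventually)
    qed
    then show "AE t in lborel. (\<lambda>n. g t * of_real (h n (cis t))) \<longlonglongrightarrow> g t * of_real (indicator K (cis t))"
      by (intro AE_I2 tendsto_mult tendsto_const tendsto_of_real)
    show "AE t in lborel. cmod (g t * of_real (h n (cis t))) \<le> cmod (g t)" for n
      using h1 by (intro AE_I2) (simp add: norm_mult mult_left_le)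
  qed
  moreover have "(LINT t|lborel. g t * of_real (h n (cis t))) = 0" for n
    by (rule integral_zero_of_smooth_zero[OF g zero continuous_on_subset[OF hc]]) (use h1 in auto)
  ultimately show ?thesis by (simp add: LIMSEQ_const_iff)
qed

lemma Arg2pi_cis: "t \<in> {0..<2*pi} \<Longrightarrow> Arg2pi (cis t) = t"
  by (rule Arg2pi_unique[of 1]) (auto simp: cis_conv_exp)

text \<open>Within one period a half-line corresponds to a closed arc, the full circle or nothing,
  so the integrals of \<open>g\<close> over half-lines vanish. Half-lines are stable under
  intersection and generate the Borel sets; hence the integral over every Borel set
  vanishes.\<close>

lemma AE_zero_of_smooth_zero:
  fixes g :: "real \<Rightarrow> complex"
  assumes g: "integrable lborel g" and supp: "\<And>t. t \<notin> {0..<2*pi} \<Longrightarrow> g t = 0"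
    and zero: "\<And>\<phi>. smooth_circle \<phi> \<Longrightarrow> (LINT t|lborel. g t * of_real (\<phi> (circ t))) = 0"
  shows "AE t in lborel. g t = 0"
proof -
  have gen: "(LINT t:{..a}|lborel. g t) = 0" for a
  proof -
    consider "a < 0" | "0 \<le> a" "a < 2 * pi" | "2 * pi \<le> a" by linarith
    then show ?thesis
    proof cases
      case 1
      then have 0: "indicat_real {..a} t *\<^sub>R g t = 0" for t using supp[of t] by (auto simp: indicator_def)
      show ?thesis unfolding set_lebesgue_integral_def 0 by simp
    next
      case 2
      have eq: "indicat_real {..a} t *\<^sub>R g t = g t * of_real (indicator (cis ` {0..a}) (cis t))" for t
      proof (cases "t \<in> {0..<2*pi}")
        case True
        have "cis t \<in> cis ` {0..a} \<longleftrightarrow> t \<le> a"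
        proof
          assume "cis t \<in> cis ` {0..a}"
          then obtain x where x: "cis t = cis x" "x \<in> {0..a}" by (rule imageE)
          have "x \<in> {0..<2*pi}" using x(2) 2 by simp
          then have "Arg2pi (cis x) = x" by (rule Arg2pi_cis)
          then have "t = x" unfolding x(1)[symmetric] Arg2pi_cis[OF True] .
          then show "t \<le> a" using x(2) by simp
        next
          assume "t \<le> a"
          then show "cis t \<in> cis ` {0..a}" using True by (intro imageI) simp
        qed
        then show ?thesis using True by (cases "t \<le> a") (simp_all add: indicator_def)
      qed (simp add: supp)
      have cl: "closed (cis ` {0..a})"
        by (intro compact_imp_closed compact_continuous_image continuous_on_cis continuous_on_id compact_Icc)
      have ne: "cis ` {0..a} \<noteq> {}" using 2 by simp
      show ?thesis
        unfolding set_lebesgue_integral_def eq by (rule integral_zero_on_arc[OF g zero cl ne])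
    next
      case 3
      have eq: "indicat_real {..a} t *\<^sub>R g t = g t * of_real (indicator (sphere 0 1) (cis t))" for t
        using supp[of t] 3 by (auto simp: indicator_def)
      have ne: "sphere (0::complex) 1 \<noteq> {}" by simp
      show ?thesis
        unfolding set_lebesgue_integral_def eq by (rule integral_zero_on_arc[OF g zero closed_sphere ne])
    qed
  qed
  have int: "set_integrable lborel A g" if "A \<in> sets borel" for A
    unfolding set_integrable_def using g that by (intro integrable_mult_indicator) auto
  have all: "(LINT t|lborel. g t) = 0"
    using zero[OF smooth_circle_real_polynomial[OF real_polynomial_function.intros(2)[of 1]]] by simp
  have borel: "(LINT t:A|lborel. g t) = 0" if A: "A \<in> sets lborel" for A
  proof -
    have "A \<in> sigma_sets UNIV (range atMost)" using A by (simp add: borel_eq_atMost)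
    then show ?thesis
    proof (rule sigma_sets_induct_disjoint[rotated 2])
      show "Int_stable (range (atMost :: real \<Rightarrow> real set))" by (auto simp: Int_stable_def)
      show "(LINT t:UNIV - B|lborel. g t) = 0" if "B \<in> sigma_sets UNIV (range atMost)" "(LINT t:B|lborel. g t) = 0" for B
      proof -
        have B: "B \<in> sets borel" using that(1) by (simp add: borel_eq_atMost)
        have "(LINT t:(B \<union> (UNIV - B))|lborel. g t) = (LINT t:B|lborel. g t) + (LINT t:UNIV - B|lborel. g t)"
          by (rule set_integral_Un) (use B int in auto)
        then show ?thesis using that(2) all by (simp add: set_lebesgue_integral_def)
      qed
      show "(LINT t:\<Union> (range B)|lborel. g t) = 0"
        if "disjoint_family B" "range B \<subseteq> sigma_sets UNIV (range atMost)" "\<And>i. (LINT t:B i|lborel. g t) = 0" for B :: "nat \<Rightarrow> real set"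
      proof -
        have B: "B i \<in> sets borel" for i using that(2) by (auto simp: borel_eq_atMost)
        have "(LINT t:\<Union> (range B)|lborel. g t) = (\<Sum>i. LINT t:B i|lborel. g t)"
          by (rule lebesgue_integral_countable_add) (use B that(1) int in \<open>auto simp: disjoint_family_on_def\<close>)
        then show ?thesis using that(3) by simp
      qed
      show "(LINT t:B|lborel. g t) = 0" if "B \<in> range atMost" for B using that gen by blast
      show "(LINT t:{}|lborel. g t) = 0" by (simp add: set_lebesgue_integral_def)
    qed simp
  qed
  show ?thesis
    by (rule sigma_finite_measure.density_zero[OF lborel.sigma_finite_measure_axioms g borel])
qed

subsection \<open>The Sobolev norm on the whole circle\<close>

lemma angles_UNIV [simp]: "angles UNIV = {0..<2 * pi}"
  by (auto simp: angles_def)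

definition L2_circle :: "(circle \<Rightarrow> complex) \<Rightarrow> bool" where
  "L2_circle f \<longleftrightarrow> square_integrable_on UNIV f"

definition sq_norm :: "(circle \<Rightarrow> complex) \<Rightarrow> real" where
  "sq_norm f = (LINT t:{0..<2*pi}|lborel. (cmod (f (circ t)))\<^sup>2)"

lemma sq_norm_nonneg: "0 \<le> sq_norm f"
  unfolding sq_norm_def set_lebesgue_integral_def by (rule Bochner_Integration.integral_nonneg) simp

lemma L2_circle_alt:
  "L2_circle f \<longleftrightarrow> (\<lambda>t. indicator {0..<2*pi} t *\<^sub>R f (circ t)) \<in> borel_measurable lborel \<and>
     integrable lborel (\<lambda>t. (cmod (indicator {0..<2*pi} t *\<^sub>R f (circ t)))\<^sup>2)"
proof -
  have "indicat_real {0..<2*pi} t *\<^sub>R (cmod (f (circ t)))\<^sup>2 = (cmod (indicat_real {0..<2*pi} t *\<^sub>R f (circ t)))\<^sup>2" for t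
    by (simp add: indicator_def)
  then show ?thesis
    by (simp add: L2_circle_def square_integrable_on_def set_borel_measurable_def set_integrable_def)
qed

lemma L2_circle_measurable: "L2_circle f \<Longrightarrow> (\<lambda>t. indicator {0..<2*pi} t *\<^sub>R f (circ t)) \<in> borel_measurable lborel"
  unfolding L2_circle_alt by (rule conjunct1)

lemma L2_circle_square_integrable:
  "L2_circle f \<Longrightarrow> integrable lborel (\<lambda>t. (cmod (indicator {0..<2*pi} t *\<^sub>R f (circ t)))\<^sup>2)"
  unfolding L2_circle_alt by (rule conjunct2)

lemma sq_norm_alt: "sq_norm f = (LINT t|lborel. (cmod (indicator {0..<2*pi} t *\<^sub>R f (circ t)))\<^sup>2)"
proof -
  have "indicat_real {0..<2*pi} t *\<^sub>R (cmod (f (circ t)))\<^sup>2 = (cmod (indicat_real {0..<2*pi} t *\<^sub>R f (circ t)))\<^sup>2" for t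
    by (simp add: indicator_def)
  then show ?thesis by (simp add: sq_norm_def set_lebesgue_integral_def)
qed

text \<open>After the triangle inequality the two sides differ by (c |x| - |y|)^2 / c. The free
  weight \<open>c\<close> replaces Cauchy-Schwarz in the triangle inequality of the Sobolev
  norm.\<close>

lemma cmod_add_square_le:
  assumes "0 < c"
  shows "(cmod (x + y))\<^sup>2 \<le> (1 + c) * (cmod x)\<^sup>2 + (1 + 1 / c) * (cmod y)\<^sup>2"
proof -
  have "(cmod (x + y))\<^sup>2 \<le> (cmod x + cmod y)\<^sup>2" by (intro power_mono norm_triangle_ineq) auto
  also have "\<dots> = (1 + c) * (cmod x)\<^sup>2 + (1 + 1 / c) * (cmod y)\<^sup>2 - (c * cmod x - cmod y)\<^sup>2 / c"
    using assms by (simp add: power2_eq_square field_simps)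
  also have "\<dots> \<le> (1 + c) * (cmod x)\<^sup>2 + (1 + 1 / c) * (cmod y)\<^sup>2" using assms by simp
  finally show ?thesis .
qed

lemma L2_circle_add:
  assumes f: "L2_circle f" and g: "L2_circle g"
  shows "L2_circle (\<lambda>s. f s + g s)"
    and "0 < c \<Longrightarrow> sq_norm (\<lambda>s. f s + g s) \<le> (1 + c) * sq_norm f + (1 + 1 / c) * sq_norm g"
proof -
  let ?F = "\<lambda>t. indicat_real {0..<2*pi} t *\<^sub>R f (circ t)" and ?G = "\<lambda>t. indicat_real {0..<2*pi} t *\<^sub>R g (circ t)"
  have eq: "indicat_real {0..<2*pi} t *\<^sub>R (f (circ t) + g (circ t)) = ?F t + ?G t" for t by (simp add: scaleR_add_right)
  note m [measurable] = L2_circle_measurable[OF f] L2_circle_measurable[OF g]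
  note i = L2_circle_square_integrable[OF f] L2_circle_square_integrable[OF g]
  have int: "integrable lborel (\<lambda>t. (1 + c) * (cmod (?F t))\<^sup>2 + (1 + 1 / c) * (cmod (?G t))\<^sup>2)" for c
    using i by (intro Bochner_Integration.integrable_add integrable_mult_right)
  have sum: "integrable lborel (\<lambda>t. (cmod (?F t + ?G t))\<^sup>2)"
  proof (rule Bochner_Integration.integrable_bound[OF int[of 1]])
    show "(\<lambda>t. (cmod (?F t + ?G t))\<^sup>2) \<in> borel_measurable lborel" by measurable
    show "AE t in lborel. norm ((cmod (?F t + ?G t))\<^sup>2) \<le> norm ((1 + 1) * (cmod (?F t))\<^sup>2 + (1 + 1 / 1) * (cmod (?G t))\<^sup>2)"
    proof (rule AE_I2)
      fix t
      show "norm ((cmod (?F t + ?G t))\<^sup>2) \<le> norm ((1 + 1) * (cmod (?F t))\<^sup>2 + (1 + 1 / 1) * (cmod (?G t))\<^sup>2)"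
        unfolding real_norm_def abs_of_nonneg[OF zero_le_power2]
        by (rule order.trans[OF cmod_add_square_le[of 1] abs_ge_self]) simp
    qed
  qed
  show "L2_circle (\<lambda>s. f s + g s)" unfolding L2_circle_alt eq
    by (intro conjI sum) measurable
  show "sq_norm (\<lambda>s. f s + g s) \<le> (1 + c) * sq_norm f + (1 + 1 / c) * sq_norm g" if c: "0 < c"
  proof -
    have "sq_norm (\<lambda>s. f s + g s) = (LINT t|lborel. (cmod (?F t + ?G t))\<^sup>2)" unfolding sq_norm_alt eq ..
    also have "\<dots> \<le> (LINT t|lborel. (1 + c) * (cmod (?F t))\<^sup>2 + (1 + 1 / c) * (cmod (?G t))\<^sup>2)"
      by (rule integral_mono[OF sum int]) (rule cmod_add_square_le[OF c])
    also have "\<dots> = (1 + c) * sq_norm f + (1 + 1 / c) * sq_norm g"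
      unfolding sq_norm_alt
      by (subst Bochner_Integration.integral_add) (intro integrable_mult_right i, intro integrable_mult_right i, simp only: integral_mult_right_zero)
    finally show ?thesis .
  qed
qed

lemma L2_circle_cmult: "L2_circle f \<Longrightarrow> L2_circle (\<lambda>s. c * f s)"
proof -
  assume f: "L2_circle f"
  have eq: "indicat_real {0..<2*pi} t *\<^sub>R (c * f (circ t)) = c * (indicat_real {0..<2*pi} t *\<^sub>R f (circ t))" for t
    by simp
  note [measurable] = L2_circle_measurable[OF f]
  show "L2_circle (\<lambda>s. c * f s)"
    unfolding L2_circle_alt eq norm_mult[of c] power_mult_distrib[of "cmod c"]
    by (intro conjI integrable_mult_right L2_circle_square_integrable[OF f]) measurable
qed

text \<open>On a set of finite measure square integrability implies integrability, by x \<le> 1 +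
  x^2.\<close>

lemma L2_circle_integrable:
  assumes "L2_circle f"
  shows "integrable lborel (\<lambda>t. indicator {0..<2*pi} t *\<^sub>R f (circ t))"
proof (rule Bochner_Integration.integrable_bound)
  let ?F = "\<lambda>t. indicat_real {0..<2*pi} t *\<^sub>R f (circ t)"
  show "integrable lborel (\<lambda>t. indicat_real {0..<2*pi} t + (cmod (?F t))\<^sup>2)"
    by (intro Bochner_Integration.integrable_add L2_circle_square_integrable[OF assms])
      (auto intro: integrable_real_indicator)
  show "?F \<in> borel_measurable lborel" by (rule L2_circle_measurable[OF assms])
  show "AE t in lborel. norm (?F t) \<le> norm (indicat_real {0..<2*pi} t + (cmod (?F t))\<^sup>2)"
  proof (rule AE_I2)
    fix t
    have "x \<le> 1 + x\<^sup>2" for x :: real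
    proof -
      have "0 \<le> (x - 1 / 2)\<^sup>2" by simp
      then show ?thesis by (simp add: power2_eq_square algebra_simps)
    qed
    then show "norm (?F t) \<le> norm (indicat_real {0..<2*pi} t + (cmod (?F t))\<^sup>2)"
      by (auto simp: indicator_def)
  qed
qed

lemma L2_circle_times_continuous:
  assumes w: "L2_circle w" and h: "continuous_on UNIV h"
  shows "set_integrable lborel {0..<2*pi} (\<lambda>t. w (circ t) * of_real (h t))"
proof -
  let ?I = "\<lambda>t. indicat_real {0..<2*pi} t"
  note [measurable] = L2_circle_measurable[OF w]
  have [measurable]: "h \<in> borel_measurable lborel"
    using h by (simp add: borel_measurable_continuous_onI)
  have "compact (h ` {0..2*pi})"
    using h by (intro compact_continuous_image) (auto intro: continuous_on_subset)
  then have "bounded (h ` {0..2*pi})" by (rule compact_imp_bounded)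
  then obtain B where "\<forall>x\<in>h ` {0..2*pi}. norm x \<le> B" unfolding bounded_iff by (rule exE)
  then have B: "\<bar>h t\<bar> \<le> B" if "t \<in> {0..2*pi}" for t using that by simp
  have "integrable lborel (\<lambda>t. of_real B * (?I t *\<^sub>R w (circ t)))"
    using L2_circle_integrable[OF w] by (rule integrable_mult_right)
  moreover have "(\<lambda>t. (?I t *\<^sub>R w (circ t)) * of_real (h t)) \<in> borel_measurable lborel" by measurable
  then have "(\<lambda>t. ?I t *\<^sub>R (w (circ t) * of_real (h t))) \<in> borel_measurable lborel" by simp
  moreover have "AE t in lborel. norm (?I t *\<^sub>R (w (circ t) * of_real (h t))) \<le> norm (of_real B * (?I t *\<^sub>R w (circ t)))"
  proof (rule AE_I2)
    fix t
    show "norm (?I t *\<^sub>R (w (circ t) * of_real (h t))) \<le> norm (of_real B * (?I t *\<^sub>R w (circ t)))"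
    proof (cases "t \<in> {0..<2*pi}")
      case True
      then have "\<bar>h t\<bar> \<le> \<bar>B\<bar>" using order.trans[OF B abs_ge_self] by simp
      then show ?thesis using True by (simp add: norm_mult mult.commute[of "cmod (w (circ t))"] mult_right_mono)
    qed simp
  qed
  ultimately show ?thesis unfolding set_integrable_def by (rule Bochner_Integration.integrable_bound)
qed

lemma smooth_circle_continuous:
  assumes "smooth_circle \<phi>"
  shows "continuous_on UNIV (\<lambda>t. \<phi> (circ t))" and "continuous_on UNIV (deriv (\<phi> \<circ> circ))"
    and "((\<lambda>t. \<phi> (circ t)) has_real_derivative deriv (\<phi> \<circ> circ) t) (at t)"
proof -
  have k: "(deriv ^^ k) (\<phi> \<circ> circ) field_differentiable (at t)" for k t
    using assms unfolding smooth_circle_def by blast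
  have c: "continuous_on UNIV ((deriv ^^ k) (\<phi> \<circ> circ))" for k
    by (intro continuous_at_imp_continuous_on ballI field_differentiable_imp_continuous_at k)
  show "continuous_on UNIV (\<lambda>t. \<phi> (circ t))" using c[of 0] by (simp only: funpow_0 o_def)
  show "continuous_on UNIV (deriv (\<phi> \<circ> circ))" using c[of 1] by simp
  have "((\<phi> \<circ> circ) has_real_derivative deriv (\<phi> \<circ> circ) t) (at t)"
    by (rule field_differentiable_derivI) (use k[of 0 t] in \<open>simp only: funpow_0\<close>)
  moreover have "(\<lambda>t. \<phi> (circ t)) = \<phi> \<circ> circ" by (simp add: o_def)
  ultimately show "((\<lambda>t. \<phi> (circ t)) has_real_derivative deriv (\<phi> \<circ> circ) t) (at t)" by (simp only:)
qed

text \<open>Both derivatives define the same functional on test functions, and on the whole circle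
  every smooth function is one.\<close>

lemma weak_derivative_unique:
  assumes u: "L2_circle u" "weak_derivative_on UNIV f u" and v: "L2_circle v" "weak_derivative_on UNIV f v"
  shows "AE t in lborel. t \<in> {0..<2*pi} \<longrightarrow> u (circ t) = v (circ t)"
proof -
  let ?I = "\<lambda>t. indicat_real {0..<2*pi} t"
  define g where "g = (\<lambda>t. ?I t *\<^sub>R u (circ t) - ?I t *\<^sub>R v (circ t))"
  have int: "integrable lborel g"
    unfolding g_def by (intro Bochner_Integration.integrable_diff L2_circle_integrable u v)
  have zero: "(LINT t|lborel. g t * of_real (\<phi> (circ t))) = 0" if phi: "smooth_circle \<phi>" for \<phi>
  proof -
    note prod = L2_circle_times_continuous[OF _ smooth_circle_continuous(1)[OF phi], unfolded set_integrable_def]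
    have eq: "(LINT t:{0..<2*pi}|lborel. u (circ t) * of_real (\<phi> (circ t))) =
        (LINT t:{0..<2*pi}|lborel. v (circ t) * of_real (\<phi> (circ t)))"
    proof -
      have "(LINT t:{0..<2*pi}|lborel. f (circ t) * of_real (deriv (\<phi> \<circ> circ) t)) =
          - (LINT t:{0..<2*pi}|lborel. w (circ t) * of_real (\<phi> (circ t)))" if "weak_derivative_on UNIV f w" for w
        using that phi unfolding weak_derivative_on_def by simp
      from this[OF u(2)] this[OF v(2)] show ?thesis by simp
    qed
    have "(LINT t|lborel. g t * of_real (\<phi> (circ t))) =
        (LINT t|lborel. ?I t *\<^sub>R (u (circ t) * of_real (\<phi> (circ t))) - ?I t *\<^sub>R (v (circ t) * of_real (\<phi> (circ t))))"
      by (intro Bochner_Integration.integral_cong) (auto simp: g_def left_diff_distrib)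
    also have "\<dots> = 0"
      using eq by (simp add: Bochner_Integration.integral_diff prod u v set_lebesgue_integral_def)
    finally show ?thesis .
  qed
  have "AE t in lborel. g t = 0"
    by (rule AE_zero_of_smooth_zero[OF int _ zero]) (simp_all add: g_def)
  then show ?thesis by eventually_elim (auto simp: g_def)
qed

text \<open>\<open>W12_norm\<close> refers to a chosen weak derivative; uniqueness almost everywhere
  makes its value independent of the choice.\<close>

lemma W12_norm_eq:
  assumes u: "L2_circle u" "weak_derivative_on UNIV f u"
  shows "W12_norm UNIV f = sqrt (sq_norm f + sq_norm u)"
proof -
  let ?v = "some_weak_derivative UNIV f"
  have "square_integrable_on UNIV ?v \<and> weak_derivative_on UNIV f ?v"
    unfolding some_weak_derivative_def by (rule someI[of _ u]) (use u in \<open>simp add: L2_circle_def\<close>)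
  then have v: "L2_circle ?v" "weak_derivative_on UNIV f ?v" by (simp_all add: L2_circle_def)
  have "sq_norm ?v = sq_norm u"
    unfolding sq_norm_alt
  proof (rule Bochner_Integration.integral_cong_AE)
    note [measurable] = L2_circle_measurable[OF v(1)] L2_circle_measurable[OF u(1)]
    show "(\<lambda>t. (cmod (indicat_real {0..<2*pi} t *\<^sub>R ?v (circ t)))\<^sup>2) \<in> borel_measurable lborel" by measurable
    show "(\<lambda>t. (cmod (indicat_real {0..<2*pi} t *\<^sub>R u (circ t)))\<^sup>2) \<in> borel_measurable lborel" by measurable
    show "AE t in lborel. (cmod (indicat_real {0..<2*pi} t *\<^sub>R ?v (circ t)))\<^sup>2 = (cmod (indicat_real {0..<2*pi} t *\<^sub>R u (circ t)))\<^sup>2"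
      using weak_derivative_unique[OF v u] by eventually_elim (auto simp: indicator_def)
  qed
  then show ?thesis by (simp add: W12_norm_def sq_norm_def)
qed

lemma weak_derivative_add:
  assumes u: "L2_circle u" "weak_derivative_on UNIV f u" and v: "L2_circle v" "weak_derivative_on UNIV g v"
    and f: "L2_circle f" and g: "L2_circle g"
  shows "weak_derivative_on UNIV (\<lambda>s. f s + g s) (\<lambda>s. u s + v s)"
  unfolding weak_derivative_on_def
proof (intro allI impI)
  fix \<phi> assume "smooth_circle \<phi> \<and> closure {s. \<phi> s \<noteq> 0} \<subseteq> UNIV"
  then have phi: "smooth_circle \<phi>" by simp
  note 1 = L2_circle_times_continuous[OF _ smooth_circle_continuous(1)[OF phi]]
  note 2 = L2_circle_times_continuous[OF _ smooth_circle_continuous(2)[OF phi]]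
  show "(LINT t:{0..<2*pi}|lborel. (f (circ t) + g (circ t)) * of_real (deriv (\<phi> \<circ> circ) t)) =
      - (LINT t:{0..<2*pi}|lborel. (u (circ t) + v (circ t)) * of_real (\<phi> (circ t)))"
    using u(2) v(2) phi unfolding weak_derivative_on_def distrib_right
    by (simp add: set_integral_add(2)[OF 2[OF f] 2[OF g]] set_integral_add(2)[OF 1[OF u(1)] 1[OF v(1)]])
qed

lemma weak_derivative_cmult:
  assumes "weak_derivative_on UNIV f u"
  shows "weak_derivative_on UNIV (\<lambda>s. c * f s) (\<lambda>s. c * u s)"
  using assms unfolding weak_derivative_on_def mult.assoc set_integral_mult_right by simp

lemma sq_norm_cmult: "sq_norm (\<lambda>s. c * f s) = (cmod c)\<^sup>2 * sq_norm f"
  by (simp add: sq_norm_def norm_mult power_mult_distrib)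

lemma W12_circleE:
  assumes "W12 UNIV f"
  obtains u where "L2_circle f" "L2_circle u" "weak_derivative_on UNIV f u"
  using assms unfolding W12_def L2_circle_def by blast

lemma W12_norm_cmult:
  assumes "W12 UNIV f"
  shows "W12_norm UNIV (\<lambda>s. c * f s) = cmod c * W12_norm UNIV f"
proof -
  obtain u where u: "L2_circle f" "L2_circle u" "weak_derivative_on UNIV f u" by (rule W12_circleE[OF assms])
  have "W12_norm UNIV (\<lambda>s. c * f s) = sqrt ((cmod c)\<^sup>2 * (sq_norm f + sq_norm u))"
    using W12_norm_eq[OF L2_circle_cmult[OF u(2)] weak_derivative_cmult[OF u(3)], of c]
    by (simp add: sq_norm_cmult distrib_left)
  then show ?thesis using W12_norm_eq[OF u(2,3)] by (simp add: real_sqrt_mult)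
qed

lemma W12_norm_nonneg: "0 \<le> W12_norm UNIV f"
  unfolding W12_norm_def angles_UNIV
  using sq_norm_nonneg[of f] sq_norm_nonneg[of "some_weak_derivative UNIV f"] by (simp add: sq_norm_def)

lemma circ_continuous_real: "continuous_on UNIV f \<Longrightarrow> continuous_on UNIV (\<lambda>t. f (circ t))"
  for f :: "circle \<Rightarrow> complex"
  unfolding continuous_on_open_vimage[OF open_UNIV] open_circle_def by (auto simp: vimage_def)

text \<open>A zero norm gives f = 0 almost everywhere. A nonempty open interval on which the
  continuous \<open>f\<close> is nonzero would have positive measure; the endpoints 0 and 2 pi are
  reached by closure.\<close>

lemma W12_norm_eq_0_iff:
  assumes "W12 UNIV f"
  shows "W12_norm UNIV f = 0 \<longleftrightarrow> f = (\<lambda>_. 0)"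
proof
  assume 0: "W12_norm UNIV f = 0"
  obtain u where u: "L2_circle f" "L2_circle u" "weak_derivative_on UNIV f u" by (rule W12_circleE[OF assms])
  have "sq_norm f = 0"
    using 0 sq_norm_nonneg[of f] sq_norm_nonneg[of u] unfolding W12_norm_eq[OF u(2,3)] by simp
  then have "AE t in lborel. (cmod (indicat_real {0..<2*pi} t *\<^sub>R f (circ t)))\<^sup>2 = 0"
    unfolding sq_norm_alt
    by (subst (asm) integral_nonneg_eq_0_iff_AE[OF L2_circle_square_integrable[OF u(1)]]) auto
  then have ae: "AE t in lborel. t \<in> {0..<2*pi} \<longrightarrow> f (circ t) = 0" by eventually_elim auto
  have cont: "continuous_on UNIV (\<lambda>t. f (circ t))"
    using assms by (intro circ_continuous_real) (simp add: W12_def)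
  have zero: "f (circ t) = 0" if t: "t \<in> {0<..<2*pi}" for t
  proof (rule ccontr)
    assume nz: "f (circ t) \<noteq> 0"
    have "open ({0<..<2*pi} \<inter> {t. f (circ t) \<noteq> 0})"
      using cont by (intro open_Int open_greaterThanLessThan open_Collect_neq continuous_on_const)
    moreover have "t \<in> {0<..<2*pi} \<inter> {t. f (circ t) \<noteq> 0}" using t nz by simp
    ultimately obtain e where e: "0 < e" "ball t e \<subseteq> {0<..<2*pi} \<inter> {t. f (circ t) \<noteq> 0}"
      by (rule openE)
    have "AE x in lborel. x \<notin> ball t e"
      using ae
    proof eventually_elim
      case (elim x)
      show "x \<notin> ball t e"
      proof
        assume "x \<in> ball t e"
        then have "x \<in> {0<..<2*pi} \<inter> {t. f (circ t) \<noteq> 0}" by (rule subsetD[OF e(2)])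
        then show False using elim by simp
      qed
    qed
    then have "ball t e \<in> null_sets lborel" by (subst AE_iff_null_sets) auto
    then have "emeasure lborel (ball t e) = 0" by (rule null_setsD1)
    then show False using e(1) by (simp add: ball_eq_greaterThanLessThan)
  qed
  have "f s = 0" for s
  proof -
    obtain t where t: "t \<in> {0..2*pi}" "circ t = s" using circ_surj by blast
    have "{0..2*pi} \<subseteq> closure {0<..<2*pi}" by simp
    then have "f (circ t) = 0"
      by (intro continuous_constant_on_closure[of "{0<..<2*pi}" "\<lambda>t. f (circ t)" 0 t]
          continuous_on_subset[OF cont] zero) (use t in auto)
    then show ?thesis using t by simp
  qed
  then show "f = (\<lambda>_. 0)" by auto
next
  assume "f = (\<lambda>_. 0)"
  then show "W12_norm UNIV f = 0" using W12_norm_cmult[OF assms, of 0] by simp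
qed

lemma W12_circle_add: "W12 UNIV f \<Longrightarrow> W12 UNIV g \<Longrightarrow> W12 UNIV (\<lambda>s. f s + g s)"
proof -
  assume f: "W12 UNIV f" and g: "W12 UNIV g"
  obtain u where u: "L2_circle f" "L2_circle u" "weak_derivative_on UNIV f u" by (rule W12_circleE[OF f])
  obtain v where v: "L2_circle g" "L2_circle v" "weak_derivative_on UNIV g v" by (rule W12_circleE[OF g])
  have "continuous_on UNIV (\<lambda>s. f s + g s)" using f g by (intro continuous_on_add) (auto simp: W12_def)
  moreover have "L2_circle (\<lambda>s. f s + g s)" "L2_circle (\<lambda>s. u s + v s)" by (intro L2_circle_add u v)+
  ultimately show ?thesis
    using weak_derivative_add[OF u(2,3) v(2,3) u(1) v(1)] unfolding W12_def L2_circle_def by blast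
qed

lemma W12_circle_cmult: "W12 UNIV f \<Longrightarrow> W12 UNIV (\<lambda>s. c * f s)"
proof -
  assume f: "W12 UNIV f"
  obtain u where u: "L2_circle f" "L2_circle u" "weak_derivative_on UNIV f u" by (rule W12_circleE[OF f])
  have "continuous_on UNIV (\<lambda>s. c * f s)" using f by (intro continuous_on_mult_left) (auto simp: W12_def)
  then show ?thesis
    using L2_circle_cmult[OF u(1), of c] L2_circle_cmult[OF u(2), of c] weak_derivative_cmult[OF u(3), of c]
    unfolding W12_def L2_circle_def by blast
qed

lemma W12_norm_triangle:
  assumes f: "W12 UNIV f" and g: "W12 UNIV g"
  shows "W12_norm UNIV (\<lambda>s. f s + g s) \<le> W12_norm UNIV f + W12_norm UNIV g"
proof -
  obtain u where u: "L2_circle f" "L2_circle u" "weak_derivative_on UNIV f u" by (rule W12_circleE[OF f])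
  obtain v where v: "L2_circle g" "L2_circle v" "weak_derivative_on UNIV g v" by (rule W12_circleE[OF g])
  let ?a = "W12_norm UNIV f" and ?b = "W12_norm UNIV g"
  have a2: "?a\<^sup>2 = sq_norm f + sq_norm u" and b2: "?b\<^sup>2 = sq_norm g + sq_norm v"
    using sq_norm_nonneg by (simp_all add: W12_norm_eq[OF u(2,3)] W12_norm_eq[OF v(2,3)])
  have s2: "W12_norm UNIV (\<lambda>s. f s + g s) = sqrt (sq_norm (\<lambda>s. f s + g s) + sq_norm (\<lambda>s. u s + v s))"
    by (rule W12_norm_eq[OF L2_circle_add(1)[OF u(2) v(2)] weak_derivative_add[OF u(2,3) v(2,3) u(1) v(1)]])
  consider "?a = 0" | "?b = 0" | "0 < ?a" "0 < ?b" using W12_norm_nonneg[of f] W12_norm_nonneg[of g] by linarith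
  then show ?thesis
  proof cases
    case 1
    then show ?thesis using W12_norm_eq_0_iff[OF f] by simp
  next
    case 2
    then show ?thesis using W12_norm_eq_0_iff[OF g] by simp
  next
    case 3
    \<comment> \<open>For norms a and b this weight turns (1 + c) a^2 + (1 + 1/c) b^2 into (a +
      b)^2.\<close>
    define c where "c = ?b / ?a"
    have c: "0 < c" using 3 by (simp add: c_def)
    have "sq_norm (\<lambda>s. f s + g s) + sq_norm (\<lambda>s. u s + v s) \<le> (1 + c) * ?a\<^sup>2 + (1 + 1 / c) * ?b\<^sup>2"
      using L2_circle_add(2)[OF u(1) v(1) c] L2_circle_add(2)[OF u(2) v(2) c] unfolding a2 b2 distrib_left by linarith
    also have "\<dots> = (?a + ?b)\<^sup>2" using 3 by (simp add: c_def power2_eq_square field_simps)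
    finally show ?thesis unfolding s2 using 3 by (intro real_le_lsqrt) auto
  qed
qed

subsection \<open>Continuously differentiable functions are Sobolev functions\<close>

text \<open>The inverse of \<open>circ\<close> on one half-open period; it turns an angular
  derivative into a function on the circle.\<close>

definition circle_angle :: "circle \<Rightarrow> real" where
  "circle_angle s = Arg2pi (Rep_circle s)"

lemma circle_angle_circ: "t \<in> {0..<2*pi} \<Longrightarrow> circle_angle (circ t) = t"
  by (simp add: circle_angle_def Arg2pi_cis del: atLeastLessThan_iff)

lemma circ_2pi: "circ (2 * pi) = circ 0"
  by (simp add: circ_def)

lemma open_circ_vimage: "open U \<Longrightarrow> open (circ -` U)"
  by (simp add: open_circle_def)

lemma closed_circ_vimage: "closed K \<Longrightarrow> closed (circ -` K)"
  using open_circ_vimage[of "- K"] by (simp add: vimage_Compl open_closed)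

text \<open>Adding the angle 2 pi and the boundary of \<open>T\<close> embeds
  \<open>angles T\<close> in a compact set, on which continuity gives integrability.\<close>

lemma square_integrable_on_of_continuous:
  assumes T: "open T" and cont: "continuous_on ({0..2*pi} \<inter> circ -` closure T) g"
    and eq: "\<And>t. t \<in> {0..<2*pi} \<Longrightarrow> f (circ t) = g t"
  shows "square_integrable_on T f"
proof -
  let ?K = "{0..2*pi} \<inter> circ -` closure T"
  have K: "compact ?K" by (intro compact_Int_closed compact_Icc closed_circ_vimage closed_closure)
  have ang: "angles T = {0..<2*pi} \<inter> circ -` T" by (auto simp: angles_def)
  have m: "angles T \<in> sets lborel" unfolding ang using open_circ_vimage[OF T] by auto
  have sub: "angles T \<subseteq> ?K" unfolding ang using closure_subset[of T] by auto
  have eq': "f (circ t) = g t" if "t \<in> angles T" for t using eq that unfolding ang by simp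
  have gi: "set_integrable lborel (angles T) g"
    by (rule set_integrable_subset[OF _ m sub]) (use borel_integrable_compact[OF K cont] in \<open>simp add: set_integrable_def\<close>)
  have "continuous_on ?K (\<lambda>t. (cmod (g t))\<^sup>2)" by (intro continuous_intros cont)
  from borel_integrable_compact[OF K this]
  have gi2: "set_integrable lborel (angles T) (\<lambda>t. (cmod (g t))\<^sup>2)"
    by (intro set_integrable_subset[OF _ m sub]) (simp add: set_integrable_def)
  have "set_borel_measurable lborel (angles T) g"
    using gi unfolding set_integrable_def set_borel_measurable_def by (rule borel_measurable_integrable)
  moreover have "(\<lambda>t. indicat_real (angles T) t *\<^sub>R (f \<circ> circ) t) = (\<lambda>t. indicat_real (angles T) t *\<^sub>R g t)"
    using eq' by (auto simp: indicator_def fun_eq_iff)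
  moreover have "(\<lambda>t. indicat_real (angles T) t *\<^sub>R (cmod (f (circ t)))\<^sup>2) = (\<lambda>t. indicat_real (angles T) t *\<^sub>R (cmod (g t))\<^sup>2)"
    using eq' by (auto simp: indicator_def fun_eq_iff)
  ultimately show ?thesis
    using gi2 unfolding square_integrable_on_def set_borel_measurable_def set_integrable_def by simp
qed

lemma set_integral_Icc_Ico: "(LINT t:{0..<2*pi}|lborel. f t) = (LINT t:{0..2*pi}|lborel. f t)"
  for f :: "real \<Rightarrow> complex"
  using interval_integral_Icc[of 0 "2*pi" f] interval_integral_Ico[of 0 "2*pi" f] by simp

text \<open>Integration by parts over a full period. The support of the test function lies in
  \<open>Q\<close>, so the products extend by 0 to continuous functions on the line, and the
  boundary terms cancel by periodicity.\<close>

lemma weak_derivative_on_of_derivative: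
  assumes Q: "open Q" "closure T \<subseteq> Q"
    and der: "\<And>t. circ t \<in> Q \<Longrightarrow> ((\<lambda>t. F (circ t)) has_vector_derivative F' t) (at t)"
    and cont: "continuous_on (circ -` Q) F'"
  shows "weak_derivative_on T F (\<lambda>s. F' (circle_angle s))"
  unfolding weak_derivative_on_def
proof (intro allI impI)
  fix \<phi> assume "smooth_circle \<phi> \<and> closure {s. \<phi> s \<noteq> 0} \<subseteq> T"
  then have phi: "smooth_circle \<phi>" and supp: "closure {s. \<phi> s \<noteq> 0} \<subseteq> T" by auto
  let ?S = "closure {s. \<phi> s \<noteq> 0}"
  let ?\<phi>' = "deriv (\<phi> \<circ> circ)"
  note smooth = smooth_circle_continuous[OF phi]
  define W where "W = circ -` (- ?S)"
  have W: "open W" unfolding W_def by (intro open_circ_vimage open_Compl closed_closure)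
  have oQ: "open (circ -` Q)" by (rule open_circ_vimage[OF Q(1)])
  have "?S \<subseteq> Q" using supp closure_subset[of T] Q(2) by (metis order.trans)
  then have cover: "UNIV = circ -` Q \<union> W" unfolding W_def by auto
  have phi0: "\<phi> (circ t) = 0" if "t \<in> W" for t
    using that closure_subset[of "{s. \<phi> s \<noteq> 0}"] unfolding W_def by auto
  have phi'0: "?\<phi>' t = 0" if "t \<in> W" for t
  proof -
    have "((\<lambda>t. 0) has_real_derivative 0) (at t)" by (rule DERIV_const)
    then have "((\<lambda>t. \<phi> (circ t)) has_real_derivative 0) (at t)"
      by (rule has_field_derivative_transform_within_open[OF _ W that]) (simp add: phi0)
    then show ?thesis using smooth(3)[of t] by (metis DERIV_unique)
  qed
  have Fc: "continuous_on (circ -` Q) (\<lambda>t. F (circ t))"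
    by (intro continuous_at_imp_continuous_on ballI has_vector_derivative_continuous[OF der]) simp
  have c1: "continuous_on UNIV (\<lambda>t. F' t * of_real (\<phi> (circ t)))"
    unfolding cover
  proof (rule continuous_on_open_Un[OF oQ W])
    show "continuous_on (circ -` Q) (\<lambda>t. F' t * of_real (\<phi> (circ t)))"
      by (intro continuous_on_mult cont continuous_on_of_real continuous_on_subset[OF smooth(1)]) simp
    show "continuous_on W (\<lambda>t. F' t * of_real (\<phi> (circ t)))"
      by (rule continuous_on_eq[OF continuous_on_const[of W 0]]) (simp add: phi0)
  qed
  have c2: "continuous_on UNIV (\<lambda>t. F (circ t) * of_real (?\<phi>' t))"
    unfolding cover
  proof (rule continuous_on_open_Un[OF oQ W])
    show "continuous_on (circ -` Q) (\<lambda>t. F (circ t) * of_real (?\<phi>' t))"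
      by (intro continuous_on_mult Fc continuous_on_of_real continuous_on_subset[OF smooth(2)]) simp
    show "continuous_on W (\<lambda>t. F (circ t) * of_real (?\<phi>' t))"
      by (rule continuous_on_eq[OF continuous_on_const[of W 0]]) (simp add: phi'0)
  qed
  have d: "((\<lambda>t. F (circ t) * of_real (\<phi> (circ t))) has_vector_derivative
      (F' t * of_real (\<phi> (circ t)) + F (circ t) * of_real (?\<phi>' t))) (at t)" for t
  proof (cases "t \<in> W")
    case True
    have "((\<lambda>t. 0) has_vector_derivative 0) (at t)" by simp
    then have "((\<lambda>t. F (circ t) * of_real (\<phi> (circ t))) has_vector_derivative 0) (at t)"
      by (rule has_vector_derivative_transform_within_open[OF _ W True]) (simp add: phi0)
    then show ?thesis using True by (simp add: phi0 phi'0)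
  next
    case False
    then have "circ t \<in> Q" using cover by auto
    have "((\<lambda>t. complex_of_real (\<phi> (circ t))) has_vector_derivative of_real (?\<phi>' t)) (at t)"
      using smooth(3)[of t] by (intro has_vector_derivative_of_real) (simp only: has_real_derivative_iff_has_vector_derivative)
    from has_vector_derivative_mult[OF der[OF \<open>circ t \<in> Q\<close>] this]
    show ?thesis by (simp add: add.commute)
  qed
  have i1: "set_integrable lborel {0..2*pi} (\<lambda>t. F' t * of_real (\<phi> (circ t)))"
    unfolding set_integrable_def by (rule borel_integrable_compact[OF compact_Icc continuous_on_subset[OF c1 subset_UNIV]])
  have i2: "set_integrable lborel {0..2*pi} (\<lambda>t. F (circ t) * of_real (?\<phi>' t))"
    unfolding set_integrable_def by (rule borel_integrable_compact[OF compact_Icc continuous_on_subset[OF c2 subset_UNIV]])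
  have "(LINT t:{0..2*pi}|lborel. F' t * of_real (\<phi> (circ t)) + F (circ t) * of_real (?\<phi>' t)) =
      F (circ (2*pi)) * of_real (\<phi> (circ (2*pi))) - F (circ 0) * of_real (\<phi> (circ 0))"
    unfolding set_lebesgue_integral_def
    by (rule integral_FTC_atLeastAtMost)
      (auto intro: has_vector_derivative_at_within[OF d] continuous_on_subset[OF continuous_on_add[OF c1 c2] subset_UNIV])
  then have sum: "(LINT t:{0..2*pi}|lborel. F' t * of_real (\<phi> (circ t))) + (LINT t:{0..2*pi}|lborel. F (circ t) * of_real (?\<phi>' t)) = 0"
    by (simp add: set_integral_add(2)[OF i1 i2] circ_2pi)
  have "(LINT t:{0..<2*pi}|lborel. F' (circle_angle (circ t)) * of_real (\<phi> (circ t))) =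
      (LINT t:{0..<2*pi}|lborel. F' t * of_real (\<phi> (circ t)))"
    by (intro set_lebesgue_integral_cong) (auto simp: circle_angle_circ simp del: atLeastLessThan_iff)
  then show "(LINT t:{0..<2*pi}|lborel. F (circ t) * of_real (?\<phi>' t)) =
      - (LINT t:{0..<2*pi}|lborel. F' (circle_angle (circ t)) * of_real (\<phi> (circ t)))"
    using sum unfolding set_integral_Icc_Ico by (simp add: eq_neg_iff_add_eq_0 add.commute)
qed

lemma continuous_on_circle:
  assumes "open T" "continuous_on (circ -` T) (\<lambda>t. f (circ t))"
  shows "continuous_on T f"
proof -
  have "open (f -` B \<inter> T)" if "open B" for B
  proof -
    have "open ((\<lambda>t. f (circ t)) -` B \<inter> circ -` T)"
      using assms(2) that continuous_on_open_vimage[OF open_circ_vimage[OF assms(1)]] by blast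
    moreover have "circ -` (f -` B \<inter> T) = (\<lambda>t. f (circ t)) -` B \<inter> circ -` T" by auto
    ultimately show ?thesis by (simp add: open_circle_def)
  qed
  then show ?thesis unfolding continuous_on_open_vimage[OF assms(1)] by blast
qed

text \<open>Differentiability on a neighbourhood of the closure keeps the function and its
  derivative continuous up to the boundary of \<open>T\<close>, hence square integrable.\<close>

lemma W12_of_derivative:
  assumes T: "open T" and Q: "open Q" "closure T \<subseteq> Q"
    and der: "\<And>t. circ t \<in> Q \<Longrightarrow> ((\<lambda>t. F (circ t)) has_vector_derivative F' t) (at t)"
    and cont: "continuous_on (circ -` Q) F'"
  shows "W12 T F" and "square_integrable_on T (\<lambda>s. F' (circle_angle s))"
proof -
  have Fc: "continuous_on (circ -` Q) (\<lambda>t. F (circ t))"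
    by (intro continuous_at_imp_continuous_on ballI has_vector_derivative_continuous[OF der]) simp
  have sub: "{0..2*pi} \<inter> circ -` closure T \<subseteq> circ -` Q" using Q(2) by auto
  show sq': "square_integrable_on T (\<lambda>s. F' (circle_angle s))"
    by (rule square_integrable_on_of_continuous[OF T continuous_on_subset[OF cont sub]]) (simp only: circle_angle_circ)
  have "square_integrable_on T F"
    by (rule square_integrable_on_of_continuous[OF T continuous_on_subset[OF Fc sub]]) (rule refl)
  moreover have "continuous_on T F"
    by (rule continuous_on_circle[OF T continuous_on_subset[OF Fc]]) (use Q(2) closure_subset[of T] in auto)
  ultimately show "W12 T F"
    unfolding W12_def using sq' weak_derivative_on_of_derivative[OF Q der cont] by blast
qed

lemma sq_norm_le:
  assumes "L2_circle f" "\<And>t. t \<in> {0..<2*pi} \<Longrightarrow> cmod (f (circ t)) \<le> M" "0 \<le> M"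
  shows "sq_norm f \<le> 2 * pi * M\<^sup>2"
proof -
  have "sq_norm f \<le> (LINT t|lborel. indicat_real {0..<2*pi} t * M\<^sup>2)"
    unfolding sq_norm_alt
  proof (rule integral_mono[OF L2_circle_square_integrable[OF assms(1)]])
    show "integrable lborel (\<lambda>t. indicat_real {0..<2*pi} t * M\<^sup>2)"
      by (intro integrable_mult_left integrable_real_indicator) auto
    show "(cmod (indicat_real {0..<2*pi} t *\<^sub>R f (circ t)))\<^sup>2 \<le> indicat_real {0..<2*pi} t * M\<^sup>2" for t
      using assms(2)[of t] by (cases "t \<in> {0..<2*pi}") (auto intro: power_mono)
  qed
  also have "\<dots> = 2 * pi * M\<^sup>2" by simp
  finally show ?thesis .
qed

lemma C1_bound_W12:
  assumes "C1_bound a M"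
  shows "W12 UNIV a" and "W12_norm UNIV a \<le> 4 * M"
proof -
  obtain a' where a: "continuous_on UNIV a'" "\<And>t. ((\<lambda>t. a (circ t)) has_vector_derivative a' t) (at t)"
    "\<And>t. cmod (a (circ t)) \<le> M" "\<And>t. cmod (a' t) \<le> M"
    using assms unfolding C1_bound_def by blast
  let ?u = "\<lambda>s. a' (circle_angle s)"
  show W: "W12 UNIV a" by (rule W12_of_derivative(1)[of UNIV UNIV, OF _ _ _ a(2)]) (use a(1) in auto)
  then have La: "L2_circle a" by (simp add: W12_def L2_circle_def)
  have Lu: "L2_circle ?u"
    unfolding L2_circle_def by (rule W12_of_derivative(2)[of UNIV UNIV, OF _ _ _ a(2)]) (use a(1) in auto)
  have w: "weak_derivative_on UNIV a ?u"
    by (rule weak_derivative_on_of_derivative[of UNIV, OF _ _ a(2)]) (use a(1) in auto)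
  have M: "0 \<le> M" using C1_bound_nonneg[OF assms] .
  have "sq_norm a \<le> 2 * pi * M\<^sup>2" by (rule sq_norm_le[OF La a(3) M])
  moreover have "sq_norm ?u \<le> 2 * pi * M\<^sup>2" by (rule sq_norm_le[OF Lu a(4) M])
  \<comment> \<open>Origin of the factor 4: both squared norms are at most 2 pi M^2, and 4 pi \<le>
    16.\<close>
  moreover have "pi * M\<^sup>2 \<le> 4 * M\<^sup>2" using pi_less_4 by (intro mult_right_mono) auto
  ultimately have "sq_norm a + sq_norm ?u \<le> (4 * M)\<^sup>2" by (simp add: power_mult_distrib)
  then show "W12_norm UNIV a \<le> 4 * M" unfolding W12_norm_eq[OF Lu w] using M by (intro real_le_lsqrt) auto
qed

section \<open>Charts of projective space and of the loop space\<close>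

lemma openin_norm_topologyD:
  assumes "Metric_space (vecs E) (\<lambda>x y. vnorm E (\<lambda>i. x i - y i))" and U: "openin (norm_topology E) U" "x \<in> U"
  shows "\<exists>r>0. \<forall>y\<in>vecs E. vnorm E (\<lambda>i. x i - y i) < r \<longrightarrow> y \<in> U" and "x \<in> vecs E"
proof -
  interpret Metric_space "vecs E" "\<lambda>x y. vnorm E (\<lambda>i. x i - y i)" by fact
  have U': "U \<subseteq> vecs E" "\<exists>r>0. mball x r \<subseteq> U" using U unfolding norm_topology_def openin_mtopology by auto
  show x: "x \<in> vecs E" using U' U(2) by auto
  show "\<exists>r>0. \<forall>y\<in>vecs E. vnorm E (\<lambda>i. x i - y i) < r \<longrightarrow> y \<in> U"
  proof -
    from U'(2) obtain r where r: "0 < r" "mball x r \<subseteq> U" by blast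
    have "y \<in> U" if "y \<in> vecs E" "vnorm E (\<lambda>i. x i - y i) < r" for y
      by (rule subsetD[OF r(2)]) (use x that in simp)
    then show ?thesis using r(1) by blast
  qed
qed

section \<open>Points of projective space and their representatives\<close>

lemma l2_diff:
  assumes "x \<in> vecs l2" "y \<in> vecs l2"
  shows "(\<lambda>j. x j - y j) \<in> vecs l2"
proof -
  have "summable (\<lambda>n. 2 * (cmod (x n))\<^sup>2 + 2 * (cmod (y n))\<^sup>2)"
    using assms by (intro summable_add summable_mult) (auto simp: l2_def)
  then have "summable (\<lambda>n. (cmod (x n - y n))\<^sup>2)"
  proof (rule summable_comparison_test_ev[rotated])
    show "\<forall>\<^sub>F n in sequentially. norm ((cmod (x n - y n))\<^sup>2) \<le> 2 * (cmod (x n))\<^sup>2 + 2 * (cmod (y n))\<^sup>2"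
    proof (rule always_eventually, rule allI)
      fix n
      show "norm ((cmod (x n - y n))\<^sup>2) \<le> 2 * (cmod (x n))\<^sup>2 + 2 * (cmod (y n))\<^sup>2"
        using cmod_add_square_le[of 1 "x n" "- y n"] by simp
    qed
  qed
  then show ?thesis by (simp add: l2_def)
qed

lemma l2_component_le:
  assumes "x \<in> vecs l2"
  shows "cmod (x j) \<le> vnorm l2 x"
proof -
  have "(cmod (x j))\<^sup>2 \<le> (\<Sum>n. (cmod (x n))\<^sup>2)"
    using assms sum_le_suminf[of "\<lambda>n. (cmod (x n))\<^sup>2" "{j}"] by (simp add: l2_def)
  then show ?thesis by (simp add: l2_def real_le_rsqrt)
qed

lemma equiv_proj_rel: "equiv (vecs l2 - {\<lambda>_. 0}) proj_rel"
proof (rule equivI)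
  show "proj_rel \<subseteq> (vecs l2 - {\<lambda>_. 0}) \<times> (vecs l2 - {\<lambda>_. 0})" by (auto simp: proj_rel_def)
  show "refl_on (vecs l2 - {\<lambda>_. 0}) proj_rel"
    by (rule refl_onI) (auto simp: proj_rel_def intro!: exI[of _ 1])
  show "sym proj_rel"
  proof (rule symI)
    fix w w' assume "(w, w') \<in> proj_rel"
    then obtain c where "w \<in> vecs l2 - {\<lambda>_. 0}" "w' \<in> vecs l2 - {\<lambda>_. 0}" "c \<noteq> 0" "w' = (\<lambda>j. c * w j)"
      by (auto simp: proj_rel_def)
    then show "(w', w) \<in> proj_rel" by (auto simp: proj_rel_def intro!: exI[of _ "1 / c"])
  qed
  show "trans proj_rel"
  proof (rule transI)
    fix x y z assume "(x, y) \<in> proj_rel" "(y, z) \<in> proj_rel"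
    then obtain c e where "x \<in> vecs l2 - {\<lambda>_. 0}" "z \<in> vecs l2 - {\<lambda>_. 0}" "c \<noteq> 0" "e \<noteq> 0"
      "y = (\<lambda>j. c * x j)" "z = (\<lambda>j. e * y j)" by (auto simp: proj_rel_def)
    then show "(x, z) \<in> proj_rel" by (auto simp: proj_rel_def mult.assoc intro!: exI[of _ "e * c"])
  qed
qed

text \<open>\<open>topology\<close> is known to return the prescribed open sets only once they form
  a topology. Stability under intersection holds because distinct classes are disjoint.\<close>

lemma topspace_proj_topology: "topspace proj_topology \<subseteq> proj_points"
proof -
  let ?P = "\<lambda>U. U \<subseteq> proj_points \<and> openin (norm_topology l2) (\<Union> U)"
  have Int: "\<Union> (S \<inter> T) = \<Union> S \<inter> \<Union> T" if "S \<subseteq> proj_points" "T \<subseteq> proj_points" for S T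
  proof
    show "\<Union> S \<inter> \<Union> T \<subseteq> \<Union> (S \<inter> T)"
    proof
      fix w assume "w \<in> \<Union> S \<inter> \<Union> T"
      then obtain p q where pq: "p \<in> S" "w \<in> p" "q \<in> T" "w \<in> q" by blast
      then have "p = q"
        using quotient_disj[OF equiv_proj_rel, of p q] that unfolding proj_points_def by blast
      then show "w \<in> \<Union> (S \<inter> T)" using pq by blast
    qed
  qed blast
  have "istopology ?P"
    unfolding istopology_def
  proof (intro conjI allI impI)
    fix S T assume "?P S" "?P T"
    then show "S \<inter> T \<subseteq> proj_points" "openin (norm_topology l2) (\<Union> (S \<inter> T))" by (auto simp: Int openin_Int)
  next
    fix \<K> assume K: "\<forall>K\<in>\<K>. ?P K"
    show "\<Union> \<K> \<subseteq> proj_points" using K by blast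
    have eq: "\<Union> (\<Union> \<K>) = \<Union> ((\<lambda>K. \<Union> K) ` \<K>)" by blast
    show "openin (norm_topology l2) (\<Union> (\<Union> \<K>))" unfolding eq
    proof (rule openin_Union)
      fix S assume "S \<in> (\<lambda>K. \<Union> K) ` \<K>"
      then obtain K where "K \<in> \<K>" "S = \<Union> K" by (rule imageE)
      then show "openin (norm_topology l2) S" using K by simp
    qed
  qed
  then have "openin proj_topology = ?P" unfolding proj_topology_def by (rule topology_inverse')
  then show ?thesis using openin_topspace[of proj_topology] by metis
qed

text \<open>The same choice as in \<open>affine_chart\<close>, so chart values are literally
  quotients of its components.\<close>

definition representative :: "(nat \<Rightarrow> complex) set \<Rightarrow> nat \<Rightarrow> complex" where
  "representative p = (SOME w. w \<in> p)"

lemma representative_in: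
  assumes "p \<in> proj_points"
  shows "representative p \<in> p" and "representative p \<in> vecs l2" and "\<exists>k. representative p k \<noteq> 0"
proof -
  have "p \<noteq> {}" using in_quotient_imp_non_empty[OF equiv_proj_rel] assms unfolding proj_points_def by blast
  then show 1: "representative p \<in> p" unfolding representative_def by (simp add: some_in_eq)
  have "p \<subseteq> vecs l2 - {\<lambda>_. 0}" using in_quotient_imp_subset[OF equiv_proj_rel] assms unfolding proj_points_def by blast
  then have "representative p \<in> vecs l2 - {\<lambda>_. 0}" using 1 by blast
  then show "representative p \<in> vecs l2" "\<exists>k. representative p k \<noteq> 0" by (auto simp: fun_eq_iff)
qed

lemma proj_points_eqI:
  assumes p: "p \<in> proj_points" and q: "q \<in> proj_points"
    and c: "c \<noteq> 0" "\<And>j. representative p j = c * representative q j"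
  shows "p = q"
proof -
  have "(representative q, representative p) \<in> proj_rel"
    unfolding proj_rel_def using c representative_in[OF p] representative_in[OF q] by (auto simp: fun_eq_iff)
  then show ?thesis
    using quotient_eqI[OF equiv_proj_rel, of q p "representative q" "representative p"] representative_in(1)[OF p]
      representative_in(1)[OF q] p q unfolding proj_points_def by simp
qed

lemma affine_chart_cdom:
  assumes p: "p \<in> proj_points"
  shows "p \<in> cdom (affine_chart k) \<longleftrightarrow> representative p k \<noteq> 0"
proof
  assume "p \<in> cdom (affine_chart k)"
  then show "representative p k \<noteq> 0" using representative_in(1)[OF p] by (simp add: affine_chart_def)
next
  assume k: "representative p k \<noteq> 0"
  have "w k \<noteq> 0" if "w \<in> p" for w
  proof -
    have "(representative p, w) \<in> proj_rel"
      using in_quotient_imp_in_rel[OF equiv_proj_rel, of p "representative p" w] p representative_in(1)[OF p] that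
      unfolding proj_points_def by simp
    then show ?thesis using k by (auto simp: proj_rel_def)
  qed
  then show "p \<in> cdom (affine_chart k)" using p by (simp add: affine_chart_def)
qed

lemma affine_chart_cmap:
  "cmap (affine_chart k) p = (\<lambda>j. representative p (if j < k then j else Suc j) / representative p k)"
  by (simp add: affine_chart_def representative_def Let_def)

section \<open>Charts of the loop space centred at constant loops\<close>

text \<open>\<open>Metric_space\<close> demands symmetry of the distance for all functions, also for
  those without a square-integrable weak derivative. For these the derivatives of f and - f are
  chosen from the same empty predicate and agree.\<close>

lemma W12_norm_uminus: "W12_norm UNIV (\<lambda>s. - f s) = W12_norm UNIV f"
proof (cases "\<exists>u. L2_circle u \<and> weak_derivative_on UNIV f u")
  case True
  then obtain u where u: "L2_circle u" "weak_derivative_on UNIV f u" by blast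
  have m: "(\<lambda>s. - h s) = (\<lambda>s. (-1) * h s)" for h :: "circle \<Rightarrow> complex" by simp
  have "sq_norm (\<lambda>s. (-1) * h s) = sq_norm h" for h by (subst sq_norm_cmult) simp
  then show ?thesis
    using W12_norm_eq[OF L2_circle_cmult[OF u(1)] weak_derivative_cmult[OF u(2)], of "-1"] W12_norm_eq[OF u]
    by (simp only: m)
next
  case False
  have neg: "weak_derivative_on UNIV h (\<lambda>s. - u s)" if "weak_derivative_on UNIV (\<lambda>s. - h s) u" for h u
    using weak_derivative_cmult[OF that, of "-1"] by simp
  have negL: "L2_circle (\<lambda>s. - u s)" if "L2_circle u" for u using L2_circle_cmult[OF that, of "-1"] by simp
  have no: "(\<lambda>u. square_integrable_on UNIV u \<and> weak_derivative_on UNIV f u) = (\<lambda>_. False)"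
    using False by (auto simp: fun_eq_iff L2_circle_def)
  have no': "(\<lambda>u. square_integrable_on UNIV u \<and> weak_derivative_on UNIV (\<lambda>s. - f s) u) = (\<lambda>_. False)"
    using False neg negL unfolding fun_eq_iff L2_circle_def by blast
  show ?thesis unfolding W12_norm_def some_weak_derivative_def no no' by simp
qed

text \<open>The two instances, \<open>Aff\<close> and \<open>at_infinity_param\<close>, cover the
  sphere. The derivative 1 at the centre lets sections along the constant loop be treated as
  ordinary functions with the norm \<open>W12_norm UNIV\<close>.\<close>

locale sphere_coordinate =
  fixes \<phi> :: "complex \<Rightarrow> riemann_sphere" and \<alpha> :: "riemann_sphere \<Rightarrow> complex"
  assumes chart: "P1_chart (range \<phi>) \<alpha>"
    and left_inv: "\<alpha> (\<phi> z) = z"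
    and diff0: "chart_diff \<alpha> (\<phi> 0) = 1"
    and open_coord_vimage: "open Y \<Longrightarrow> open (\<phi> -` Y)"
    and holomorphic: "P1_chart Y \<beta> \<Longrightarrow> (\<beta> \<circ> \<phi>) holomorphic_on (\<phi> -` Y)"
begin

lemma right_inv: "x \<in> range \<phi> \<Longrightarrow> \<phi> (\<alpha> x) = x"
  using left_inv by auto

lemma loop_in_W12_loops:
  assumes a: "C1_loop a"
  shows "(\<lambda>s. \<phi> (a s)) \<in> W12_loops"
proof -
  obtain a' where a': "continuous_on UNIV a'" "\<And>t. ((\<lambda>t. a (circ t)) has_vector_derivative a' t) (at t)"
    using a unfolding C1_loop_def C1_bound_def by blast
  have ac: "continuous_on UNIV (\<lambda>t. a (circ t))"
    by (intro continuous_at_imp_continuous_on ballI has_vector_derivative_continuous[OF a'(2)])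
  have op: "open ((\<lambda>s. \<phi> (a s)) -` Y)" if "open Y" for Y
  proof -
    have "open ((\<lambda>t. a (circ t)) -` (\<phi> -` Y))" using ac open_coord_vimage[OF that] by (metis continuous_on_open_vimage open_UNIV Int_UNIV_right)
    moreover have "circ -` ((\<lambda>s. \<phi> (a s)) -` Y) = (\<lambda>t. a (circ t)) -` (\<phi> -` Y)" by auto
    ultimately show ?thesis by (simp add: open_circle_def)
  qed
  then have "continuous_on UNIV (\<lambda>s. \<phi> (a s))" by (simp add: continuous_on_open_vimage)
  moreover have "W12 T (\<beta> \<circ> (\<lambda>s. \<phi> (a s)))"
    if X: "P1_chart X \<beta>" and T: "open T" and sub: "(\<lambda>s. \<phi> (a s)) ` closure T \<subseteq> X" for X \<beta> T
  proof -
    have oX: "open X" using X by (simp add: P1_chart_def)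
    have hol: "(\<beta> \<circ> \<phi>) holomorphic_on (\<phi> -` X)" by (rule holomorphic[OF X])
    have oV: "open (\<phi> -` X)" by (rule open_coord_vimage[OF oX])
    let ?Q = "(\<lambda>s. \<phi> (a s)) -` X"
    show ?thesis
    proof (rule W12_of_derivative(1)[OF T op[OF oX]])
      show "closure T \<subseteq> ?Q" using sub by auto
      show "((\<lambda>t. (\<beta> \<circ> (\<lambda>s. \<phi> (a s))) (circ t)) has_vector_derivative a' t * deriv (\<beta> \<circ> \<phi>) (a (circ t))) (at t)"
        if "circ t \<in> ?Q" for t
      proof -
        have "((\<beta> \<circ> \<phi>) has_field_derivative deriv (\<beta> \<circ> \<phi>) (a (circ t))) (at (a (circ t)))"
          by (rule holomorphic_derivI[OF hol oV]) (use that in simp)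
        from field_vector_diff_chain_at[OF a'(2) this] show ?thesis by (simp add: o_def)
      qed
      have "continuous_on (\<phi> -` X) (deriv (\<beta> \<circ> \<phi>))"
        by (intro holomorphic_on_imp_continuous_on holomorphic_deriv hol oV)
      then have "continuous_on (circ -` ?Q) (\<lambda>t. deriv (\<beta> \<circ> \<phi>) (a (circ t)))"
        by (rule continuous_on_compose2[OF _ continuous_on_subset[OF ac subset_UNIV]]) auto
      then show "continuous_on (circ -` ?Q) (\<lambda>t. a' t * deriv (\<beta> \<circ> \<phi>) (a (circ t)))"
        by (intro continuous_on_mult continuous_on_subset[OF a'(1) subset_UNIV])
    qed
  qed
  ultimately show ?thesis unfolding W12_loops_def by blast
qed

abbreviation base where "base \<equiv> (\<lambda>_::circle. \<phi> 0)"

definition sections :: "circle model_space" where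
  "sections = W12_sections base 1 (\<lambda>_. UNIV) (\<lambda>_. \<alpha>)"

lemma vnorm_sections: "vnorm sections \<xi> = W12_norm UNIV \<xi>"
  using W12_norm_nonneg[of \<xi>] by (simp add: sections_def W12_sections_def diff0)

lemma vecs_sections_W12: "\<xi> \<in> vecs sections \<Longrightarrow> W12 UNIV \<xi>"
proof -
  assume "\<xi> \<in> vecs sections"
  then have *: "\<forall>X \<beta> T. P1_chart X \<beta> \<and> open T \<and> base ` closure T \<subseteq> X \<longrightarrow> W12 T (\<lambda>s. chart_diff \<beta> (base s) * \<xi> s)"
    unfolding sections_def W12_sections_def by simp
  have "W12 UNIV (\<lambda>s. chart_diff \<alpha> (base s) * \<xi> s)"
    by (rule *[rule_format, of "range \<phi>"]) (use chart in auto)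
  then show ?thesis by (simp add: diff0)
qed

lemma C1_loop_in_sections:
  assumes "C1_loop a"
  shows "a \<in> vecs sections"
proof -
  have "W12 T (\<lambda>s. chart_diff \<beta> (base s) * a s)" if "open T" for T \<beta>
  proof -
    have "C1_loop (\<lambda>s. chart_diff \<beta> (base s) * a s)" by (rule C1_loop_cmult[OF assms])
    then obtain F' where F: "continuous_on UNIV F'" "\<And>t. ((\<lambda>t. chart_diff \<beta> (base (circ t)) * a (circ t)) has_vector_derivative F' t) (at t)"
      unfolding C1_loop_def C1_bound_def by blast
    show ?thesis by (rule W12_of_derivative(1)[OF that open_UNIV subset_UNIV F(2)]) (use F(1) in simp)
  qed
  then show ?thesis unfolding sections_def W12_sections_def by simp
qed

lemma Metric_space_sections: "Metric_space (vecs sections) (\<lambda>x y. vnorm sections (\<lambda>i. x i - y i))"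
proof
  have diff: "W12 UNIV (\<lambda>i. x i - y i)" if "x \<in> vecs sections" "y \<in> vecs sections" for x y
    using W12_circle_add[OF vecs_sections_W12[OF that(1)] W12_circle_cmult[OF vecs_sections_W12[OF that(2)], of "-1"]] by simp
  show "0 \<le> vnorm sections (\<lambda>i. x i - y i)" for x y by (simp add: vnorm_sections W12_norm_nonneg)
  show "vnorm sections (\<lambda>i. x i - y i) = vnorm sections (\<lambda>i. y i - x i)" for x y
    unfolding vnorm_sections using W12_norm_uminus[of "\<lambda>i. x i - y i"] by simp
  show "(vnorm sections (\<lambda>i. x i - y i) = 0) = (x = y)" if "x \<in> vecs sections" "y \<in> vecs sections" for x y
    unfolding vnorm_sections W12_norm_eq_0_iff[OF diff[OF that]] by (auto simp: fun_eq_iff)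
  show "vnorm sections (\<lambda>i. x i - z i) \<le> vnorm sections (\<lambda>i. x i - y i) + vnorm sections (\<lambda>i. y i - z i)"
    if "x \<in> vecs sections" "y \<in> vecs sections" "z \<in> vecs sections" for x y z
    unfolding vnorm_sections using W12_norm_triangle[OF diff[OF that(1,2)] diff[OF that(2,3)]] by simp
qed

lemma P1_chart_continuous:
  assumes "P1_chart X \<beta>"
  shows "continuous_on X \<beta>"
proof -
  have X: "open X" using assms by (simp add: P1_chart_def)
  have "open (\<beta> -` B \<inter> X)" if B: "open B" for B
  proof -
    have op: "open ((\<beta> \<circ> \<psi>) -` B \<inter> \<psi> -` X)"
      if "(\<beta> \<circ> \<psi>) holomorphic_on \<psi> -` X" "open (\<psi> -` X)" for \<psi> :: "complex \<Rightarrow> riemann_sphere"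
      using holomorphic_on_imp_continuous_on[OF that(1)] continuous_on_open_vimage[OF that(2)] B by blast
    have "open ((\<beta> \<circ> Aff) -` B \<inter> Aff -` X)" "open ((\<beta> \<circ> at_infinity_param) -` B \<inter> at_infinity_param -` X)"
      using assms X by (auto intro!: op simp: P1_chart_def open_riemann_sphere_def)
    then show ?thesis by (simp add: open_riemann_sphere_def vimage_comp)
  qed
  then show ?thesis unfolding continuous_on_open_vimage[OF X] by blast
qed

text \<open>Along a constant loop every chart acts on the fibres by one constant factor, so the
  bundle is a product; the factor 1 of \<open>\<alpha>\<close> shows that there are no further open
  sets.\<close>

lemma pullback_bundle_topology_base: "pullback_bundle_topology base = euclidean"
proof -
  have "(\<forall>X \<beta>. P1_chart X \<beta> \<longrightarrow> open {(s, w). base s \<in> X \<and> (s, w / chart_diff \<beta> (base s)) \<in> W}) \<longleftrightarrow> open W"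
    (is "?P W \<longleftrightarrow> _") for W :: "(circle \<times> complex) set"
  proof
    assume *: "?P W"
    have "open {(s, w). base s \<in> range \<phi> \<and> (s, w / chart_diff \<alpha> (base s)) \<in> W}"
      using * chart by blast
    then show "open W" by (simp add: diff0)
  next
    assume W: "open W"
    show "?P W"
    proof (intro allI impI)
      fix X \<beta>
      let ?f = "\<lambda>p::circle \<times> complex. (fst p, snd p * inverse (chart_diff \<beta> (\<phi> 0)))"
      have "open (?f -` W)"
        by (rule open_vimage[OF W]) (intro continuous_intros)
      moreover have "{(s, w). base s \<in> X \<and> (s, w / chart_diff \<beta> (base s)) \<in> W} = (if \<phi> 0 \<in> X then ?f -` W else {})"
        by (auto simp: divide_inverse)
      ultimately show "open {(s, w). base s \<in> X \<and> (s, w / chart_diff \<beta> (base s)) \<in> W}" by simp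
    qed
  qed
  then have "pullback_bundle_topology base = topology open"
    unfolding pullback_bundle_topology_def by (simp only: )
  then show ?thesis by simp
qed

text \<open>The one-set cover and the constant partition of unity 1 reduce \<open>loop_G\<close> to
  \<open>\<alpha>\<close>; the domain consists of all Sobolev loops in the image of
  \<open>\<phi>\<close>.\<close>

definition loop_chart :: "(circle \<Rightarrow> riemann_sphere, circle) chart" where
  "loop_chart = \<lparr>cdom = {h \<in> W12_loops. \<forall>s. (s, h s) \<in> UNIV \<times> range \<phi>},
     cmap = (\<lambda>h s. loop_G base 1 (\<lambda>_. \<alpha>) (\<lambda>_ _. 1) s (h s)), cspace = W12_sections base 1 (\<lambda>_. UNIV) (\<lambda>_. \<alpha>)\<rparr>"

lemma loop_G_eq: "loop_G base 1 (\<lambda>_. \<alpha>) (\<lambda>_ _. 1) s x = \<alpha> x"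
  by (simp add: loop_G_def diff0 left_inv)

lemma base_loop: "base \<in> W12_loops"
  using loop_in_W12_loops[OF C1_loop_const[of 0]] .

lemma adapted_cover_base: "adapted_cover base 1 (\<lambda>_. UNIV) (\<lambda>_. range \<phi>) (\<lambda>_. \<alpha>)"
  using chart by (auto simp: adapted_cover_def)

lemma loop_chart_in_atlas: "loop_chart \<in> loop_charts"
proof -
  have sm: "smooth_partition 1 (\<lambda>_. UNIV) (\<lambda>_ _. 1)"
  proof -
    have "smooth_circle (\<lambda>_. 1)"
      using smooth_circle_real_polynomial[OF real_polynomial_function.intros(2)[of 1]] .
    then show ?thesis by (simp add: smooth_partition_def)
  qed
  let ?U = "UNIV \<times> range \<phi> :: (circle \<times> riemann_sphere) set"
  let ?G = "\<lambda>(s, x). (s, loop_G base 1 (\<lambda>_. \<alpha>) (\<lambda>_ _. 1) s x)"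
  have oR: "open (range \<phi>)" using chart by (simp add: P1_chart_def)
  have G: "?G = (\<lambda>p. (fst p, \<alpha> (snd p)))" by (simp only: loop_G_eq case_prod_unfold)
  have img: "?G ` ?U = UNIV"
  proof -
    have "(s, z) \<in> ?G ` ?U" for s z
      by (rule image_eqI[of _ _ "(s, \<phi> z)"]) (auto simp: left_inv loop_G_eq[unfolded One_nat_def])
    then show ?thesis by auto
  qed
  have hom: "homeomorphic_map (top_of_set ?U) (subtopology (pullback_bundle_topology base) (?G ` ?U)) ?G"
    unfolding img pullback_bundle_topology_base subtopology_UNIV homeomorphic_map_maps
  proof (intro exI[of _ "\<lambda>p. (fst p, \<phi> (snd p))"])
    have phi: "continuous_on UNIV \<phi>"
      using open_coord_vimage by (simp add: continuous_on_open_vimage)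
    have "continuous_on ?U (\<lambda>p. (fst p, \<alpha> (snd p)))"
      by (intro continuous_on_Pair continuous_on_fst continuous_on_id
          continuous_on_compose2[OF P1_chart_continuous[OF chart] continuous_on_snd[OF continuous_on_id]]) auto
    moreover have "continuous_on UNIV (\<lambda>p::circle \<times> complex. (fst p, \<phi> (snd p)))"
      by (intro continuous_on_Pair continuous_on_fst continuous_on_id
          continuous_on_compose2[OF phi continuous_on_snd[OF continuous_on_id]]) auto
    ultimately show "homeomorphic_maps (top_of_set ?U) euclidean ?G (\<lambda>p. (fst p, \<phi> (snd p)))"
      unfolding homeomorphic_maps_def G by (auto simp: left_inv continuous_map_in_subtopology)
  qed
  have fibre: "P1_chart {x. (s, x) \<in> ?U} (loop_G base 1 (\<lambda>_. \<alpha>) (\<lambda>_ _. 1) s)" for s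
  proof -
    have "loop_G base 1 (\<lambda>_. \<alpha>) (\<lambda>_ _. 1) s = \<alpha>" by (rule ext) (rule loop_G_eq)
    then show ?thesis using chart by simp
  qed
  have adm: "admissible_nbhd base 1 (\<lambda>_. range \<phi>) (\<lambda>_. \<alpha>) (\<lambda>_ _. 1) ?U"
    unfolding admissible_nbhd_def Let_def
  proof (intro conjI)
    show "open ?U" by (intro open_Times open_UNIV oR)
    show "\<forall>s. P1_chart {x. (s, x) \<in> ?U} (loop_G base 1 (\<lambda>_. \<alpha>) (\<lambda>_ _. 1) s)" using fibre by blast
    show "openin (pullback_bundle_topology base) (?G ` ?U)" unfolding img pullback_bundle_topology_base by simp
  qed (use hom in auto)
  show ?thesis
    unfolding loop_charts_def loop_chart_def mem_Collect_eq
    by (intro exI[of _ base] exI[of _ 1] exI[of _ "\<lambda>_. UNIV"] exI[of _ "\<lambda>_. range \<phi>"] exI[of _ "\<lambda>_. \<alpha>"]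
        exI[of _ "\<lambda>_ _. 1"] exI[of _ ?U] conjI refl base_loop adapted_cover_base sm adm)
qed

lemma loop_in_topspace:
  assumes "C1_loop a"
  shows "(\<lambda>s. \<phi> (a s)) \<in> topspace sobolev_topology"
proof -
  \<comment> \<open>A radius larger than the Sobolev distance to the base loop: the topology is
    generated by neighbourhoods, so one of them has to contain the given loop.\<close>
  let ?e = "W12_norm UNIV (\<lambda>s. \<alpha> (\<phi> (a s)) - \<alpha> (\<phi> 0)) + 1"
  have "(\<lambda>s. \<phi> (a s)) \<in> sobolev_nbhd base 1 (\<lambda>_. UNIV) (\<lambda>_. range \<phi>) (\<lambda>_. \<alpha>) ?e"
    using loop_in_W12_loops[OF assms] by (simp add: sobolev_nbhd_def image_subset_iff)
  moreover have "0 < ?e" using W12_norm_nonneg by (simp add: add_nonneg_pos)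
  ultimately show ?thesis
    unfolding sobolev_topology_def topology_generated_by_topspace using base_loop adapted_cover_base by blast
qed

end

definition affine_coordinate :: "riemann_sphere \<Rightarrow> complex" where
  "affine_coordinate p = (case p of Aff z \<Rightarrow> z | Infinity \<Rightarrow> 0)"

definition infinity_coordinate :: "riemann_sphere \<Rightarrow> complex" where
  "infinity_coordinate p = (case p of Aff z \<Rightarrow> 1 / z | Infinity \<Rightarrow> 0)"

lemma range_Aff: "range Aff = - {Infinity}"
  by (auto simp: image_iff) (metis riemann_sphere.exhaust)

lemma range_at_infinity: "range at_infinity_param = - {Aff 0}"
proof -
  have "Aff z \<in> range at_infinity_param" if "z \<noteq> 0" for z
    using that by (intro image_eqI[of _ _ "1 / z"]) (auto simp: at_infinity_param_def)
  moreover have "Infinity \<in> range at_infinity_param" by (intro image_eqI[of _ _ 0]) (auto simp: at_infinity_param_def)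
  ultimately have "x \<in> range at_infinity_param" if "x \<noteq> Aff 0" for x using that by (cases x) auto
  then show ?thesis by (auto simp: at_infinity_param_def split: if_splits)
qed

interpretation affine: sphere_coordinate Aff affine_coordinate
proof
  have 1: "affine_coordinate \<circ> Aff = (\<lambda>z. z)" by (auto simp: affine_coordinate_def)
  have 2: "at_infinity_param -` range Aff = - {0}" by (auto simp: range_Aff at_infinity_param_def)
  have "(\<lambda>w. 1 / w) holomorphic_on - {0::complex}" by (intro holomorphic_intros) auto
  then have 3: "(affine_coordinate \<circ> at_infinity_param) holomorphic_on - {0}"
    by (rule holomorphic_transform) (simp add: affine_coordinate_def at_infinity_param_def)
  have UU: "Aff -` range Aff = UNIV" by auto
  have "open (range Aff)" unfolding open_riemann_sphere_def 2 UU by (simp add: open_Compl)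
  moreover have "inj_on affine_coordinate (range Aff)" by (auto simp: inj_on_def affine_coordinate_def)
  ultimately show "P1_chart (range Aff) affine_coordinate"
    unfolding P1_chart_def 1 2 using 3 by (auto intro: holomorphic_on_ident)
  show "chart_diff affine_coordinate (Aff 0) = 1" by (simp add: chart_diff_def 1)
qed (auto simp: affine_coordinate_def open_riemann_sphere_def P1_chart_def)

interpretation infinity: sphere_coordinate at_infinity_param infinity_coordinate
proof
  have 1: "infinity_coordinate \<circ> at_infinity_param = (\<lambda>z. z)" by (auto simp: infinity_coordinate_def at_infinity_param_def)
  have 2: "Aff -` range at_infinity_param = - {0}" by (auto simp: range_at_infinity)
  have 3: "(infinity_coordinate \<circ> Aff) holomorphic_on - {0}"
    unfolding o_def infinity_coordinate_def by (auto intro!: holomorphic_intros)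
  have UU: "at_infinity_param -` range at_infinity_param = UNIV" by auto
  have "open (range at_infinity_param)" unfolding open_riemann_sphere_def 2 UU by (simp add: open_Compl)
  moreover have "inj_on infinity_coordinate (range at_infinity_param)"
    by (rule inj_on_imageI) (simp add: 1)
  ultimately show "P1_chart (range at_infinity_param) infinity_coordinate"
    unfolding P1_chart_def 1 2 using 3 by (auto intro: holomorphic_on_ident)
  show "infinity_coordinate (at_infinity_param z) = z" for z using fun_cong[OF 1, of z] by simp
  have "at_infinity_param 0 = Infinity" by (simp add: at_infinity_param_def)
  then show "chart_diff infinity_coordinate (at_infinity_param 0) = 1" by (simp add: chart_diff_def 1)
qed (auto simp: open_riemann_sphere_def P1_chart_def)

section \<open>Holomorphic maps from the loop space to projective space\<close>

definition loop_image :: "(complex \<Rightarrow> riemann_sphere) \<Rightarrow> ((circle \<Rightarrow> riemann_sphere) \<Rightarrow> (nat \<Rightarrow> complex) set) \<Rightarrow>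
    (circle \<Rightarrow> complex) \<Rightarrow> nat \<Rightarrow> complex" where
  "loop_image \<phi> f b = representative (f (\<lambda>s. \<phi> (b s)))"

section \<open>From holomorphic maps in charts to homogeneous coordinates\<close>

text \<open>Let coordinate \<open>k\<close> be nonzero at \<open>a\<close>. The scalar 1 / ?w b k
  turns the homogeneous coordinates into those of \<open>affine_chart k\<close>, with a 1 inserted
  at \<open>k\<close>. The Frechet derivative in charts bounds all components at once, which gives
  continuity uniform in \<open>j\<close>; restricted to complex lines it gives
  differentiability.\<close>

lemma projective_loop_map_regular:
  assumes coord: "sphere_coordinate \<phi> \<alpha>"
    and f: "holomorphic_map loop_space_P1 proj_l2 (topspace (mtop loop_space_P1)) f"
    and fp: "\<And>p. p \<in> topspace (mtop loop_space_P1) \<Longrightarrow> f p \<in> proj_points"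
    and a: "C1_loop a"
  shows "projectively_regular (loop_image \<phi> f) a"
proof -
  interpret sphere_coordinate \<phi> \<alpha> by fact
  let ?w = "loop_image \<phi> f"
  let ?D = "topspace (mtop loop_space_P1)"
  have in_D: "(\<lambda>s. \<phi> (b s)) \<in> ?D" if "C1_loop b" for b
    using loop_in_topspace[OF that] by (simp add: loop_space_P1_def)
  have in_proj: "f (\<lambda>s. \<phi> (b s)) \<in> proj_points" if "C1_loop b" for b by (intro fp in_D that)
  obtain k where k: "?w a k \<noteq> 0" using representative_in(3)[OF in_proj[OF a]] by (auto simp: loop_image_def)
  define U where "U = cmap loop_chart ` {p \<in> ?D \<inter> cdom loop_chart. f p \<in> cdom (affine_chart k)}"
  define F where "F = cmap (affine_chart k) \<circ> f \<circ> chart_inv loop_chart"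
  have "holomorphic_between (cspace loop_chart) (cspace (affine_chart k)) U F"
    using f loop_chart_in_atlas unfolding holomorphic_map_def U_def F_def
    by (simp add: loop_space_P1_def proj_l2_def)
  then have hol: "holomorphic_between sections l2 U F" by (simp add: loop_chart_def sections_def affine_chart_def)
  have cmap: "cmap loop_chart (\<lambda>s. \<phi> (b s)) = b" for b
    by (simp add: loop_chart_def loop_G_eq[unfolded One_nat_def] left_inv)
  have cdom: "(\<lambda>s. \<phi> (b s)) \<in> cdom loop_chart" if "C1_loop b" for b
    using loop_in_W12_loops[OF that] by (simp add: loop_chart_def)
  have inj: "h = (\<lambda>s. \<phi> (cmap loop_chart h s))" if "h \<in> cdom loop_chart" for h
    using that by (auto simp: loop_chart_def loop_G_eq[unfolded One_nat_def] right_inv)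
  have inv: "chart_inv loop_chart b = (\<lambda>s. \<phi> (b s))" if "C1_loop b" for b
  proof -
    have "inj_on (cmap loop_chart) (cdom loop_chart)"
    proof (rule inj_onI)
      fix h h' assume h: "h \<in> cdom loop_chart" "h' \<in> cdom loop_chart" "cmap loop_chart h = cmap loop_chart h'"
      have "h = (\<lambda>s. \<phi> (cmap loop_chart h s))" by (rule inj[OF h(1)])
      also have "\<dots> = h'" unfolding h(3) by (rule inj[OF h(2), symmetric])
      finally show "h = h'" .
    qed
    from inv_into_f_f[OF this cdom[OF that]] show ?thesis by (simp only: cmap chart_inv_def)
  qed
  have F_eq: "F b = (\<lambda>j. ?w b (if j < k then j else Suc j) / ?w b k)" if "C1_loop b" for b
    by (simp add: F_def inv[OF that] affine_chart_cmap loop_image_def)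
  have U_iff: "b \<in> U \<longleftrightarrow> ?w b k \<noteq> 0" if b: "C1_loop b" for b
  proof
    assume "b \<in> U"
    then obtain p where p: "p \<in> cdom loop_chart" "f p \<in> cdom (affine_chart k)" "b = cmap loop_chart p" unfolding U_def by blast
    then have "p = (\<lambda>s. \<phi> (b s))" using inj by simp
    then show "?w b k \<noteq> 0" using p(2) affine_chart_cdom[OF in_proj[OF b]] by (simp add: loop_image_def)
  next
    assume "?w b k \<noteq> 0"
    then have "f (\<lambda>s. \<phi> (b s)) \<in> cdom (affine_chart k)"
      using affine_chart_cdom[OF in_proj[OF b]] by (simp add: loop_image_def)
    then show "b \<in> U" unfolding U_def using cmap[of b] in_D[OF b] cdom[OF b] by force
  qed
  have aU: "a \<in> U" using U_iff[OF a] k by simp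
  have opU: "openin (norm_topology sections) U" and FU: "F ` U \<subseteq> vecs l2"
    using hol unfolding holomorphic_between_def by blast+
  obtain A where "has_cderiv sections l2 F A a" using hol aU unfolding holomorphic_between_def by blast
  then have lin: "bounded_clinear_on sections l2 A"
    and der: "\<forall>e>0. \<exists>d>0. \<forall>y\<in>vecs sections. vnorm sections (\<lambda>i. y i - a i) < d \<longrightarrow>
        vnorm l2 (\<lambda>j. F y j - F a j - A (\<lambda>i. y i - a i) j) \<le> e * vnorm sections (\<lambda>i. y i - a i)"
    unfolding has_cderiv_def by (rule conjunct1, rule conjunct2)
  obtain C where C: "\<forall>x\<in>vecs sections. vnorm l2 (A x) \<le> C * vnorm sections x"
    using lin unfolding bounded_clinear_on_def by blast
  have Al2: "A x \<in> vecs l2" if "x \<in> vecs sections" for x using lin that unfolding bounded_clinear_on_def by blast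
  have Acm: "A (\<lambda>i. c * x i) = (\<lambda>j. c * A x j)" if "x \<in> vecs sections" for c x
    using lin that unfolding bounded_clinear_on_def by blast
  obtain r where r: "0 < r" "\<forall>y\<in>vecs sections. vnorm sections (\<lambda>i. a i - y i) < r \<longrightarrow> y \<in> U"
    using openin_norm_topologyD(1)[OF Metric_space_sections opU aU] by blast
  have near: "y \<in> U" if "C1_loop y" "vnorm sections (\<lambda>i. y i - a i) < r" for y
  proof -
    have "vnorm sections (\<lambda>i. a i - y i) = vnorm sections (\<lambda>i. y i - a i)"
      unfolding vnorm_sections using W12_norm_uminus[of "\<lambda>i. y i - a i"] by simp
    then show ?thesis using r(2) that C1_loop_in_sections[OF that(1)] by simp
  qed
  have C1: "C1_loop b" if "C1_bound (\<lambda>s. b s - a s) e" for b e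
    using C1_loop_add[OF a C1_loopI[OF that]] by simp
  have small: "vnorm sections (\<lambda>i. b i - a i) \<le> 4 * e" if "C1_bound (\<lambda>s. b s - a s) e" for b e
    unfolding vnorm_sections by (rule C1_bound_W12(2)[OF that])
  \<comment> \<open>The inverse of the renumbering by which \<open>affine_chart\<close> skips the
    index \<open>k\<close>.\<close>
  define \<tau> where "\<tau> = (\<lambda>j::nat. if j < k then j else j - 1)"
  have ratio: "?w b j / ?w b k = F b (\<tau> j)" if "C1_loop b" "j \<noteq> k" for b j
    using that by (auto simp: F_eq \<tau>_def)
  have comp: "cmod (F b j - F a j - A (\<lambda>i. b i - a i) j) \<le> vnorm l2 (\<lambda>j. F b j - F a j - A (\<lambda>i. b i - a i) j)"
    if "b \<in> U" "C1_loop b" for b j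
  proof (rule l2_component_le)
    have "C1_loop (\<lambda>i. b i - a i)" using C1_loop_add[OF that(2) C1_loop_cmult[OF a, of "-1"]] by simp
    then show "(\<lambda>j. F b j - F a j - A (\<lambda>i. b i - a i) j) \<in> vecs l2"
      using FU that aU by (intro l2_diff Al2 C1_loop_in_sections) auto
  qed
  show ?thesis
    unfolding projectively_regular_def
  proof (intro exI[of _ "\<lambda>b. 1 / ?w b k"] conjI allI impI)
    show "\<exists>e>0. \<forall>b. C1_bound (\<lambda>s. b s - a s) e \<longrightarrow> 1 / ?w b k \<noteq> 0"
    \<comment> \<open>The Sobolev norm is at most 4 times the C^1 bound, so r / 8 leads to r / 2 <
      r.\<close>
    proof (intro exI[of _ "r / 8"] conjI allI impI)
      fix b assume b: "C1_bound (\<lambda>s. b s - a s) (r / 8)"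
      have "b \<in> U" by (rule near[OF C1[OF b]]) (use small[OF b] r in simp)
      then show "1 / ?w b k \<noteq> 0" using U_iff[OF C1[OF b]] by simp
    qed (use r in simp)
  next
    fix \<epsilon> :: real assume eps: "0 < \<epsilon>"
    obtain \<delta> where d: "0 < \<delta>" "\<forall>y\<in>vecs sections. vnorm sections (\<lambda>i. y i - a i) < \<delta> \<longrightarrow>
        vnorm l2 (\<lambda>j. F y j - F a j - A (\<lambda>i. y i - a i) j) \<le> 1 * vnorm sections (\<lambda>i. y i - a i)"
      using der zero_less_one by blast
    \<comment> \<open>The increment of \<open>F\<close> is at most 1 + |C| times the Sobolev
      distance, which is at most 4 e; the last entry makes this at most \<epsilon> / 2.\<close>
    define e where "e = min (min (r / 8) (\<delta> / 8)) (\<epsilon> / (8 * (1 + \<bar>C\<bar>)))"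
    have "0 < \<epsilon> / (8 * (1 + \<bar>C\<bar>))" using eps by (intro divide_pos_pos) auto
    then have e: "0 < e" "e \<le> r / 8" "e \<le> \<delta> / 8" "e \<le> \<epsilon> / (8 * (1 + \<bar>C\<bar>))"
      unfolding e_def using r(1) d(1) by linarith+
    show "\<exists>e>0. \<forall>b. C1_bound (\<lambda>s. b s - a s) e \<longrightarrow> (\<forall>j. cmod (1 / ?w b k * ?w b j - 1 / ?w a k * ?w a j) < \<epsilon>)"
    proof (intro exI[of _ e] conjI allI impI e(1))
      fix b j assume b: "C1_bound (\<lambda>s. b s - a s) e"
      let ?n = "vnorm sections (\<lambda>i. b i - a i)"
      have n: "?n \<le> 4 * e" by (rule small[OF b])
      have bU: "b \<in> U" by (rule near[OF C1[OF b]]) (use n e r in simp)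
      have wb: "?w b k \<noteq> 0" using U_iff[OF C1[OF b]] bU by simp
      show "cmod (1 / ?w b k * ?w b j - 1 / ?w a k * ?w a j) < \<epsilon>"
      proof (cases "j = k")
        case True
        then show ?thesis using wb k eps by simp
      next
        case False
        let ?x = "\<lambda>i. b i - a i"
        have xs: "?x \<in> vecs sections" by (rule C1_loop_in_sections[OF C1_loopI[OF b]])
        have "vnorm l2 (\<lambda>j. F b j - F a j - A ?x j) \<le> 1 * ?n"
          using d(2) C1_loop_in_sections[OF C1[OF b]] n e d(1) by auto
        then have 1: "cmod (F b (\<tau> j) - F a (\<tau> j) - A ?x (\<tau> j)) \<le> ?n"
          using comp[OF bU C1[OF b], of "\<tau> j"] by linarith
        have "cmod (A ?x (\<tau> j)) \<le> C * ?n" using l2_component_le[OF Al2[OF xs], of "\<tau> j"] C xs by fastforce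
        also have "\<dots> \<le> \<bar>C\<bar> * ?n" by (intro mult_right_mono) (auto simp: vnorm_sections W12_norm_nonneg)
        finally have 2: "cmod (A ?x (\<tau> j)) \<le> \<bar>C\<bar> * ?n" .
        have "cmod (F b (\<tau> j) - F a (\<tau> j)) \<le> (1 + \<bar>C\<bar>) * ?n"
          using norm_triangle_ineq[of "F b (\<tau> j) - F a (\<tau> j) - A ?x (\<tau> j)" "A ?x (\<tau> j)"] 1 2
          by (simp add: distrib_right)
        also have "\<dots> \<le> (1 + \<bar>C\<bar>) * (4 * e)" using n by (intro mult_left_mono) auto
        also have "\<dots> \<le> (1 + \<bar>C\<bar>) * (4 * (\<epsilon> / (8 * (1 + \<bar>C\<bar>))))" using e(4) by (intro mult_left_mono) auto
        also have "\<dots> = \<epsilon> / 2"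
        proof -
          have "1 + \<bar>C\<bar> \<noteq> 0" by linarith
          then show ?thesis by (simp add: field_simps)
        qed
        finally show ?thesis using eps ratio[OF C1[OF b] False] ratio[OF a False] by simp
      qed
    qed
  next
    fix j b assume b: "C1_loop b"
    let ?c = "\<lambda>t s. a s + t * b s"
    have ab: "C1_loop (?c t)" for t by (intro C1_loop_intros a b)
    define N where "N = vnorm sections b"
    have N0: "0 \<le> N" by (simp add: N_def vnorm_sections W12_norm_nonneg)
    have bs: "b \<in> vecs sections" by (rule C1_loop_in_sections[OF b])
    have nc: "vnorm sections (\<lambda>i. ?c t i - a i) = cmod t * N" for t
      using W12_norm_cmult[OF vecs_sections_W12[OF bs], of t] by (simp add: N_def vnorm_sections)
    have cU: "?c t \<in> U" if "cmod t < r / (N + 1)" for t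
    proof (rule near[OF ab])
      have "cmod t * (N + 1) < r" using that N0 by (simp add: pos_less_divide_eq)
      moreover have "cmod t * N \<le> cmod t * (N + 1)" by (intro mult_left_mono) auto
      ultimately show "vnorm sections (\<lambda>i. ?c t i - a i) < r" unfolding nc by linarith
    qed
    have rN: "0 < r / (N + 1)" using r N0 by simp
    show "(\<lambda>t. 1 / ?w (?c t) k * ?w (?c t) j) field_differentiable at 0"
    proof (cases "j = k")
      case True
      have "((\<lambda>t. 1 / ?w (?c t) k * ?w (?c t) j) has_field_derivative 0) (at 0)"
      proof (rule has_field_derivative_transform_within[OF DERIV_const rN])
        fix t :: complex assume "dist t 0 < r / (N + 1)"
        then have "?c t \<in> U" by (intro cU) simp
        then show "1 = 1 / ?w (?c t) k * ?w (?c t) j" using True U_iff[OF ab] by simp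
      qed simp
      then show ?thesis by (auto simp: field_differentiable_def)
    next
      case False
      \<comment> \<open>Along the line the increment of the argument is h b, so complex linearity
        pulls h out of the Frechet derivative. The remainder is at most e N |h|, and
        \<open>e\<close> is chosen to make e N smaller than \<epsilon>.\<close>
      have "((\<lambda>t. F (?c t) (\<tau> j)) has_field_derivative A b (\<tau> j)) (at 0)"
        unfolding DERIV_def
      proof (rule LIM_I)
        fix \<epsilon> :: real assume eps: "0 < \<epsilon>"
        define e where "e = \<epsilon> / (2 * (N + 1))"
        have e: "0 < e" using eps N0 by (simp add: e_def)
        obtain \<delta> where d: "0 < \<delta>" "\<forall>y\<in>vecs sections. vnorm sections (\<lambda>i. y i - a i) < \<delta> \<longrightarrow>
            vnorm l2 (\<lambda>j. F y j - F a j - A (\<lambda>i. y i - a i) j) \<le> e * vnorm sections (\<lambda>i. y i - a i)"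
          using der e by blast
        have "cmod ((F (?c (0 + h)) (\<tau> j) - F (?c 0) (\<tau> j)) / h - A b (\<tau> j)) < \<epsilon>"
          if h: "h \<noteq> 0" "cmod h < min (\<delta> / (N + 1)) (r / (N + 1))" for h
        proof -
          have "cmod h * (N + 1) < \<delta>" using h N0 by (simp add: pos_less_divide_eq)
          moreover have "cmod h * N \<le> cmod h * (N + 1)" by (intro mult_left_mono) auto
          ultimately have hd: "vnorm sections (\<lambda>i. ?c h i - a i) < \<delta>" unfolding nc by linarith
          have hU: "?c h \<in> U" using h by (intro cU) simp
          have "cmod (F (?c h) (\<tau> j) - F a (\<tau> j) - A (\<lambda>i. ?c h i - a i) (\<tau> j)) \<le> e * vnorm sections (\<lambda>i. ?c h i - a i)"
            using comp[OF hU ab, of "\<tau> j"] d(2) hd C1_loop_in_sections[OF ab] by (meson order.trans)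
          also have "\<dots> = e * (cmod h * N)" unfolding nc ..
          also have "e * (cmod h * N) \<le> e * (cmod h * (N + 1))" using e by (intro mult_left_mono) auto
          also have "\<dots> = \<epsilon> / 2 * cmod h" using N0 by (simp add: e_def field_simps)
          also have "\<dots> < \<epsilon> * cmod h" using eps h by simp
          also have "(\<lambda>i. ?c h i - a i) = (\<lambda>i. h * b i)" by simp
          finally have lt: "cmod (F (?c h) (\<tau> j) - F a (\<tau> j) - h * A b (\<tau> j)) < \<epsilon> * cmod h" by (simp add: Acm[OF bs])
          have "(F (?c (0 + h)) (\<tau> j) - F (?c 0) (\<tau> j)) / h - A b (\<tau> j) = (F (?c h) (\<tau> j) - F a (\<tau> j) - h * A b (\<tau> j)) / h"
            using h by (simp add: field_simps)
          then show ?thesis using lt h by (simp add: norm_divide pos_divide_less_eq)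
        qed
        then show "\<exists>s>0. \<forall>h. h \<noteq> 0 \<and> norm (h - 0) < s \<longrightarrow>
            norm ((F (?c (0 + h)) (\<tau> j) - F (?c 0) (\<tau> j)) / h - A b (\<tau> j)) < \<epsilon>"
          using d(1) rN N0 by (intro exI[of _ "min (\<delta> / (N + 1)) (r / (N + 1))"]) auto
      qed
      moreover have "(\<lambda>t. 1 / ?w (?c t) k * ?w (?c t) j) = (\<lambda>t. F (?c t) (\<tau> j))"
        using ratio[OF ab False] by auto
      ultimately show ?thesis by (auto simp: field_differentiable_def)
    qed
  qed
qed

text \<open>Adds a linear combination of two coordinates as a further homogeneous coordinate, so that one
  coordinate is nonzero at both constant loops \<open>0\<close> and \<open>\<infinity>\<close>.\<close>

definition adjoin_coordinate :: "nat \<Rightarrow> nat \<Rightarrow> complex \<Rightarrow> (nat \<Rightarrow> complex) \<Rightarrow> nat option \<Rightarrow> complex" where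
  "adjoin_coordinate k l c w j = (case j of None \<Rightarrow> w k + c * w l | Some i \<Rightarrow> w i)"

text \<open>The new component is a fixed linear combination of old ones, so the same scalar works,
  with a loss of precision by the factor 1 + |c|.\<close>

lemma projectively_regular_adjoin_coordinate:
  assumes "projectively_regular v a"
  shows "projectively_regular (\<lambda>b. adjoin_coordinate k l c (v b)) a"
proof -
  obtain \<kappa> where nz: "\<exists>e>0. \<forall>b. C1_bound (\<lambda>s. b s - a s) e \<longrightarrow> \<kappa> b \<noteq> 0"
    and cont: "\<forall>\<epsilon>>0. \<exists>e>0. \<forall>b. C1_bound (\<lambda>s. b s - a s) e \<longrightarrow> (\<forall>j. cmod (\<kappa> b * v b j - \<kappa> a * v a j) < \<epsilon>)"
    and dif: "\<forall>j b. C1_loop b \<longrightarrow> (\<lambda>t. \<kappa> (\<lambda>s. a s + t * b s) * v (\<lambda>s. a s + t * b s) j) field_differentiable at 0"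
    by (rule projectively_regularE[OF assms])
  show ?thesis
    unfolding projectively_regular_def
  proof (intro exI[of _ \<kappa>] conjI nz allI impI)
    fix \<epsilon> :: real assume eps: "0 < \<epsilon>"
    have c0: "0 < 1 + cmod c" using norm_ge_zero[of c] by linarith
    have e': "0 < \<epsilon> / (1 + cmod c)" using eps c0 by simp
    then obtain e where e: "0 < e" "\<forall>b. C1_bound (\<lambda>s. b s - a s) e \<longrightarrow> (\<forall>j. cmod (\<kappa> b * v b j - \<kappa> a * v a j) < \<epsilon> / (1 + cmod c))"
      using cont by blast
    show "\<exists>e>0. \<forall>b. C1_bound (\<lambda>s. b s - a s) e \<longrightarrow>
        (\<forall>j. cmod (\<kappa> b * adjoin_coordinate k l c (v b) j - \<kappa> a * adjoin_coordinate k l c (v a) j) < \<epsilon>)"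
    proof (intro exI[of _ e] conjI allI impI e(1))
      fix b j assume b: "C1_bound (\<lambda>s. b s - a s) e"
      have lt: "cmod (\<kappa> b * v b i - \<kappa> a * v a i) < \<epsilon> / (1 + cmod c)" for i using e(2) b by blast
      show "cmod (\<kappa> b * adjoin_coordinate k l c (v b) j - \<kappa> a * adjoin_coordinate k l c (v a) j) < \<epsilon>"
      proof (cases j)
        case None
        have "cmod (\<kappa> b * adjoin_coordinate k l c (v b) j - \<kappa> a * adjoin_coordinate k l c (v a) j) =
            cmod ((\<kappa> b * v b k - \<kappa> a * v a k) + c * (\<kappa> b * v b l - \<kappa> a * v a l))"
          by (simp add: None adjoin_coordinate_def algebra_simps)
        also have "\<dots> \<le> cmod (\<kappa> b * v b k - \<kappa> a * v a k) + cmod c * cmod (\<kappa> b * v b l - \<kappa> a * v a l)"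
          using norm_triangle_ineq[of "\<kappa> b * v b k - \<kappa> a * v a k" "c * (\<kappa> b * v b l - \<kappa> a * v a l)"] by (simp add: norm_mult)
        also have "\<dots> < \<epsilon> / (1 + cmod c) + cmod c * (\<epsilon> / (1 + cmod c))"
          using lt by (intro add_less_le_mono mult_left_mono) (auto intro: less_imp_le)
        also have "\<dots> = \<epsilon> / (1 + cmod c) * (1 + cmod c)" by (simp only: distrib_left mult_1_right mult.commute[of "cmod c"])
        also have "\<dots> = \<epsilon>" using c0 by simp
        finally show ?thesis .
      next
        case (Some i)
        have "\<epsilon> / (1 + cmod c) \<le> \<epsilon>" using eps c0 by (simp add: divide_le_eq mult_le_cancel_left1)
        then show ?thesis using lt[of i] by (simp add: Some adjoin_coordinate_def)
      qed
    qed
  next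
    fix j b assume b: "C1_loop b"
    let ?f = "\<lambda>i t. \<kappa> (\<lambda>s. a s + t * b s) * v (\<lambda>s. a s + t * b s) i"
    have d: "?f i field_differentiable at 0" for i using dif b by blast
    show "(\<lambda>t. \<kappa> (\<lambda>s. a s + t * b s) * adjoin_coordinate k l c (v (\<lambda>s. a s + t * b s)) j) field_differentiable at 0"
    proof (cases j)
      case None
      have "(\<lambda>t. ?f k t + c * ?f l t) field_differentiable at 0"
        by (intro field_differentiable_add field_differentiable_mult field_differentiable_const d)
      then show ?thesis by (simp add: None adjoin_coordinate_def algebra_simps)
    next
      case (Some i)
      then show ?thesis using d[of i] by (simp add: adjoin_coordinate_def)
    qed
  qed
qed

text \<open>Each condition fails for at most one value of \<open>c\<close>, so one of 0, 1, 2
  satisfies both.\<close>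

lemma avoid_two_zeros:
  fixes p q p' q' :: complex
  assumes "p \<noteq> 0" "q' \<noteq> 0"
  shows "\<exists>c. p + c * q \<noteq> 0 \<and> p' + c * q' \<noteq> 0"
proof (cases "p' = 0")
  case True
  show ?thesis
  proof (cases "p + q = 0")
    case True': True
    then have "q = - p" by (simp add: eq_neg_iff_add_eq_0 add.commute)
    then show ?thesis using assms True by (intro exI[of _ 2]) simp
  next
    case False
    then show ?thesis using assms True by (intro exI[of _ 1]) auto
  qed
next
  case False
  then show ?thesis using assms by (intro exI[of _ 0]) auto
qed

theorem mainTheorem2:
  shows "\<not> (\<exists>M. closed_submanifold proj_l2 M \<and>
              biholomorphic_to_submanifold loop_space_P1 proj_l2 M)"
proof
  assume "\<exists>M. closed_submanifold proj_l2 M \<and> biholomorphic_to_submanifold loop_space_P1 proj_l2 M"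
  then obtain M f where M: "closed_submanifold proj_l2 M"
    and bij: "bij_betw f (topspace (mtop loop_space_P1)) M"
    and hol: "holomorphic_map loop_space_P1 proj_l2 (topspace (mtop loop_space_P1)) f"
    unfolding biholomorphic_to_submanifold_def by blast
  have "M \<subseteq> topspace proj_topology"
    using M closedin_subset unfolding closed_submanifold_def proj_l2_def by fastforce
  then have fp: "f p \<in> proj_points" if "p \<in> topspace (mtop loop_space_P1)" for p
    using that bij topspace_proj_topology by (auto simp: bij_betw_def)
  have in_D: "(\<lambda>s. Aff (b s)) \<in> topspace (mtop loop_space_P1)" "(\<lambda>s. at_infinity_param (b s)) \<in> topspace (mtop loop_space_P1)"
    if "C1_loop b" for b
    using affine.loop_in_topspace[OF that] infinity.loop_in_topspace[OF that] by (simp_all add: loop_space_P1_def)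
  let ?v = "loop_image Aff f" and ?w = "loop_image at_infinity_param f"
  have 0: "C1_loop (\<lambda>_. 0)" by (rule C1_loop_const)
  obtain k where k: "?v (\<lambda>_. 0) k \<noteq> 0"
    using representative_in(3)[OF fp[OF in_D(1)[OF 0]]] by (auto simp: loop_image_def)
  obtain l where l: "?w (\<lambda>_. 0) l \<noteq> 0"
    using representative_in(3)[OF fp[OF in_D(2)[OF 0]]] by (auto simp: loop_image_def)
  obtain c where c: "?v (\<lambda>_. 0) k + c * ?v (\<lambda>_. 0) l \<noteq> 0" "?w (\<lambda>_. 0) k + c * ?w (\<lambda>_. 0) l \<noteq> 0"
    using avoid_two_zeros[OF k l] by blast
  interpret projective_loop_map "\<lambda>b. adjoin_coordinate k l c (?v b)" "\<lambda>b. adjoin_coordinate k l c (?w b)" None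
  proof
    show "projectively_regular (\<lambda>b. adjoin_coordinate k l c (?v b)) a" if "C1_loop a" for a
      by (intro projectively_regular_adjoin_coordinate
          projective_loop_map_regular[OF affine.sphere_coordinate_axioms hol fp] that)
    show "projectively_regular (\<lambda>b. adjoin_coordinate k l c (?w b)) (\<lambda>_. 0)"
      by (intro projectively_regular_adjoin_coordinate
          projective_loop_map_regular[OF infinity.sphere_coordinate_axioms hol fp] 0)
    show "\<exists>j. adjoin_coordinate k l c (?v a) j \<noteq> 0" if a: "C1_loop a" for a
    proof -
      obtain i where "?v a i \<noteq> 0"
        using representative_in(3)[OF fp[OF in_D(1)[OF a]]] by (auto simp: loop_image_def)
      then show ?thesis by (intro exI[of _ "Some i"]) (simp add: adjoin_coordinate_def)
    qed
    show "\<exists>e. e \<noteq> 0 \<and> (\<forall>j. adjoin_coordinate k l c (?w (\<lambda>s. 1 / a s)) j = e * adjoin_coordinate k l c (?v a) j)"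
      if "\<And>s. a s \<noteq> 0" for a
    proof -
      \<comment> \<open>For an invertible loop both parametrizations describe the same point of the
        loop space, so the homogeneous coordinates agree and the factor is 1.\<close>
      have "(\<lambda>s. at_infinity_param (1 / a s)) = (\<lambda>s. Aff (a s))" using that by (simp add: at_infinity_param_def)
      then show ?thesis by (intro exI[of _ 1]) (simp add: loop_image_def)
    qed
  qed (use c in \<open>simp_all add: adjoin_coordinate_def\<close>)
  obtain a b e where ab: "C1_loop a" "C1_loop b" "a \<noteq> b" and e: "e \<noteq> 0"
    and eq: "\<forall>j. adjoin_coordinate k l c (?v a) j = e * adjoin_coordinate k l c (?v b) j"
    using not_injective by blast
  \<comment> \<open>The original components sit at the indices \<open>Some j\<close>, so
    proportionality survives when the adjoined one is forgotten.\<close>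
  have "representative (f (\<lambda>s. Aff (a s))) j = e * representative (f (\<lambda>s. Aff (b s))) j" for j
    using eq[rule_format, of "Some j"] by (simp add: adjoin_coordinate_def loop_image_def)
  then have "f (\<lambda>s. Aff (a s)) = f (\<lambda>s. Aff (b s))"
    by (intro proj_points_eqI[OF fp[OF in_D(1)[OF ab(1)]] fp[OF in_D(1)[OF ab(2)]] e])
  then have "(\<lambda>s. Aff (a s)) = (\<lambda>s. Aff (b s))"
    using bij in_D(1)[OF ab(1)] in_D(1)[OF ab(2)] by (auto simp: bij_betw_def dest: inj_onD)
  then show False using ab(3) by (auto simp: fun_eq_iff)
qed

end
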